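(* Let $\mathcal N\equiv\mathcal N^{A'\to B}$ be a quantum channel and let $0<\varepsilon\le1$. The one-shot $\varepsilon$-error quantum capacity of $\mathcal N$ satisfies $$\max_{\mathcal M\subseteq\mathcal H_A}\left[-H_{\max}^{\delta}(A|B)_{\psi_{\mathcal M}}\right]+2\log\delta'\ \le\ Q^{(1)}_\varepsilon(\mathcal N)\ \le\ \max_{\mathcal M\subseteq\mathcal H_A}\left[-H_{\max}^{\varepsilon}(A|B)_{\psi_{\mathcal M}}\right]$$ for some $\delta>0$ such that $\varepsilon=2\sqrt{5\delta'}+2\sqrt\delta$, where $\delta'=\delta+\sqrt{4\sqrt\delta-4\delta}$. Here $\mathcal M$ ranges over (nonzero) subspaces of $\mathcal H_A\simeq\mathcal H_{A'}$, and $$|\psi_{\mathcal M}\rangle^{ABE}:=(\mathbb I_A\otimes U_{\mathcal N}^{A'\to BE})|\Phi_{\mathcal M}^{AA'}\rangle,$$ where $U_{\mathcal N}^{A'\to BE}$ is a Stinespring isometry realizing $\mathcal N$ and $|\Phi^{AA'}_{\mathcal M}\rangle$ is a maximally entangled state of rank $m=\dim\mathcal M$ in $\mathcal H_A\otimes\mathcal H_{A'}$ supported on $\mathcal M\otimes\mathcal M'$.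
   Context: All Hilbert spaces are finite-dimensional; logarithms are to base 2. A quantum channel is a CPTP map. $\mathcal D(\mathcal H)$ is the set of states (positive operators of trace 1) and $\mathcal D_\le(\mathcal H)$ the set of subnormalized states (positive operators of trace $\le1$). Fix an identification $\mathcal H_A\simeq\mathcal H_{A'}$; for a subspace $\mathcal M\subseteq\mathcal H_A$ let $\mathcal M'\subseteq\mathcal H_{A'}$ be the corresponding subspace. With orthonormal bases $\{|i^A\rangle\}$ of $\mathcal M$ and $\{|i^{A'}\rangle\}$ of $\mathcal M'$, $|\Phi_{\mathcal M}^{AA'}\rangle=\frac1{\sqrt m}\sum_{i=1}^m|i^A\rangle\otimes|i^{A'}\rangle$, $m=\dim\mathcal M$; $\Phi_{\mathcal M}$ also denotes the corresponding projector. One-shot $\varepsilon$-error quantum capacity: $$Q^{(1)}_\varepsilon(\mathcal N):=\max\{\log m:\mathsf F_{\mathrm{ent}}(\mathcal N;m)\ge1-\varepsilon^2\},$$ $$\mathsf F_{\mathrm{ent}}(\mathcal N;m):=\max_{\mathcal M\subseteq\mathcal H_A,\ \dim\mathcal M=m}\ \max_{\mathcal D}\ \langle\Phi_{\mathcal M}^{AA'}|(\mathrm{id}_A\otimes\mathcal D\circ\mathcal N)(\Phi_{\mathcal M}^{AA'})|\Phi_{\mathcal M}^{AA'}\rangle,$$ where $\mathcal D=\mathcal D^{B\to A'}$ ranges over decoding CPTP maps. Entropies. Fidelity: $F(\rho,\sigma)=\|\sqrt\rho\sqrt\sigma\|_1$. $D_{\max}(\rho\|\sigma)=\log\min\{\lambda:\rho\le\lambda\sigma\}$.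 For $\rho^{AB}\in\mathcal D_\le(\mathcal H_A\otimes\mathcal H_B)$, $H_{\min}(A|B)_\rho=\max_{\sigma^B\in\mathcal D(\mathcal H_B)}[-D_{\max}(\rho^{AB}\|\mathbb I_A\otimes\sigma^B)]$. For $\rho\in\mathcal D(\mathcal H)$ and $0\le\epsilon\le1$, $\mathcal B^\epsilon(\rho)=\{\overline\rho\in\mathcal D_\le(\mathcal H):F^2(\overline\rho,\rho)\ge1-\epsilon^2\}$, and $H_{\min}^\epsilon(A|B)_\rho=\max_{\overline\rho^{AB}\in\mathcal B^\epsilon(\rho^{AB})}H_{\min}(A|B)_{\overline\rho}$. The smooth max-entropy is defined by duality: for a pure state $\rho^{ABC}$, $H_{\max}^\epsilon(A|C)_\rho:=-H_{\min}^\epsilon(A|B)_\rho$. Equivalently, $H_{\max}^\epsilon(A|B)_\rho=\min_{\overline\rho^{AB}\in\mathcal B^\epsilon(\rho^{AB})}\max_{\sigma^B\in\mathcal D(\mathcal H_B)}2\log F(\overline\rho^{AB},\mathbb I_A\otimes\sigma^B)$. *)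

theory Defs
  imports "HOL-Analysis.Analysis"
begin

(* A finite-dimensional Hilbert space is complex^'n, a tensor product is indexed by the
   product of the index types. Subspaces and dimensions are the complex ones
   (vec.subspace, vec.dim, vec.span), not the real ones of the same name. *)

definition cinner :: "complex^'n \<Rightarrow> complex^'n \<Rightarrow> complex" where
  "cinner x y = (\<Sum>i\<in>UNIV. cnj (x $ i) * y $ i)"

definition dagger :: "complex^'n^'m \<Rightarrow> complex^'m^'n" where
  "dagger A = (\<chi> i j. cnj (A $ j $ i))"

definition proj :: "complex^'n \<Rightarrow> complex^'n^'n" where
  "proj x = (\<chi> i j. x $ i * cnj (x $ j))"

definition tensor_vec ::
  "complex^'m \<Rightarrow> complex^'n \<Rightarrow> complex^('m::finite \<times> 'n::finite)" where
  "tensor_vec x y = (\<chi> p. x $ fst p * y $ snd p)"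

definition tensor_mat ::
  "complex^'m^'k \<Rightarrow> complex^'n^'l
    \<Rightarrow> complex^('m::finite \<times> 'n::finite)^('k::finite \<times> 'l::finite)" where
  "tensor_mat A B = (\<chi> p q. A $ fst p $ fst q * B $ snd p $ snd q)"

definition ptrace_snd ::
  "complex^('m::finite \<times> 'n::finite)^('m \<times> 'n) \<Rightarrow> complex^'m^'m" where
  "ptrace_snd X = (\<chi> i j. \<Sum>k\<in>UNIV. X $ (i, k) $ (j, k))"

definition ptrace_mid ::
  "complex^('a::finite \<times> ('b::finite \<times> 'e::finite))^('a \<times> ('b \<times> 'e))
    \<Rightarrow> complex^('a \<times> 'e)^('a \<times> 'e)" where
  "ptrace_mid X = (\<chi> p q. \<Sum>b\<in>UNIV. X $ (fst p, b, snd p) $ (fst q, b, snd q))"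

text \<open>Positivity of the quadratic form over the complex numbers includes hermiticity.\<close>

definition psd :: "complex^'n^'n \<Rightarrow> bool" where
  "psd A \<longleftrightarrow> (\<forall>x. cinner x (A *v x) \<in> \<real>\<^sub>\<ge>\<^sub>0)"

definition op_le :: "complex^'n^'n \<Rightarrow> complex^'n^'n \<Rightarrow> bool" where
  "op_le A B \<longleftrightarrow> psd (B - A)"

definition state :: "complex^'n^'n \<Rightarrow> bool" where
  "state \<rho> \<longleftrightarrow> psd \<rho> \<and> trace \<rho> = 1"

definition substate :: "complex^'n^'n \<Rightarrow> bool" where
  "substate \<rho> \<longleftrightarrow> psd \<rho> \<and> Re (trace \<rho>) \<le> 1"

definition op_sqrt :: "complex^'n^'n \<Rightarrow> complex^'n^'n" where
  "op_sqrt A = (THE S. psd S \<and> S ** S = A)"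

definition trace_norm :: "complex^'n^'n \<Rightarrow> real" where
  "trace_norm A = Re (trace (op_sqrt (dagger A ** A)))"

definition fidelity :: "complex^'n^'n \<Rightarrow> complex^'n^'n \<Rightarrow> real" where
  "fidelity \<rho> \<sigma> = trace_norm (op_sqrt \<rho> ** op_sqrt \<sigma>)"

definition clinear_map :: "(complex^'m^'m \<Rightarrow> complex^'n^'n) \<Rightarrow> bool" where
  "clinear_map \<Psi> \<longleftrightarrow> (\<forall>X Y. \<Psi> (X + Y) = \<Psi> X + \<Psi> Y) \<and>
    (\<forall>c X. \<Psi> (map_matrix ((*) c) X) = map_matrix ((*) c) (\<Psi> X))"

text \<open>An operator on the tensor product of an \<open>n\<close>-dimensional ancilla with the system is a block
  matrix \<open>(X i j)\<close> with \<open>i, j < n\<close>, a vector is a family \<open>v i\<close> with \<open>i < n\<close>, and the map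
  \<open>id \<otimes> \<Psi>\<close> acts on each block. Complete positivity is positivity of \<open>id \<otimes> \<Psi>\<close> for all \<open>n\<close>.\<close>

definition block_psd :: "nat \<Rightarrow> (nat \<Rightarrow> nat \<Rightarrow> complex^'n^'n) \<Rightarrow> bool" where
  "block_psd n X \<longleftrightarrow>
    (\<forall>v. (\<Sum>i<n. \<Sum>j<n. cinner (v i) (X i j *v v j)) \<in> \<real>\<^sub>\<ge>\<^sub>0)"

definition completely_positive :: "(complex^'m^'m \<Rightarrow> complex^'n^'n) \<Rightarrow> bool" where
  "completely_positive \<Psi> \<longleftrightarrow>
    (\<forall>n X. block_psd n X \<longrightarrow> block_psd n (\<lambda>i j. \<Psi> (X i j)))"

definition quantum_channel :: "(complex^'m^'m \<Rightarrow> complex^'n^'n) \<Rightarrow> bool" where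
  "quantum_channel \<Psi> \<longleftrightarrow>
    clinear_map \<Psi> \<and> completely_positive \<Psi> \<and> (\<forall>X. trace (\<Psi> X) = trace X)"

definition id_tensor ::
  "(complex^'m^'m \<Rightarrow> complex^'n^'n)
    \<Rightarrow> complex^('a::finite \<times> 'm::finite)^('a \<times> 'm)
    \<Rightarrow> complex^('a \<times> 'n::finite)^('a \<times> 'n)" where
  "id_tensor \<Psi> X =
    (\<chi> p q. \<Psi> (\<chi> i j. X $ (fst p, i) $ (fst q, j)) $ snd p $ snd q)"

definition stinespring_isometry ::
  "complex^'m^('n::finite \<times> 'e::finite) \<Rightarrow> (complex^'m^'m \<Rightarrow> complex^'n^'n) \<Rightarrow> bool" where
  "stinespring_isometry U \<Psi> \<longleftrightarrow>
    dagger U ** U = mat 1 \<and> (\<forall>X. \<Psi> X = ptrace_snd (U ** X ** dagger U))"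

definition orthonormal_basis_of :: "(complex^'n) set \<Rightarrow> (nat \<Rightarrow> complex^'n) \<Rightarrow> bool" where
  "orthonormal_basis_of M b \<longleftrightarrow>
    (\<forall>i<vec.dim M. \<forall>j<vec.dim M. cinner (b i) (b j) = (if i = j then 1 else 0)) \<and>
    vec.span (b ` {..<vec.dim M}) = M"

text \<open>The spaces of \<open>A\<close> and \<open>A'\<close> are identified by having the same index type, so \<open>M'\<close> is \<open>M\<close>.
  The two bases are independent; different choices give different vectors \<open>\<phi>\<close>.\<close>

definition max_entangled :: "(complex^'n) set \<Rightarrow> complex^('n::finite \<times> 'n) \<Rightarrow> bool" where
  "max_entangled M \<phi> \<longleftrightarrow>
    (\<exists>b b'. orthonormal_basis_of M b \<and> orthonormal_basis_of M b' \<and>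
      \<phi> = (1 / sqrt (real (vec.dim M))) *\<^sub>R (\<Sum>i<vec.dim M. tensor_vec (b i) (b' i)))"

text \<open>Below, \<open>\<Phi>\<close> is the chosen assignment of a maximally entangled vector to each subspace.\<close>

definition ent_fidelity ::
  "((complex^'a) set \<Rightarrow> complex^('a::finite \<times> 'a)) \<Rightarrow>
    (complex^'a^'a \<Rightarrow> complex^'b^'b) \<Rightarrow> nat \<Rightarrow> real" where
  "ent_fidelity \<Phi> N m =
    Sup {Re (cinner (\<Phi> M) (id_tensor (D \<circ> N) (proj (\<Phi> M)) *v \<Phi> M)) | M D.
      vec.subspace M \<and> vec.dim M = m \<and> quantum_channel D}"

definition one_shot_capacity ::
  "((complex^'a) set \<Rightarrow> complex^('a::finite \<times> 'a)) \<Rightarrow>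
    (complex^'a^'a \<Rightarrow> complex^'b^'b) \<Rightarrow> real \<Rightarrow> real" where
  "one_shot_capacity \<Phi> N \<epsilon> =
    Max {log 2 (real m) | m. 1 \<le> m \<and> m \<le> CARD('a) \<and> ent_fidelity \<Phi> N m \<ge> 1 - \<epsilon>\<^sup>2}"

text \<open>Entropies are extended reals, with \<open>log 0 = -\<infinity>\<close>; for instance the zero operator is a
  subnormalized state, and has min-entropy \<open>\<infinity>\<close>.\<close>

definition elog2 :: "real \<Rightarrow> ereal" where
  "elog2 x = (if x \<le> 0 then -\<infinity> else ereal (log 2 x))"

definition Dmax :: "complex^'n^'n \<Rightarrow> complex^'n^'n \<Rightarrow> ereal" where
  "Dmax \<rho> \<sigma> =
    (if \<exists>l\<ge>0. op_le \<rho> (l *\<^sub>R \<sigma>) then elog2 (Inf {l. 0 \<le> l \<and> op_le \<rho> (l *\<^sub>R \<sigma>)}) else \<infinity>)"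

definition Hmin :: "complex^('a::finite \<times> 'b::finite)^('a \<times> 'b) \<Rightarrow> ereal" where
  "Hmin \<rho> = (SUP \<sigma>\<in>{\<sigma>. state \<sigma>}. - Dmax \<rho> (tensor_mat (mat 1 :: complex^'a^'a) \<sigma>))"

definition smoothing_ball :: "real \<Rightarrow> complex^'n^'n \<Rightarrow> (complex^'n^'n) set" where
  "smoothing_ball \<epsilon> \<rho> = {\<rho>'. substate \<rho>' \<and> (fidelity \<rho>' \<rho>)\<^sup>2 \<ge> 1 - \<epsilon>\<^sup>2}"

definition smooth_Hmin ::
  "real \<Rightarrow> complex^('a::finite \<times> 'b::finite)^('a \<times> 'b) \<Rightarrow> ereal" where
  "smooth_Hmin \<epsilon> \<rho> = (SUP \<rho>'\<in>smoothing_ball \<epsilon> \<rho>. Hmin \<rho>')"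

text \<open>The smooth max-entropy of \<open>A\<close> given \<open>B\<close> for a pure state on \<open>ABE\<close> with vector \<open>\<psi>\<close>,
  defined by duality as minus the smooth min-entropy of \<open>A\<close> given \<open>E\<close>.\<close>

definition smooth_Hmax ::
  "real \<Rightarrow> complex^('a::finite \<times> ('b::finite \<times> 'e::finite)) \<Rightarrow> ereal" where
  "smooth_Hmax \<epsilon> \<psi> = - smooth_Hmin \<epsilon> (ptrace_mid (proj \<psi>))"

definition channel_vec ::
  "complex^'a^('b::finite \<times> 'e::finite) \<Rightarrow> complex^('a::finite \<times> 'a)
    \<Rightarrow> complex^('a \<times> ('b \<times> 'e))" where
  "channel_vec U \<phi> = tensor_mat (mat 1 :: complex^'a^'a) U *v \<phi>"

end

(* Converse: an isometry implementing the decoder turns the channel output into a purification of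
   the reference-environment state. Projecting it onto the maximally entangled vector and
   normalising leaves a product vector, whose marginal is pi_M (x) chi; by Uhlmann's theorem it is
   eps-close to the true marginal, and its conditional min-entropy is at least log m.

   Achievability: let rho' be close to the reference-environment state of M and rho' <= kappa I (x) sigma.
   For a random s-dimensional subspace of M (a random subset of a Fourier basis twisted by random fourth
   roots of unity), a second-moment estimate in the Hilbert-Schmidt norm weighted by sigma^-1 bounds
   the state of the code by G = pi_S (x) rho'_E + Q with tr Q <= 2 sqrt (s kappa) + O(delta).
   A common operator bound G on two states gives an explicit contraction between their
   purifications of overlap at least 1 - 2 tr Q, which is the decoder. With s about delta'^2 / kappa
   the infidelity is at most 16 delta' <= 20 delta' <= eps^2. *)

theory Submission
  imports Defs
begin

text \<open>Distances between states are replaced by one-sided operator inequalities. A decoder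
  exists as soon as the code state and an ideal product state lie below a common operator
  \<open>G\<close> whose trace exceeds that of the ideal state only slightly. The smoothing error
  can therefore travel as a positive summand \<open>W\<close>: it is never decoupled, and thinning
  to a random code does not raise its expected trace. For the same reason the smoothed state may be
  subnormalized and need not be supported on the subspace. All randomness is over finite sets, so
  every existence claim is a finite average. Phases and subset do different jobs: the phases bring
  the diagonal blocks of one full basis close to the environment marginal in mean square, the subset
  thins this basis to \<open>s\<close> vectors. One subset must serve the decoupling error and the
  trace of \<open>W\<close> at once, hence a single weighted objective. The relation between
  \<epsilon>, \<delta> and \<delta>' enters the estimates through
  \<open>11 * \<delta> \<le> \<delta>'\<close>, \<open>\<delta>' \<le> 1 / 20\<close> and
  \<open>20 * \<delta>' \<le> \<epsilon>\<^sup>2\<close>.\<close>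

section \<open>Complex inner product, adjoints and the Hilbert-Schmidt inner product\<close>

lemma cinner_add_left: "cinner (x + y) z = cinner x z + cinner y z"
  and cinner_add_right: "cinner z (x + y) = cinner z x + cinner z y"
  and cinner_diff_right: "cinner z (x - y) = cinner z x - cinner z y"
  by (simp_all add: cinner_def algebra_simps sum.distrib sum_subtractf)

lemma cinner_scale_left: "cinner (c *s x) y = cnj c * cinner x y"
  and cinner_scale_right: "cinner x (c *s y) = c * cinner x y"
  by (simp_all add: cinner_def sum_distrib_left mult_ac)

lemma cinner_zero [simp]: "cinner 0 x = 0" "cinner x 0 = 0"
  by (simp_all add: cinner_def)

lemma cinner_sum_left: "cinner (sum f S) y = (\<Sum>i\<in>S. cinner (f i) y)"
  by (induction S rule: infinite_finite_induct) (simp_all add: cinner_add_left)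

lemma cinner_sum_right: "cinner y (sum f S) = (\<Sum>i\<in>S. cinner y (f i))"
  by (induction S rule: infinite_finite_induct) (simp_all add: cinner_add_right)

lemma cnj_cinner: "cnj (cinner x y) = cinner y x"
  by (simp add: cinner_def mult.commute)

lemma Re_cinner: "Re (cinner x y) = inner x y"
  by (simp add: cinner_def inner_vec_def inner_complex_def)

lemma cinner_self: "cinner x x = of_real ((norm x)\<^sup>2)"
  by (rule complex_eqI)
    (simp_all add: Re_cinner power2_norm_eq_inner, simp add: cinner_def)

lemma cinner_axis: "cinner (axis i 1) x = x $ i"
proof -
  have "cinner (axis i 1) x = (\<Sum>j\<in>UNIV. if j = i then x $ j else 0)"
    unfolding cinner_def by (rule sum.cong) (auto simp: axis_def)
  then show ?thesis by simp
qed

lemma matrix_vector_axis: "(A *v axis j 1) $ i = A $ i $ j" for A :: "complex^'n^'m"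
proof -
  have "(A *v axis j 1) $ i = (\<Sum>k\<in>UNIV. if k = j then A $ i $ k else 0)"
      unfolding matrix_vector_mult_def vec_lambda_beta by (rule sum.cong) (auto simp: axis_def)
  then show ?thesis by simp
qed

lemma cinner_axis_axis: "cinner (axis i 1) (A *v axis j 1) = A $ i $ j" for A :: "complex^'n^'m"
  by (simp add: cinner_axis matrix_vector_axis)

lemma dagger_dagger [simp]: "dagger (dagger A) = A"
  by (simp add: dagger_def vec_eq_iff)

lemma dagger_mult: "dagger (A ** B) = dagger B ** dagger A"
  by (simp add: dagger_def matrix_matrix_mult_def vec_eq_iff mult.commute)

lemma dagger_add: "dagger (A + B) = dagger A + dagger B"
  and dagger_diff: "dagger (A - B) = dagger A - dagger B"
  and dagger_scaleR: "dagger (r *\<^sub>R A) = r *\<^sub>R dagger A"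
  and dagger_zero [simp]: "dagger 0 = 0"
  by (simp_all add: dagger_def vec_eq_iff)

lemma dagger_mat_1 [simp]: "dagger (mat 1) = mat 1"
  by (simp add: dagger_def mat_def vec_eq_iff)

lemma dagger_sum: "dagger (sum f S) = (\<Sum>i\<in>S. dagger (f i))"
  by (induction S rule: infinite_finite_induct) (simp_all add: dagger_add)

lemma cinner_dagger: "cinner x (A *v y) = cinner (dagger A *v x) y"
proof -
  have "cinner x (A *v y) = (\<Sum>i\<in>UNIV. \<Sum>j\<in>UNIV. cnj (x $ i) * (A $ i $ j * y $ j))"
    by (simp add: cinner_def matrix_vector_mult_def sum_distrib_left)
  also have "\<dots> = (\<Sum>j\<in>UNIV. \<Sum>i\<in>UNIV. cnj (x $ i) * (A $ i $ j * y $ j))"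
    by (rule sum.swap)
  also have "\<dots> = cinner (dagger A *v x) y"
    by (simp add: cinner_def matrix_vector_mult_def dagger_def sum_distrib_left sum_distrib_right mult_ac)
  finally show ?thesis .
qed

lemma matrix_scaleR_left: "(r *\<^sub>R A) ** B = r *\<^sub>R (A ** B)"
  and matrix_scaleR_right: "A ** (r *\<^sub>R B) = r *\<^sub>R (A ** B)" for A :: "complex^'n^'m"
  by (simp_all add: matrix_matrix_mult_def vec_eq_iff scaleR_sum_right)

lemma matrix_vector_scaleR_left: "(r *\<^sub>R A) *v x = r *\<^sub>R (A *v x)" for A :: "complex^'n^'m"
  by (simp add: matrix_vector_mult_def vec_eq_iff scaleR_sum_right)

lemma matrix_diff_ldistrib: "A ** (B - C) = A ** B - A ** C"
  and matrix_diff_rdistrib: "(B - C) ** D = B ** D - C ** D"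
  for A :: "complex^'n^'m" and D :: "complex^'k^'l"
  by (simp_all add: matrix_matrix_mult_def vec_eq_iff algebra_simps sum_subtractf)

lemma matrix_zero_mult [simp]: "0 ** A = 0" "B ** 0 = 0" for A :: "complex^'n^'m" and B :: "complex^'k^'l"
  by (simp_all add: matrix_matrix_mult_def vec_eq_iff)

lemma matrix_mult_add_rdistrib: "(B + C) ** A = B ** A + C ** A" for A :: "complex^'n^'m"
  by (simp add: matrix_matrix_mult_def vec_eq_iff algebra_simps sum.distrib)

lemma matrix_sum_left: "(sum f S) ** B = (\<Sum>i\<in>S. f i ** B)" for B :: "complex^'n^'m"
  by (induction S rule: infinite_finite_induct) (simp_all add: matrix_mult_add_rdistrib)

lemma matrix_sum_right: "B ** (sum f S) = (\<Sum>i\<in>S. B ** f i)" for B :: "complex^'n^'m"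
  by (induction S rule: infinite_finite_induct) (simp_all add: matrix_add_ldistrib)

lemma matrix_vector_sum_left: "(sum f S) *v x = (\<Sum>i\<in>S. f i *v x)" for x :: "complex^'n"
  by (induction S rule: infinite_finite_induct) (simp_all add: matrix_vector_mult_add_rdistrib)

lemma matrix_vector_sum_right: "A *v (sum f S) = (\<Sum>i\<in>S. A *v f i)" for A :: "complex^'n^'m"
  by (induction S rule: infinite_finite_induct) (simp_all add: matrix_vector_right_distrib)

lemma trace_mult_commute: "trace (A ** B) = trace (B ** A)"
  for A :: "complex^'n^'m" and B :: "complex^'m^'n"
proof -
  have "trace (A ** B) = (\<Sum>i\<in>UNIV. \<Sum>j\<in>UNIV. A $ i $ j * B $ j $ i)"
    by (simp add: trace_def matrix_matrix_mult_def)
  also have "\<dots> = (\<Sum>j\<in>UNIV. \<Sum>i\<in>UNIV. A $ i $ j * B $ j $ i)" by (rule sum.swap)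
  also have "\<dots> = trace (B ** A)" by (simp add: trace_def matrix_matrix_mult_def mult.commute)
  finally show ?thesis .
qed

lemma trace_scaleR: "trace (r *\<^sub>R A) = r *\<^sub>R trace A" for A :: "complex^'n^'n"
  by (simp add: trace_def scaleR_sum_right)

lemma trace_sum: "trace (sum f S) = (\<Sum>i\<in>S. trace (f i))" for f :: "_ \<Rightarrow> complex^'n^'n"
  by (induction S rule: infinite_finite_induct) (simp_all add: trace_add, simp_all add: trace_def)

lemma trace_dagger: "trace (dagger A) = cnj (trace A)"
  by (simp add: trace_def dagger_def)

text \<open>On matrices \<open>inner\<close> is the real part of the Hilbert-Schmidt inner product,
  so \<open>norm\<close> of a matrix always means the Hilbert-Schmidt norm, never the operator
  norm.\<close>

lemma inner_eq_trace: "inner A B = Re (trace (dagger A ** B))" for A B :: "complex^'n^'m"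
proof -
  have "inner A B = (\<Sum>i\<in>UNIV. \<Sum>j\<in>UNIV. Re (cnj (A $ i $ j) * B $ i $ j))"
    by (simp add: inner_vec_def inner_complex_def)
  also have "\<dots> = (\<Sum>j\<in>UNIV. \<Sum>i\<in>UNIV. Re (cnj (A $ i $ j) * B $ i $ j))"
    by (rule sum.swap)
  also have "\<dots> = Re (trace (dagger A ** B))"
    by (simp add: trace_def matrix_matrix_mult_def dagger_def)
  finally show ?thesis .
qed

lemma trace_dagger_mult_self: "trace (dagger A ** A) = of_real ((norm A)\<^sup>2)"
proof (rule complex_eqI)
  show "Re (trace (dagger A ** A)) = Re (of_real ((norm A)\<^sup>2))"
    by (simp add: inner_eq_trace[symmetric] power2_norm_eq_inner)
  have "cnj (trace (dagger A ** A)) = trace (dagger A ** A)"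
    by (subst trace_dagger[symmetric]) (simp add: dagger_mult)
  then have "Im (trace (dagger A ** A)) = 0" by (metis complex_cnj_cancel_iff complex_cnj_one cnj.simps(2) neg_equal_zero)
  then show "Im (trace (dagger A ** A)) = Im (of_real ((norm A)\<^sup>2))" by simp
qed

lemma trace_self_dagger: "trace (A ** dagger A) = of_real ((norm A)\<^sup>2)"
  by (metis trace_dagger_mult_self trace_mult_commute)

lemma norm_dagger [simp]: "norm (dagger A) = norm A"
proof -
  have "complex_of_real ((norm (dagger A))\<^sup>2) = of_real ((norm A)\<^sup>2)"
    using trace_dagger_mult_self[of "dagger A"] trace_self_dagger[of A] by simp
  then show ?thesis by (simp only: of_real_eq_iff) (metis norm_ge_zero power2_eq_iff_nonneg)
qed

lemma inner_mult_left: "inner (A ** B) C = inner B (dagger A ** C)"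
  for A :: "complex^'n^'m" and B :: "complex^'k^'n"
  by (simp add: inner_eq_trace dagger_mult matrix_mul_assoc)

lemma inner_mult_right: "inner (A ** B) C = inner A (C ** dagger B)"
  for A :: "complex^'n^'m" and B :: "complex^'k^'n"
  unfolding inner_eq_trace dagger_mult
  by (metis matrix_mul_assoc trace_mult_commute)

subsection \<open>Positive semidefinite matrices\<close>

text \<open>Polarization. With \<open>a = cinner x (A *v y)\<close> and
  \<open>b = cinner y (A *v x)\<close>, reality of the quadratic form at \<open>x + y\<close> makes
  \<open>a + b\<close> real, and at \<open>x + \<i> *s y\<close> it makes
  \<open>\<i> * (a - b)\<close> real; together these say \<open>a = cnj b\<close>.\<close>

lemma psd_hermitian:
  assumes "psd A" shows "dagger A = A"
proof -
  have r: "cnj (cinner x (A *v x)) = cinner x (A *v x)" for x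
  proof -
    have "cinner x (A *v x) \<in> \<real>\<^sub>\<ge>\<^sub>0" using assms by (simp add: psd_def)
    then obtain c where "cinner x (A *v x) = complex_of_real c" by (auto simp: nonneg_Reals_def)
    then show ?thesis by simp
  qed
  have expand: "cinner (x + y) (A *v (x + y))
      = cinner x (A *v x) + cinner y (A *v y) + (cinner x (A *v y) + cinner y (A *v x))" for x y
    by (simp add: cinner_add_left cinner_add_right matrix_vector_right_distrib)
  have *: "cinner x (A *v y) + cinner y (A *v x) = cnj (cinner x (A *v y)) + cnj (cinner y (A *v x))" for x y
    using r[of "x + y"] unfolding expand complex_cnj_add r[of x] r[of y] add_left_cancel by (rule sym)
  have **: "\<i> * cinner x (A *v y) - \<i> * cinner y (A *v x)
      = - \<i> * cnj (cinner x (A *v y)) + \<i> * cnj (cinner y (A *v x))" for x y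
    using *[of x "\<i> *s y"]
    unfolding vector_scalar_commute cinner_scale_left cinner_scale_right complex_cnj_mult by simp
  have polar: "a = cnj b" if "a + b = cnj a + cnj b" "\<i> * a - \<i> * b = - \<i> * cnj a + \<i> * cnj b" for a b
    using that by (auto simp: complex_eq_iff)
  have "cinner x (A *v y) = cnj (cinner y (A *v x))" for x y
    by (rule polar[OF * **])
  then have "cnj (A $ j $ i) = A $ i $ j" for i j
    unfolding cinner_axis_axis[symmetric] by metis
  then show ?thesis by (simp add: dagger_def vec_eq_iff)
qed

lemma hermitian_quadratic_real:
  assumes "dagger A = A" shows "cinner x (A *v x) = of_real (inner x (A *v x))"
proof -
  have "cnj (cinner x (A *v x)) = cinner x (A *v x)"
    by (metis assms cinner_dagger cnj_cinner)
  then show ?thesis by (metis Re_cinner Reals_cnj_iff of_real_Re)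
qed

lemma psd_iff: "psd A \<longleftrightarrow> dagger A = A \<and> (\<forall>x. 0 \<le> inner x (A *v x))"
proof
  assume "psd A"
  then show "dagger A = A \<and> (\<forall>x. 0 \<le> inner x (A *v x))"
    using psd_hermitian[of A] by (auto simp: psd_def Re_cinner[symmetric] complex_nonneg_Reals_iff)
next
  assume "dagger A = A \<and> (\<forall>x. 0 \<le> inner x (A *v x))"
  then show "psd A" unfolding psd_def using hermitian_quadratic_real by (metis nonneg_Reals_of_real_iff)
qed

lemma psd_self_dagger: "psd (A ** dagger A)"
  unfolding psd_iff
  by (simp add: dagger_mult matrix_vector_mul_assoc[symmetric] Re_cinner[symmetric] cinner_dagger cinner_self)

lemma psd_conj:
  assumes "psd A" shows "psd (B ** A ** dagger B)"
  unfolding psd_iff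
proof (intro conjI allI)
  show "dagger (B ** A ** dagger B) = B ** A ** dagger B"
    by (simp add: dagger_mult psd_hermitian[OF assms] matrix_mul_assoc)
  fix x
  have "inner x ((B ** A ** dagger B) *v x) = inner (dagger B *v x) (A *v (dagger B *v x))"
    by (simp add: Re_cinner[symmetric] matrix_vector_mul_assoc[symmetric] cinner_dagger)
  then show "0 \<le> inner x ((B ** A ** dagger B) *v x)" using assms psd_iff by metis
qed

lemma psd_add: "psd A \<Longrightarrow> psd B \<Longrightarrow> psd (A + B)"
  by (auto simp: psd_iff dagger_add matrix_vector_mult_add_rdistrib inner_add_right)

lemma psd_scaleR: "psd A \<Longrightarrow> 0 \<le> r \<Longrightarrow> psd (r *\<^sub>R A)"
  by (auto simp: psd_iff dagger_scaleR matrix_vector_scaleR_left)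

lemma psd_zero [simp]: "psd 0"
  by (simp add: psd_iff)

lemma psd_mat_1 [simp]: "psd (mat 1)"
  by (simp add: psd_iff)

lemma psd_sum: "(\<And>i. i \<in> S \<Longrightarrow> psd (f i)) \<Longrightarrow> psd (sum f S)"
  by (induction S rule: infinite_finite_induct) (auto intro: psd_add)

lemma trace_eq_sum_quadratic: "Re (trace A) = (\<Sum>i\<in>UNIV. inner (axis i 1) (A *v axis i 1))"
  by (simp add: trace_def Re_cinner[symmetric] cinner_axis_axis)

lemma trace_psd:
  assumes "psd A" shows "0 \<le> Re (trace A)" "trace A = of_real (Re (trace A))"
proof -
  show "0 \<le> Re (trace A)"
    using assms unfolding trace_eq_sum_quadratic psd_iff by (auto intro!: sum_nonneg)
  have "cnj (trace A) = trace A" using psd_hermitian[OF assms] trace_dagger by metis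
  then show "trace A = of_real (Re (trace A))" by (metis Reals_cnj_iff of_real_Re)
qed

lemma op_le_refl [simp]: "op_le A A"
  by (simp add: op_le_def)

lemma op_le_trans: "op_le A B \<Longrightarrow> op_le B C \<Longrightarrow> op_le A C"
  unfolding op_le_def using psd_add[of "B - A" "C - B"] by simp

lemma op_le_add: "op_le A B \<Longrightarrow> op_le C D \<Longrightarrow> op_le (A + C) (B + D)"
  unfolding op_le_def using psd_add[of "B - A" "D - C"] by (simp add: algebra_simps)

lemma op_le_scaleR: "op_le A B \<Longrightarrow> 0 \<le> r \<Longrightarrow> op_le (r *\<^sub>R A) (r *\<^sub>R B)"
  unfolding op_le_def using psd_scaleR[of "B - A" r] by (simp add: algebra_simps)

lemma op_le_conj: "op_le A B \<Longrightarrow> op_le (C ** A ** dagger C) (C ** B ** dagger C)"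
  unfolding op_le_def using psd_conj[of "B - A" C]
  by (simp add: matrix_diff_ldistrib matrix_diff_rdistrib)

lemma op_le_quadratic: "op_le A B \<Longrightarrow> inner x (A *v x) \<le> inner x (B *v x)"
  unfolding op_le_def psd_iff by (simp add: matrix_vector_mult_diff_rdistrib inner_diff_right)

lemma op_le_trace: "op_le A B \<Longrightarrow> Re (trace A) \<le> Re (trace B)"
  unfolding op_le_def using trace_psd(1)[of "B - A"] by (simp add: trace_sub)

lemma op_leI:
  assumes "dagger A = A" "dagger B = B" "\<And>x. inner x (A *v x) \<le> inner x (B *v x)"
  shows "op_le A B"
  using assms by (simp add: op_le_def psd_iff dagger_diff matrix_vector_mult_diff_rdistrib inner_diff_right)

subsection \<open>Contractions\<close>

definition contraction :: "complex^'n^'m \<Rightarrow> bool" where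
  "contraction K \<longleftrightarrow> (\<forall>x. norm (K *v x) \<le> norm x)"

lemma inner_matrix_vector: "inner x (A *v y) = inner (dagger A *v x) y"
  using cinner_dagger[of x A y] Re_cinner by metis

lemma contraction_dagger:
  assumes "contraction K" shows "contraction (dagger K)"
  unfolding contraction_def
proof
  fix y
  have "(norm (dagger K *v y))\<^sup>2 = inner y (K *v (dagger K *v y))"
    by (simp add: power2_norm_eq_inner inner_matrix_vector)
  also have "\<dots> \<le> norm y * norm (K *v (dagger K *v y))" by (rule norm_cauchy_schwarz)
  also have "\<dots> \<le> norm y * norm (dagger K *v y)"
    using assms by (auto simp: contraction_def intro: mult_left_mono)
  finally show "norm (dagger K *v y) \<le> norm y"
    by (cases "dagger K *v y = 0") (auto simp: power2_eq_square)
qed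

lemma contraction_mult: "contraction K \<Longrightarrow> contraction L \<Longrightarrow> contraction (K ** L)"
  unfolding contraction_def by (metis matrix_vector_mul_assoc order_trans)

lemma norm_matrix_columns: "(norm A)\<^sup>2 = (\<Sum>j\<in>UNIV. (norm (A *v axis j 1))\<^sup>2)" for A :: "complex^'n^'m"
proof -
  have "(norm A)\<^sup>2 = (\<Sum>i\<in>UNIV. \<Sum>j\<in>UNIV. (cmod (A $ i $ j))\<^sup>2)"
    by (simp add: norm_vec_def L2_set_def sum_nonneg)
  also have "\<dots> = (\<Sum>j\<in>UNIV. \<Sum>i\<in>UNIV. (cmod (A $ i $ j))\<^sup>2)" by (rule sum.swap)
  also have "\<dots> = (\<Sum>j\<in>UNIV. (norm (A *v axis j 1))\<^sup>2)"
    by (simp add: norm_vec_def L2_set_def sum_nonneg matrix_vector_axis)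
  finally show ?thesis .
qed

lemma norm_mult_bounded:
  fixes K :: "complex^'n^'m" and A :: "complex^'k^'n"
  assumes "\<And>x. (norm (K *v x))\<^sup>2 \<le> c * (norm x)\<^sup>2"
  shows "(norm (K ** A))\<^sup>2 \<le> c * (norm A)\<^sup>2"
  unfolding norm_matrix_columns[of A] norm_matrix_columns[of "K ** A"] sum_distrib_left
  using assms by (intro sum_mono) (simp add: matrix_vector_mul_assoc[symmetric])

lemma contraction_iff_op_le: "contraction K \<longleftrightarrow> op_le (dagger K ** K) (mat 1)"
proof -
  have q: "inner x ((dagger K ** K) *v x) = (norm (K *v x))\<^sup>2" for x
    by (simp add: matrix_vector_mul_assoc[symmetric] inner_matrix_vector power2_norm_eq_inner)
  have "op_le (dagger K ** K) (mat 1) \<longleftrightarrow> (\<forall>x. (norm (K *v x))\<^sup>2 \<le> (norm x)\<^sup>2)"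
    unfolding op_le_def psd_iff
    by (simp add: dagger_diff dagger_mult matrix_vector_mult_diff_rdistrib inner_diff_right q power2_norm_eq_inner)
  then show ?thesis unfolding contraction_def by (simp add: power2_le_iff_abs_le)
qed

subsection \<open>Spectral theorem\<close>

definition diag_mat :: "('n::finite \<Rightarrow> complex) \<Rightarrow> complex^'n^'n" where
  "diag_mat d = (\<chi> i j. if i = j then d i else 0)"

lemma diag_mat_mult: "diag_mat c ** diag_mat d = diag_mat (\<lambda>i. c i * d i)"
proof -
  have "(\<Sum>k\<in>UNIV. (if i = k then c i else 0) * (if k = j then d k else 0))
      = (if i = j then c i * d i else 0)" for i j
  proof -
    have "(\<Sum>k\<in>UNIV. (if i = k then c i else 0) * (if k = j then d k else 0))
      = (\<Sum>k\<in>UNIV. if k = i then (if i = j then c i * d i else 0) else 0)"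
      by (rule sum.cong) auto
    then show ?thesis by simp
  qed
  then show ?thesis by (simp add: diag_mat_def matrix_matrix_mult_def vec_eq_iff)
qed

lemma dagger_diag_mat: "dagger (diag_mat d) = diag_mat (\<lambda>i. cnj (d i))"
  by (simp add: dagger_def diag_mat_def vec_eq_iff)

lemma diag_mat_vector: "(diag_mat d *v x) $ i = d i * x $ i"
proof -
  have "(\<Sum>k\<in>UNIV. (if i = k then d i else 0) * x $ k) = (\<Sum>k\<in>UNIV. if k = i then d i * x $ i else 0)"
    by (rule sum.cong) auto
  then show ?thesis by (simp add: diag_mat_def matrix_vector_mult_def)
qed

lemma psd_diag_mat: "(\<And>i. 0 \<le> d i) \<Longrightarrow> psd (diag_mat (\<lambda>i. complex_of_real (d i)))"
  by (auto simp: psd_iff dagger_diag_mat diag_mat_vector inner_vec_def inner_complex_def algebra_simps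
      intro!: sum_nonneg)

text \<open>One Gram-Schmidt step: \<open>k\<close> vectors cannot span the space, and a vector
  outside their span minus its projection onto it works.\<close>

lemma orthogonal_vector_exists:
  fixes e :: "nat \<Rightarrow> complex^'n"
  assumes "k < CARD('n)" and on: "\<And>i j. i < k \<Longrightarrow> j < k \<Longrightarrow> cinner (e i) (e j) = (if i = j then 1 else 0)"
  obtains x where "x \<noteq> 0" "\<And>i. i < k \<Longrightarrow> cinner (e i) x = 0"
proof -
  have "vec.dim (e ` {..<k}) \<le> card (e ` {..<k})"
    by (rule vec.dim_le_card') simp
  also have "\<dots> \<le> k" using card_image_le[of "{..<k}" e] by simp
  finally have "vec.dim (e ` {..<k}) < CARD('n)" using assms by simp
  then have "vec.span (e ` {..<k}) \<noteq> UNIV"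
    by (metis vec.dim_span vec.dim_UNIV vec_dim_card less_irrefl)
  then obtain y where y: "y \<notin> vec.span (e ` {..<k})" by auto
  define x where "x = y - (\<Sum>i<k. cinner (e i) y *s e i)"
  have s: "(\<Sum>i<k. cinner (e i) y *s e i) \<in> vec.span (e ` {..<k})"
    by (intro vec.span_sum vec.span_scale vec.span_base) auto
  have "x \<noteq> 0" using y s unfolding x_def by auto
  moreover have "cinner (e i) x = 0" if "i < k" for i
  proof -
    have "(\<Sum>j<k. cinner (e j) y * cinner (e i) (e j)) = (\<Sum>j<k. if j = i then cinner (e i) y else 0)"
      using on that by (intro sum.cong) auto
    then show ?thesis using that
      by (simp add: x_def cinner_diff_right cinner_sum_right cinner_scale_right)
  qed
  ultimately show ?thesis using that by blast
qed

lemma norm_scale: "norm (c *s x) = cmod c * norm x" for x :: "complex^'n"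
  by (simp add: norm_vec_def norm_mult L2_set_right_distrib)

lemma scaleR_eq_scale: "r *\<^sub>R x = complex_of_real r *s x" for x :: "complex^'n"
  unfolding vec_eq_iff vector_scaleR_component vector_smult_component by (simp add: scaleR_conv_of_real)

lemma matrix_vector_scaleR_right: "A *v (r *\<^sub>R x) = r *\<^sub>R (A *v x)" for A :: "complex^'n^'m"
  by (simp add: matrix_vector_mult_def vec_eq_iff scaleR_sum_right)

text \<open>The quadratic form attains its maximum on the unit sphere of the orthogonal complement, and a
  maximiser is an eigenvector because the complement is invariant.\<close>

lemma hermitian_next_eigenvector:
  fixes A :: "complex^'n^'n"
  assumes herm: "dagger A = A" and k: "k < CARD('n)"
    and on: "\<And>i j. i < k \<Longrightarrow> j < k \<Longrightarrow> cinner (e i) (e j) = (if i = j then 1 else 0)"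
    and eig: "\<And>i. i < k \<Longrightarrow> A *v e i = complex_of_real (t i) *s e i"
  obtains v r where "norm v = 1" "\<And>i. i < k \<Longrightarrow> cinner (e i) v = 0" "A *v v = complex_of_real r *s v"
proof -
  define W where "W = {x. \<forall>i<k. cinner (e i) x = 0}"
  have W_add: "x + y \<in> W" if "x \<in> W" "y \<in> W" for x y using that by (simp add: W_def cinner_add_right)
  have W_scale: "c *s x \<in> W" if "x \<in> W" for x c using that by (simp add: W_def cinner_scale_right)
  have W_A: "A *v x \<in> W" if "x \<in> W" for x
    using that eig by (auto simp: W_def cinner_dagger herm cinner_scale_left)
  have c_cont: "continuous_on UNIV (\<lambda>x. cinner y x)" for y :: "complex^'n"
    unfolding cinner_def by (intro continuous_intros)
  have A_cont: "continuous_on UNIV (\<lambda>x. A *v x)"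
    unfolding matrix_vector_mult_def by (intro continuous_intros)
  have "W = (\<Inter>i\<in>{..<k}. {x. cinner (e i) x = 0})" by (auto simp: W_def)
  moreover have "closed {x. cinner (e i) x = 0}" for i
    using c_cont[of "e i"] by (intro closed_Collect_eq) auto
  ultimately have "closed W" by auto
  then have comp: "compact (sphere 0 1 \<inter> W)" by (simp add: compact_Int_closed)
  obtain x0 where x0: "x0 \<noteq> 0" "x0 \<in> W"
    using orthogonal_vector_exists[OF k on] unfolding W_def by (smt (verit) mem_Collect_eq)
  have "(1 / norm x0) *\<^sub>R x0 \<in> sphere 0 1 \<inter> W"
    using x0 W_scale by (auto simp: scaleR_eq_scale[of _ x0] norm_scale norm_divide)
  then have ne: "sphere 0 1 \<inter> W \<noteq> {}" by blast
  have "continuous_on (sphere 0 1 \<inter> W) (\<lambda>x. inner x (A *v x))"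
    by (intro continuous_intros continuous_on_subset[OF A_cont]) auto
  then obtain v where v: "v \<in> sphere 0 1 \<inter> W"
    and max: "\<And>x. x \<in> sphere 0 1 \<inter> W \<Longrightarrow> inner x (A *v x) \<le> inner v (A *v v)"
    using continuous_attains_sup[OF comp ne] by blast
  define r where "r = inner v (A *v v)"
  have nv: "norm v = 1" and vW: "v \<in> W" using v by auto
  have ub: "inner x (A *v x) \<le> r * (norm x)\<^sup>2" if "x \<in> W" for x
  proof (cases "x = 0")
    case False
    let ?y = "(1 / norm x) *\<^sub>R x"
    have "?y \<in> sphere 0 1 \<inter> W"
      using that False W_scale by (auto simp: scaleR_eq_scale[of _ x] norm_scale norm_divide)
    from max[OF this] have "inner ?y (A *v ?y) \<le> r" by (simp add: r_def)
    then have "(1 / norm x) * ((1 / norm x) * inner x (A *v x)) \<le> r"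
      by (simp add: matrix_vector_scaleR_right)
    then show ?thesis using False by (simp add: field_simps power2_eq_square)
  qed simp
  define w where "w = r *\<^sub>R v - A *v v"
  have wW: "w \<in> W"
    using W_add[OF W_scale[OF vW, of "of_real r"] W_scale[OF W_A[OF vW], of "-1"]]
    by (simp add: w_def scaleR_eq_scale[of _ v] vector_sneg_minus1[symmetric])
  \<comment> \<open>Compare \<open>v\<close> with the competitor \<open>v + s *\<^sub>R w\<close>.
    The first-order term is \<open>2 * s * (norm w)\<^sup>2\<close>, so a small negative
    \<open>s\<close> contradicts maximality unless \<open>w = 0\<close>.\<close>
  have key: "0 \<le> 2 * s * (norm w)\<^sup>2 + s\<^sup>2 * (r * (norm w)\<^sup>2 - inner w (A *v w))" for s
  proof -
    have "v + s *\<^sub>R w \<in> W" using W_add[OF vW W_scale[OF wW, of "of_real s"]] by (simp add: scaleR_eq_scale)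
    from ub[OF this]
    have "inner (v + s *\<^sub>R w) (A *v (v + s *\<^sub>R w)) \<le> r * inner (v + s *\<^sub>R w) (v + s *\<^sub>R w)"
      by (simp add: power2_norm_eq_inner)
    moreover have Aw: "inner w (A *v v) = inner v (A *v w)"
      by (metis inner_matrix_vector herm inner_commute)
    moreover have "inner v v = 1" using nv by (simp add: power2_norm_eq_inner[symmetric])
    ultimately have le: "r + 2 * s * inner v (A *v w) + s\<^sup>2 * inner w (A *v w)
        \<le> r * (1 + 2 * s * inner v w + s\<^sup>2 * inner w w)"
      by (simp add: r_def[symmetric] matrix_vector_right_distrib matrix_vector_scaleR_right inner_add_left
          inner_add_right inner_commute[of w v] algebra_simps power2_eq_square)
    have "inner w w = r * inner v w - inner v (A *v w)"
      using Aw by (subst (2) w_def) (simp add: inner_diff_right inner_commute)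
    then have "r * inner v w = inner w w + inner v (A *v w)" by simp
    then have "2 * s * (r * inner v w) = 2 * s * (inner w w + inner v (A *v w))" by simp
    then show ?thesis using le by (simp add: power2_norm_eq_inner algebra_simps)
  qed
  have "w = 0"
  proof (rule ccontr)
    assume "w \<noteq> 0"
    define n where "n = (norm w)\<^sup>2"
    define C where "C = r * (norm w)\<^sup>2 - inner w (A *v w)"
    have n: "n > 0" using \<open>w \<noteq> 0\<close> by (simp add: n_def)
    have C: "C \<ge> 0" using ub[OF wW] by (simp add: C_def)
    \<comment> \<open>This size keeps the quadratic term below the linear one, because
      \<open>n * C / (C + 1) \<le> n\<close>; adding 1 covers \<open>C = 0\<close>.\<close>
    define s where "s = - n / (C + 1)"
    have "0 \<le> 2 * s * n + s\<^sup>2 * C" using key[of s] by (simp add: n_def C_def)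
    also have "\<dots> = s * (2 * n + s * C)" by (simp add: algebra_simps power2_eq_square)
    finally have "0 \<le> s * (2 * n + s * C)" .
    moreover have "s < 0" using n C by (simp add: s_def)
    moreover have "2 * n + s * C > 0"
    proof -
      have "n * C / (C + 1) \<le> n" using n C by (simp add: field_simps)
      then show ?thesis using n by (simp add: s_def)
    qed
    ultimately show False by (smt (verit) mult_neg_pos)
  qed
  then have "A *v v = complex_of_real r *s v" by (simp add: w_def scaleR_eq_scale)
  then show ?thesis using that nv vW by (auto simp: W_def)
qed

lemma hermitian_eigenvectors:
  fixes A :: "complex^'n^'n"
  assumes herm: "dagger A = A" and "k \<le> CARD('n)"
  shows "\<exists>e t. (\<forall>i<k. \<forall>j<k. cinner (e i) (e j) = (if i = j then 1 else 0)) \<and>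
    (\<forall>i<k. A *v e i = complex_of_real (t i) *s e i)"
  using assms(2)
proof (induction k)
  case (Suc k)
  then obtain e t where e: "\<And>i j. i < k \<Longrightarrow> j < k \<Longrightarrow> cinner (e i) (e j) = (if i = j then 1 else 0)"
    and t: "\<And>i. i < k \<Longrightarrow> A *v e i = complex_of_real (t i) *s e i" by auto
  obtain v r where v: "norm v = 1" "\<And>i. i < k \<Longrightarrow> cinner (e i) v = 0" "A *v v = complex_of_real r *s v"
    using hermitian_next_eigenvector[OF herm Suc_le_lessD[OF Suc.prems], of e t] e t by metis
  have v': "cinner v (e i) = 0" if "i < k" for i using v(2)[OF that] cnj_cinner by (metis complex_cnj_zero)
  have "cinner v v = 1" using v(1) by (simp add: cinner_self)
  then show ?case using e t v v'
    by (intro exI[of _ "e(k := v)"] exI[of _ "t(k := r)"]) (auto simp: less_Suc_eq)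
qed auto

theorem spectral_theorem:
  fixes A :: "complex^'n^'n"
  assumes "dagger A = A"
  obtains E :: "complex^'n^'n" and t where "dagger E ** E = mat 1" "E ** dagger E = mat 1"
    "A = E ** diag_mat (\<lambda>i. complex_of_real (t i)) ** dagger E"
proof -
  obtain e t where e: "\<And>i j. i < CARD('n) \<Longrightarrow> j < CARD('n) \<Longrightarrow> cinner (e i) (e j) = (if i = j then 1 else 0)"
    and t: "\<And>i. i < CARD('n) \<Longrightarrow> A *v e i = complex_of_real (t i) *s e i"
    using hermitian_eigenvectors[OF assms order_refl] by blast
  obtain h :: "'n \<Rightarrow> nat" where h: "bij_betw h UNIV {0..<CARD('n)}"
    using ex_bij_betw_finite_nat[OF finite, of "UNIV :: 'n set"] by auto
  have hl: "h i < CARD('n)" for i using h by (auto simp: bij_betw_def)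
  have hi: "h i = h j \<longleftrightarrow> i = j" for i j using h by (auto simp: bij_betw_def inj_on_def)
  define E :: "complex^'n^'n" where "E = (\<chi> a i. e (h i) $ a)"
  define T where "T = diag_mat (\<lambda>i. complex_of_real (t (h i)))"
  have 1: "dagger E ** E = mat 1"
    using e[OF hl hl] by (simp add: vec_eq_iff matrix_matrix_mult_def dagger_def E_def cinner_def mat_def hi)
  then have 2: "E ** dagger E = mat 1" using matrix_left_right_inverse by blast
  have "A ** E = E ** T"
  proof -
    have "(\<Sum>k\<in>UNIV. A $ i $ k * e (h j) $ k) = e (h j) $ i * complex_of_real (t (h j))" for i j
      using arg_cong[OF t[OF hl[of j]], of "\<lambda>v. v $ i"] by (simp add: matrix_vector_mult_def mult.commute)
    moreover have "(\<Sum>k\<in>UNIV. e (h k) $ i * (if k = j then complex_of_real (t (h k)) else 0))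
      = e (h j) $ i * complex_of_real (t (h j))" for i j
      by (simp add: if_distrib cong: if_cong)
    ultimately show ?thesis
      by (simp add: vec_eq_iff matrix_matrix_mult_def E_def T_def diag_mat_def)
  qed
  then have "A = E ** T ** dagger E" using 2 by (metis matrix_mul_assoc matrix_mul_rid)
  from that[OF 1 2 this[unfolded T_def]] show ?thesis .
qed

lemma psd_spectral:
  fixes A :: "complex^'n^'n"
  assumes "psd A"
  obtains E :: "complex^'n^'n" and t where "dagger E ** E = mat 1" "E ** dagger E = mat 1" "\<And>i. 0 \<le> t i"
    "A = E ** diag_mat (\<lambda>i. complex_of_real (t i)) ** dagger E"
proof -
  obtain E :: "complex^'n^'n" and t where E: "dagger E ** E = mat 1" "E ** dagger E = mat 1"
    and A: "A = E ** diag_mat (\<lambda>i. complex_of_real (t i)) ** dagger E"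
    by (rule spectral_theorem[OF psd_hermitian[OF assms]], rule that)
  have "diag_mat (\<lambda>i. complex_of_real (t i)) = dagger E ** A ** dagger (dagger E)"
  proof -
    have "dagger E ** (E ** D ** dagger E) ** E = (dagger E ** E) ** D ** (dagger E ** E)" for D
      by (simp only: matrix_mul_assoc)
    note cancel = this[of "diag_mat (\<lambda>i. complex_of_real (t i))", unfolded E(1) matrix_mul_lid matrix_mul_rid]
    show ?thesis by (subst A) (simp only: dagger_dagger cancel)
  qed
  then have "psd (diag_mat (\<lambda>i. complex_of_real (t i)))" using psd_conj[OF assms] by metis
  then have "0 \<le> inner (axis i 1) (diag_mat (\<lambda>i. complex_of_real (t i)) *v axis i 1)" for i
    unfolding psd_iff by blast
  then have "0 \<le> t i" for i
    by (simp add: Re_cinner[symmetric] cinner_axis_axis) (simp add: diag_mat_def)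
  from that[OF E this A] show ?thesis .
qed

lemma unitary_norm: "dagger E ** E = mat 1 \<Longrightarrow> norm (E *v x) = norm x"
  by (metis cinner_self cinner_dagger matrix_vector_mul_assoc matrix_vector_mul_lid norm_eq_sqrt_inner
      Re_cinner)

lemma contraction_diag_mat:
  assumes "\<And>i. cmod (d i) \<le> 1" shows "contraction (diag_mat d)"
  unfolding contraction_def
proof
  fix x
  show "norm (diag_mat d *v x) \<le> norm x"
    unfolding norm_vec_def
    by (rule L2_set_mono) (auto simp: diag_mat_vector norm_mult assms mult_left_le_one_le)
qed

lemma contraction_unitary: "dagger E ** E = mat 1 \<Longrightarrow> contraction E"
  by (simp add: contraction_def unitary_norm)

lemma spectral_mult:
  assumes "dagger E ** E = mat 1"
  shows "(E ** diag_mat c ** dagger E) ** (E ** diag_mat d ** dagger E) = E ** diag_mat (\<lambda>i. c i * d i) ** dagger E"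
proof -
  have "(E ** diag_mat c ** dagger E) ** (E ** diag_mat d ** dagger E)
      = E ** diag_mat c ** (dagger E ** E) ** diag_mat d ** dagger E"
    by (simp only: matrix_mul_assoc)
  also have "\<dots> = E ** (diag_mat c ** diag_mat d) ** dagger E"
    by (simp only: assms matrix_mul_rid matrix_mul_assoc)
  finally show ?thesis by (simp only: diag_mat_mult)
qed

section \<open>Positive square roots, Douglas factorization and polar decomposition\<close>

lemma psd_sqrt_exists:
  fixes A :: "complex^'n^'n"
  assumes "psd A" shows "\<exists>S. psd S \<and> S ** S = A"
proof -
  obtain E :: "complex^'n^'n" and t where E: "dagger E ** E = mat 1" and t: "\<And>i. 0 \<le> t i"
    and A: "A = E ** diag_mat (\<lambda>i. complex_of_real (t i)) ** dagger E"
    by (rule psd_spectral[OF assms], rule that)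
  let ?S = "E ** diag_mat (\<lambda>i. complex_of_real (sqrt (t i))) ** dagger E"
  have "complex_of_real (sqrt (t i)) * complex_of_real (sqrt (t i)) = complex_of_real (t i)" for i
    using t by (simp flip: of_real_mult)
  then have "?S ** ?S = A" by (simp add: spectral_mult[OF E] A)
  moreover have "psd ?S" by (intro psd_conj psd_diag_mat) (simp add: t)
  ultimately show ?thesis by blast
qed

lemma psd_kernel:
  assumes "psd S" "inner v (S *v v) = 0" shows "S *v v = 0"
proof -
  obtain R where R: "psd R" "R ** R = S" using psd_sqrt_exists[OF assms(1)] by blast
  have "inner (R *v v) (R *v v) = 0"
    using assms(2) R psd_hermitian[OF R(1)] by (metis inner_matrix_vector matrix_vector_mul_assoc)
  then have "R *v v = 0" by simp
  then show ?thesis using R(2) by (metis matrix_vector_mul_assoc matrix_vector_mult_0_right)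
qed

text \<open>From \<open>S ** S = T ** T\<close> the difference \<open>H = S - T\<close> satisfies
  \<open>S ** H + H ** T = 0\<close>. On an eigenvector of \<open>H\<close> with nonzero eigenvalue
  this forces both quadratic forms of \<open>S\<close> and \<open>T\<close> to vanish, so both
  matrices kill it, and so does \<open>H\<close>: a contradiction.\<close>

lemma psd_sqrt_unique:
  fixes S T :: "complex^'n^'n"
  assumes S: "psd S" and T: "psd T" and eq: "S ** S = T ** T" shows "S = T"
proof -
  note hS = psd_hermitian[OF S] and hT = psd_hermitian[OF T]
  have herm: "dagger (S - T) = S - T" by (simp add: dagger_diff hS hT)
  obtain E :: "complex^'n^'n" and d where E: "dagger E ** E = mat 1" "E ** dagger E = mat 1"
    and A: "S - T = E ** diag_mat (\<lambda>i. complex_of_real (d i)) ** dagger E"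
    by (rule spectral_theorem[OF herm], rule that)
  have "d i = 0" for i
  proof (rule ccontr)
    assume d: "d i \<noteq> 0"
    define v where "v = E *v axis i 1"
    have Ev: "dagger E *v v = axis i 1" by (simp add: v_def matrix_vector_mul_assoc E)
    have "diag_mat (\<lambda>i. complex_of_real (d i)) *v axis i 1 = d i *\<^sub>R axis i 1"
      unfolding vec_eq_iff vector_scaleR_component diag_mat_vector by (simp add: axis_def scaleR_conv_of_real)
    then have Hv: "(S - T) *v v = d i *\<^sub>R v"
      unfolding A matrix_vector_mul_assoc[symmetric] Ev by (simp add: matrix_vector_scaleR_right v_def)
    have nz: "v \<noteq> 0" using Ev by (metis axis_eq_0_iff matrix_vector_mult_0_right zero_neq_one)
    have "S ** (S - T) + (S - T) ** T = 0"
      by (simp add: matrix_diff_ldistrib matrix_diff_rdistrib eq)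
    then have "0 = inner v ((S ** (S - T) + (S - T) ** T) *v v)" by simp
    also have "\<dots> = inner v (S *v ((S - T) *v v)) + inner ((S - T) *v v) (T *v v)"
      by (simp only: matrix_vector_mult_add_rdistrib inner_add_right matrix_vector_mul_assoc[symmetric]
          inner_matrix_vector[of v "S - T"] herm)
    also have "\<dots> = d i * (inner v (S *v v) + inner v (T *v v))"
      unfolding Hv by (simp add: matrix_vector_scaleR_right distrib_left)
    finally have "inner v (S *v v) + inner v (T *v v) = 0" using d by simp
    moreover have "0 \<le> inner v (S *v v)" "0 \<le> inner v (T *v v)" using S T by (auto simp: psd_iff)
    ultimately have "inner v (S *v v) = 0" "inner v (T *v v) = 0" by linarith+
    then have "S *v v = 0" "T *v v = 0" using psd_kernel S T by blast+
    then have "(S - T) *v v = 0" by (simp add: matrix_vector_mult_diff_rdistrib)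
    then show False using Hv d nz by simp
  qed
  then have "S - T = 0" unfolding A by (simp add: diag_mat_def zero_vec_def[symmetric] cong: if_cong)
  then show ?thesis by simp
qed

lemma
  assumes "psd A"
  shows op_sqrt_psd: "psd (op_sqrt A)" and op_sqrt_mult: "op_sqrt A ** op_sqrt A = A"
proof -
  have "\<exists>!S. psd S \<and> S ** S = A"
    using psd_sqrt_exists[OF assms] psd_sqrt_unique by metis
  from theI'[OF this] show "psd (op_sqrt A)" "op_sqrt A ** op_sqrt A = A"
    unfolding op_sqrt_def by blast+
qed

lemma op_sqrt_hermitian: "psd A \<Longrightarrow> dagger (op_sqrt A) = op_sqrt A"
  by (rule psd_hermitian[OF op_sqrt_psd])

lemma norm_op_sqrt: "psd A \<Longrightarrow> (norm (op_sqrt A))\<^sup>2 = Re (trace A)"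
  using trace_dagger_mult_self[of "op_sqrt A"] by (simp add: op_sqrt_hermitian op_sqrt_mult)

text \<open>\<open>V\<close> is the pseudo-inverse of \<open>S\<close> applied to \<open>X\<close>.
  The operator inequality says \<open>norm (dagger X *v w) \<le> norm (S *v w)\<close>, which makes
  \<open>V\<close> a contraction and shows that \<open>dagger X\<close> vanishes on the kernel of
  \<open>S\<close>, so that nothing is lost by inverting on the support only.\<close>

lemma douglas_factorization:
  fixes S :: "complex^'n^'n" and X :: "complex^'r^'n"
  assumes S: "psd S" and le: "op_le (X ** dagger X) (S ** S)"
  obtains V where "contraction V" "X = S ** V"
proof -
  obtain E :: "complex^'n^'n" and t where E: "dagger E ** E = mat 1" "E ** dagger E = mat 1"
    and t: "\<And>i. 0 \<le> t i" and A: "S = E ** diag_mat (\<lambda>i. complex_of_real (t i)) ** dagger E"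
    by (rule psd_spectral[OF S], rule that)
  define F where "F g = E ** diag_mat g ** dagger E" for g
  have FF: "F f ** F g = F (\<lambda>i. f i * g i)" for f g unfolding F_def by (rule spectral_mult[OF E(1)])
  have SF: "S = F (\<lambda>i. complex_of_real (t i))" unfolding F_def by (rule A)
  have bound: "norm (dagger X *v w) \<le> norm (S *v w)" for w
  proof -
    have "(norm (dagger X *v w))\<^sup>2 = inner w ((X ** dagger X) *v w)"
      by (simp add: matrix_vector_mul_assoc[symmetric] inner_matrix_vector power2_norm_eq_inner)
    also have "\<dots> \<le> inner w ((S ** S) *v w)" by (rule op_le_quadratic[OF le])
    also have "\<dots> = (norm (S *v w))\<^sup>2"
      by (simp add: matrix_vector_mul_assoc[symmetric] inner_matrix_vector power2_norm_eq_inner psd_hermitian[OF S])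
    finally show ?thesis by simp
  qed
  \<comment> \<open>Through the functional calculus \<open>F\<close>, \<open>p\<close> gives the
    pseudo-inverse of \<open>S\<close>, \<open>q\<close> its support projection and \<open>z\<close>
    its kernel projection.\<close>
  define p where "p = (\<lambda>i. complex_of_real (if t i > 0 then 1 / t i else 0))"
  define q where "q = (\<lambda>i. complex_of_real (if t i > 0 then 1 else 0))"
  define z where "z = (\<lambda>i. complex_of_real (if t i > 0 then 0 else 1))"
  have Fp: "dagger (F p) = F p" by (simp add: F_def dagger_mult dagger_diag_mat p_def matrix_mul_assoc)
  have Fz: "dagger (F z) = F z" by (simp add: F_def dagger_mult dagger_diag_mat z_def matrix_mul_assoc)
  have "(\<lambda>i. complex_of_real (t i) * p i) = q" using t by (auto simp: p_def q_def fun_eq_iff)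
  then have SFp: "S ** F p = F q" unfolding SF FF by simp
  have "(\<lambda>i. complex_of_real (t i) * z i) = (\<lambda>i. 0)"
    using t by (auto simp: z_def fun_eq_iff intro: antisym)
  then have SFz: "S ** F z = 0"
    unfolding SF FF by (simp add: F_def diag_mat_def zero_vec_def[symmetric] cong: if_cong)
  have "contraction (diag_mat q)" by (rule contraction_diag_mat) (simp add: q_def)
  moreover have "contraction E" "contraction (dagger E)" using E by (simp_all add: contraction_unitary)
  ultimately have cq: "contraction (F q)" unfolding F_def by (intro contraction_mult)
  have "contraction (dagger X ** F p)"
    unfolding contraction_def matrix_vector_mul_assoc[symmetric]
  proof
    fix x
    have "norm (dagger X *v (F p *v x)) \<le> norm (F q *v x)"
      using bound[of "F p *v x"] by (simp add: matrix_vector_mul_assoc SFp)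
    also have "\<dots> \<le> norm x" using cq by (simp add: contraction_def)
    finally show "norm (dagger X *v (F p *v x)) \<le> norm x" .
  qed
  from contraction_dagger[OF this] have c: "contraction (F p ** X)" by (simp add: dagger_mult Fp)
  have "norm (dagger X *v (F z *v x)) \<le> 0" for x
    using bound[of "F z *v x"] by (simp add: matrix_vector_mul_assoc SFz)
  then have "dagger X ** F z = 0" by (simp add: matrix_eq matrix_vector_mul_assoc)
  then have "F z ** X = 0" using Fz by (metis dagger_dagger dagger_mult dagger_zero)
  moreover have "F q + F z = mat 1"
  proof -
    have "diag_mat q + diag_mat z = mat 1"
      by (auto simp: diag_mat_def mat_def vec_eq_iff q_def z_def)
    then show ?thesis
      unfolding F_def using E(2) by (metis matrix_add_ldistrib matrix_mult_add_rdistrib matrix_mul_rid)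
  qed
  ultimately have "X = S ** (F p ** X)"
    by (metis SFp add.right_neutral matrix_mul_assoc matrix_mul_lid matrix_mult_add_rdistrib)
  with c show ?thesis by (rule that)
qed

text \<open>By cyclicity the trace is the inner product of the square root of \<open>R\<close> with
  its image under \<open>C\<close>; Cauchy-Schwarz does the rest.\<close>

lemma trace_contraction_psd_le:
  assumes "contraction C" "psd R" shows "Re (trace (C ** R)) \<le> Re (trace R)"
proof -
  let ?r = "op_sqrt R"
  have "trace (C ** R) = trace (?r ** (C ** ?r))"
    by (metis op_sqrt_mult[OF assms(2)] matrix_mul_assoc trace_mult_commute)
  then have "Re (trace (C ** R)) = inner ?r (C ** ?r)"
    by (simp add: inner_eq_trace op_sqrt_hermitian[OF assms(2)])
  also have "\<dots> \<le> norm ?r * norm (C ** ?r)" by (rule norm_cauchy_schwarz)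
  also have "\<dots> \<le> norm ?r * norm ?r"
  proof -
    have "(norm (C *v x))\<^sup>2 \<le> 1 * (norm x)\<^sup>2" for x
      using assms(1) by (simp add: contraction_def power_mono)
    from norm_mult_bounded[of C, OF this, of ?r] have "norm (C ** ?r) \<le> norm ?r"
      by (simp add: power2_le_iff_abs_le)
    then show ?thesis by (intro mult_left_mono) auto
  qed
  also have "\<dots> = Re (trace R)" using norm_op_sqrt[OF assms(2)] by (simp add: power2_eq_square)
  finally show ?thesis .
qed

lemma psd_dagger_self: "psd (dagger A ** A)"
  using psd_self_dagger[of "dagger A"] by simp

lemma psd_sandwich_zero:
  assumes "psd Q" "dagger R ** Q ** R = 0" shows "Q ** R = 0"
proof -
  have "Q *v (R *v x) = 0" for x
  proof (rule psd_kernel[OF assms(1)])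
    have "inner (R *v x) (Q *v (R *v x)) = inner x ((dagger R ** Q ** R) *v x)"
      by (simp add: matrix_vector_mul_assoc[symmetric] inner_matrix_vector)
    then show "inner (R *v x) (Q *v (R *v x)) = 0" by (simp add: assms(2))
  qed
  then show ?thesis by (simp add: matrix_eq matrix_vector_mul_assoc[symmetric])
qed

text \<open>Douglas factorization of \<open>dagger M\<close> through
  \<open>op_sqrt (dagger M ** M)\<close> supplies a contraction instead of the usual partial
  isometry. The third claim still holds: the positive defect \<open>mat 1 - V ** dagger V\<close>
  has zero sandwich with that square root, hence annihilates it.\<close>

lemma trace_norm_polar:
  fixes M :: "complex^'n^'n"
  obtains V where "contraction V" "M = dagger V ** op_sqrt (dagger M ** M)" "V ** M = op_sqrt (dagger M ** M)"
proof -
  let ?R = "op_sqrt (dagger M ** M)"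
  note R = op_sqrt_psd[OF psd_dagger_self, of M] and RR = op_sqrt_mult[OF psd_dagger_self, of M]
    and hR = op_sqrt_hermitian[OF psd_dagger_self, of M]
  have "op_le (dagger M ** dagger (dagger M)) (?R ** ?R)" by (simp add: RR)
  then obtain V where V: "contraction V" "dagger M = ?R ** V"
    using douglas_factorization[OF R] by blast
  from V(2) have M: "M = dagger V ** ?R" by (metis dagger_dagger dagger_mult hR)
  have "op_le (V ** dagger V) (mat 1)"
    using contraction_dagger[OF V(1)] by (simp add: contraction_iff_op_le)
  then have Q: "psd (mat 1 - V ** dagger V)" by (simp add: op_le_def)
  have "?R ** (V ** dagger V) ** ?R = dagger M ** M"
    using M V(2) by (metis matrix_mul_assoc)
  then have "dagger ?R ** (mat 1 - V ** dagger V) ** ?R = 0"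
    by (simp add: hR matrix_diff_ldistrib matrix_diff_rdistrib RR)
  from psd_sandwich_zero[OF Q this] have "?R = V ** dagger V ** ?R"
    by (simp add: matrix_diff_rdistrib)
  then have "V ** M = ?R" using M by (metis matrix_mul_assoc)
  with V(1) M show ?thesis by (rule that)
qed

lemma trace_norm_ge:
  fixes M :: "complex^'n^'n"
  assumes "contraction K" shows "Re (trace (K ** M)) \<le> trace_norm M"
proof -
  obtain V where V: "contraction V" "M = dagger V ** op_sqrt (dagger M ** M)"
    by (rule trace_norm_polar)
  have "trace (K ** M) = trace ((K ** dagger V) ** op_sqrt (dagger M ** M))"
    by (metis V(2) matrix_mul_assoc)
  then show ?thesis unfolding trace_norm_def
    using trace_contraction_psd_le[OF contraction_mult[OF assms contraction_dagger[OF V(1)]]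
        op_sqrt_psd[OF psd_dagger_self]] by simp
qed

subsection \<open>Uhlmann's theorem\<close>

text \<open>A matrix \<open>X\<close> is read as a purification of \<open>X ** dagger X\<close>, its
  column index being the purifying system. Factoring both purifications through the square roots
  turns their overlap into the trace of a contraction times the product of the roots, which the
  trace norm dominates.\<close>

lemma fidelity_ge_inner:
  fixes X Y :: "complex^'r^'n"
  shows "inner X Y \<le> fidelity (X ** dagger X) (Y ** dagger Y)"
proof -
  let ?r = "op_sqrt (X ** dagger X)" and ?s = "op_sqrt (Y ** dagger Y)"
  note p = psd_self_dagger
  obtain V where V: "contraction V" "X = ?r ** V"
    by (rule douglas_factorization[OF op_sqrt_psd[OF p[of X]], of X]) (simp_all add: op_sqrt_mult p)
  obtain W where W: "contraction W" "Y = ?s ** W"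
    by (rule douglas_factorization[OF op_sqrt_psd[OF p[of Y]], of Y]) (simp_all add: op_sqrt_mult p)
  have "dagger X ** Y = dagger V ** (?r ** ?s ** W)"
    by (metis V(2) W(2) dagger_mult op_sqrt_hermitian[OF p[of X]] matrix_mul_assoc)
  then have "trace (dagger X ** Y) = trace ((W ** dagger V) ** (?r ** ?s))"
    by (metis trace_mult_commute matrix_mul_assoc)
  then show ?thesis
    unfolding inner_eq_trace fidelity_def
    using trace_norm_ge[OF contraction_mult[OF W(1) contraction_dagger[OF V(1)]]] by metis
qed

text \<open>The polar factor is only a contraction, so \<open>X\<close> purifies an operator below
  \<rho> instead of \<rho> itself. The later use needs only this upper bound and the exact
  overlap.\<close>

lemma fidelity_attained:
  fixes \<rho> \<sigma> :: "complex^'n^'n"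
  assumes "psd \<rho>" "psd \<sigma>"
  obtains X Y :: "complex^'n^'n" where "op_le (X ** dagger X) \<rho>" "Y ** dagger Y = \<sigma>"
    "inner X Y = fidelity \<rho> \<sigma>"
proof -
  let ?M = "op_sqrt \<rho> ** op_sqrt \<sigma>"
  obtain V where V: "contraction V" "V ** ?M = op_sqrt (dagger ?M ** ?M)"
    by (rule trace_norm_polar)
  let ?X = "op_sqrt \<rho> ** dagger V"
  have "op_le (dagger V ** V) (mat 1)" using V(1) by (simp add: contraction_iff_op_le)
  from op_le_conj[OF this, of "op_sqrt \<rho>"] have 1: "op_le (?X ** dagger ?X) \<rho>"
    by (simp add: dagger_mult op_sqrt_hermitian[OF assms(1)] op_sqrt_mult[OF assms(1)] matrix_mul_assoc)
  have 2: "op_sqrt \<sigma> ** dagger (op_sqrt \<sigma>) = \<sigma>"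
    by (simp add: op_sqrt_hermitian[OF assms(2)] op_sqrt_mult[OF assms(2)])
  have 3: "inner ?X (op_sqrt \<sigma>) = fidelity \<rho> \<sigma>"
    by (simp add: inner_eq_trace dagger_mult op_sqrt_hermitian[OF assms(1)] fidelity_def trace_norm_def
        V(2) matrix_mul_assoc[symmetric])
  from 1 2 3 show ?thesis by (rule that)
qed

lemma fidelity_nonneg:
  "0 \<le> fidelity \<rho> \<sigma>"
  unfolding fidelity_def trace_norm_def by (rule trace_psd(1)[OF op_sqrt_psd[OF psd_dagger_self]])

subsection \<open>Kraus representations\<close>

definition kraus_map :: "('g::finite \<Rightarrow> complex^'m^'n) \<Rightarrow> complex^'m^'m \<Rightarrow> complex^'n^'n" where
  "kraus_map K X = (\<Sum>g\<in>UNIV. K g ** X ** dagger (K g))"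

abbreviation kraus_complete :: "('g::finite \<Rightarrow> complex^'m^'n) \<Rightarrow> bool" where
  "kraus_complete K \<equiv> (\<Sum>g\<in>UNIV. dagger (K g) ** K g) = mat 1"

abbreviation entanglement_fidelity ::
  "complex^('a::finite \<times> 'a) \<Rightarrow> (complex^'a^'a \<Rightarrow> complex^'a^'a) \<Rightarrow> real" where
  "entanglement_fidelity \<phi> T \<equiv> Re (cinner \<phi> (id_tensor T (proj \<phi>) *v \<phi>))"

lemma quadruple_product_component:
  "(A ** X ** dagger B) $ i $ j = (\<Sum>k\<in>UNIV. \<Sum>l\<in>UNIV. A $ i $ k * X $ k $ l * cnj (B $ j $ l))"
  for A :: "complex^'m^'n"
proof -
  have "(A ** X ** dagger B) $ i $ j = (\<Sum>l\<in>UNIV. \<Sum>k\<in>UNIV. A $ i $ k * X $ k $ l * cnj (B $ j $ l))"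
    by (simp add: matrix_matrix_mult_def dagger_def sum_distrib_right)
  then show ?thesis by (subst sum.swap)
qed

lemma kraus_map_component:
  "kraus_map K X $ i $ j = (\<Sum>g\<in>UNIV. \<Sum>k\<in>UNIV. \<Sum>l\<in>UNIV. K g $ i $ k * X $ k $ l * cnj (K g $ j $ l))"
  by (simp add: kraus_map_def quadruple_product_component)

lemma trace_kraus_map: "trace (kraus_map K X) = trace ((\<Sum>g\<in>UNIV. dagger (K g) ** K g) ** X)"
proof -
  have "trace (K g ** X ** dagger (K g)) = trace (dagger (K g) ** K g ** X)" for g
    by (metis matrix_mul_assoc trace_mult_commute)
  then show ?thesis by (simp add: kraus_map_def trace_sum matrix_sum_left)
qed

lemma nonneg_Reals_sum: "(\<And>i. i \<in> S \<Longrightarrow> f i \<in> \<real>\<^sub>\<ge>\<^sub>0) \<Longrightarrow> sum f S \<in> \<real>\<^sub>\<ge>\<^sub>0"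
  for f :: "_ \<Rightarrow> complex"
  by (induction S rule: infinite_finite_induct) auto

lemma quantum_channel_kraus_map:
  fixes K :: "'g::finite \<Rightarrow> complex^'a^'b"
  assumes "kraus_complete K"
  shows "quantum_channel (kraus_map K)"
  unfolding quantum_channel_def
proof (intro conjI allI)
  show "clinear_map (kraus_map K)"
    unfolding clinear_map_def
  proof (intro conjI allI)
    fix X Y c
    show "kraus_map K (X + Y) = kraus_map K X + kraus_map K Y"
      by (simp add: kraus_map_def matrix_add_ldistrib matrix_mult_add_rdistrib sum.distrib)
    show "kraus_map K (map_matrix ((*) c) X) = map_matrix ((*) c) (kraus_map K X)"
      by (simp add: vec_eq_iff kraus_map_component map_matrix_def sum_distrib_left mult_ac)
  qed
  show "completely_positive (kraus_map K)"
    unfolding completely_positive_def block_psd_def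
  proof (intro allI impI)
    fix n :: nat and X :: "nat \<Rightarrow> nat \<Rightarrow> complex^'a^'a" and v :: "nat \<Rightarrow> complex^'b"
    assume X: "\<forall>v. (\<Sum>i<n. \<Sum>j<n. cinner (v i) (X i j *v v j)) \<in> \<real>\<^sub>\<ge>\<^sub>0"
    have "(\<Sum>i<n. \<Sum>j<n. cinner (v i) (kraus_map K (X i j) *v v j))
      = (\<Sum>i<n. \<Sum>j<n. \<Sum>g\<in>UNIV. cinner (dagger (K g) *v v i) (X i j *v (dagger (K g) *v v j)))"
      by (simp add: kraus_map_def matrix_vector_sum_left cinner_sum_right matrix_vector_mul_assoc[symmetric]
          cinner_dagger[of _ "K _"])
    also have "\<dots> = (\<Sum>i<n. \<Sum>g\<in>UNIV. \<Sum>j<n. cinner (dagger (K g) *v v i) (X i j *v (dagger (K g) *v v j)))"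
      by (intro sum.cong refl sum.swap)
    also have "\<dots> = (\<Sum>g\<in>UNIV. \<Sum>i<n. \<Sum>j<n. cinner (dagger (K g) *v v i) (X i j *v (dagger (K g) *v v j)))"
      by (rule sum.swap)
    also have "\<dots> \<in> \<real>\<^sub>\<ge>\<^sub>0"
      by (intro nonneg_Reals_sum X[rule_format])
    finally show "(\<Sum>i<n. \<Sum>j<n. cinner (v i) (kraus_map K (X i j) *v v j)) \<in> \<real>\<^sub>\<ge>\<^sub>0" .
  qed
  show "trace (kraus_map K X) = trace X" for X by (simp add: trace_kraus_map assms)
qed

definition matrix_unit :: "'m \<Rightarrow> 'n \<Rightarrow> complex^'n^'m" where
  "matrix_unit i j = (\<chi> p q. if p = i \<and> q = j then 1 else 0)"

lemma matrix_unit_expansion: "X = (\<Sum>i\<in>UNIV. \<Sum>j\<in>UNIV. map_matrix ((*) (X $ i $ j)) (matrix_unit i j))"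
proof -
  have "(\<Sum>i\<in>UNIV. \<Sum>j\<in>UNIV. X $ i $ j * (if p = i \<and> q = j then 1 else 0)) = X $ p $ q" for p q
  proof -
    have "(\<Sum>j\<in>UNIV. X $ i $ j * (if p = i \<and> q = j then 1 else 0)) = (if i = p then X $ p $ q else 0)" for i
      by (cases "i = p") (simp_all add: if_distrib cong: if_cong)
    then show ?thesis by simp
  qed
  then show ?thesis by (simp add: vec_eq_iff matrix_unit_def map_matrix_def)
qed

lemma clinear_map_sum:
  assumes "clinear_map D" shows "D (sum f S) = (\<Sum>i\<in>S. D (f i))"
proof -
  have "D (map_matrix ((*) 0) 0) = map_matrix ((*) 0) (D 0)" using assms unfolding clinear_map_def by blast
  then have "D 0 = 0" by (simp add: map_matrix_def zero_vec_def)
  then show ?thesis using assms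
    by (induction S rule: infinite_finite_induct) (auto simp: clinear_map_def)
qed

lemma clinear_map_component:
  assumes "clinear_map D"
  shows "D X $ a $ b = (\<Sum>i\<in>UNIV. \<Sum>j\<in>UNIV. X $ i $ j * D (matrix_unit i j) $ a $ b)"
proof -
  have "D X = (\<Sum>i\<in>UNIV. \<Sum>j\<in>UNIV. map_matrix ((*) (X $ i $ j)) (D (matrix_unit i j)))"
    using assms unfolding clinear_map_def
    by (subst matrix_unit_expansion[of X]) (simp add: clinear_map_sum[OF assms])
  then show ?thesis by (simp add: map_matrix_def)
qed

lemma trace_mult_matrix_unit: "trace (A ** matrix_unit i j) = A $ j $ i"
proof -
  have "trace (A ** matrix_unit i j) = (\<Sum>p\<in>UNIV. \<Sum>q\<in>UNIV. if q = i then (if p = j then A $ p $ q else 0) else 0)"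
    unfolding trace_def matrix_matrix_mult_def matrix_unit_def vec_lambda_beta
    by (intro sum.cong refl) auto
  then show ?thesis by simp
qed

lemma sum_UNIV_prod: "(\<Sum>p\<in>UNIV. f p) = (\<Sum>a\<in>UNIV. \<Sum>b\<in>UNIV. f (a, b))"
  for f :: "('a::finite \<times> 'b::finite) \<Rightarrow> 'c::comm_monoid_add"
  unfolding UNIV_Times_UNIV[symmetric] by (simp add: sum.cartesian_product)

text \<open>\<open>C\<close> is the Choi matrix, and the columns of its square root, reshaped, are
  the Kraus operators. The index type \<open>'b \<times> 'a\<close> is the same for every channel,
  so all decoders sit in one Euclidean space, where a compactness argument can find the best
  one.\<close>

theorem kraus_representation:
  fixes D :: "complex^'b^'b \<Rightarrow> complex^'a^'a"
  assumes D: "quantum_channel D"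
  obtains V :: "'b \<times> 'a \<Rightarrow> complex^'b^'a" where "D = kraus_map V" "kraus_complete V"
proof -
  have lin: "clinear_map D" and cp: "completely_positive D" and tp: "\<And>X. trace (D X) = trace X"
    using D by (auto simp: quantum_channel_def)
  define C :: "complex^('b \<times> 'a)^('b \<times> 'a)" where
    "C = (\<chi> p q. D (matrix_unit (fst p) (fst q)) $ snd p $ snd q)"
  \<comment> \<open>Complete positivity speaks of blocks indexed by natural numbers, so the basis of
    the input space has to be enumerated.\<close>
  obtain h where h: "bij_betw h {0..<CARD('b)} (UNIV :: 'b set)"
    using ex_bij_betw_nat_finite[of "UNIV :: 'b set"] by auto
  then have reindex: "(\<Sum>p<CARD('b). f (h p)) = sum f UNIV" for f :: "'b \<Rightarrow> complex"
    using sum.reindex_bij_betw[OF h] by (simp add: lessThan_atLeast0)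
  have "psd C"
    unfolding psd_def
  proof
    fix w :: "complex^('b \<times> 'a)"
    \<comment> \<open>This block matrix is the unnormalized projector onto a maximally entangled
      vector: its quadratic form is the squared modulus of
      \<open>\<Sum>p<CARD('b). v p $ h p\<close>.\<close>
    have "block_psd CARD('b) (\<lambda>p q. matrix_unit (h p) (h q) :: complex^'b^'b)"
      unfolding block_psd_def
    proof
      fix v :: "nat \<Rightarrow> complex^'b"
      let ?s = "\<Sum>p<CARD('b). v p $ h p"
      have "cinner x (matrix_unit i j *v y) = cnj (x $ i) * y $ j" for x y :: "complex^'b" and i j
      proof -
        have "(\<Sum>k\<in>UNIV. (if p = i \<and> k = j then 1 else 0) * y $ k)
            = (\<Sum>k\<in>UNIV. if k = j then (if p = i then y $ j else 0) else 0)" for p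
          by (intro sum.cong) auto
        then have "matrix_unit i j *v y = y $ j *s axis i 1"
          by (auto simp: vec_eq_iff matrix_unit_def matrix_vector_mult_def axis_def)
        then show ?thesis
          using cnj_cinner[of "axis i 1" x] by (simp add: cinner_scale_right cinner_axis mult.commute)
      qed
      then have "(\<Sum>i<CARD('b). \<Sum>j<CARD('b). cinner (v i) (matrix_unit (h i) (h j) *v v j)) = cnj ?s * ?s"
        by (simp add: sum_product)
      also have "\<dots> = complex_of_real ((cmod ?s)\<^sup>2)" by (metis complex_norm_square mult.commute)
      finally show "(\<Sum>i<CARD('b). \<Sum>j<CARD('b). cinner (v i) (matrix_unit (h i) (h j) *v v j)) \<in> \<real>\<^sub>\<ge>\<^sub>0"
        by simp
    qed
    then have "block_psd CARD('b) (\<lambda>p q. D (matrix_unit (h p) (h q)))"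
      using cp by (simp add: completely_positive_def)
    then have "(\<Sum>p<CARD('b). \<Sum>q<CARD('b). cinner (\<chi> a. w $ (h p, a)) (D (matrix_unit (h p) (h q)) *v (\<chi> a. w $ (h q, a)))) \<in> \<real>\<^sub>\<ge>\<^sub>0"
      unfolding block_psd_def by (rule allE[of _ "\<lambda>p. \<chi> a. w $ (h p, a)"])
    also have "(\<Sum>p<CARD('b). \<Sum>q<CARD('b). cinner (\<chi> a. w $ (h p, a)) (D (matrix_unit (h p) (h q)) *v (\<chi> a. w $ (h q, a))))
      = (\<Sum>i\<in>UNIV. \<Sum>j\<in>UNIV. cinner (\<chi> a. w $ (i, a)) (D (matrix_unit i j) *v (\<chi> a. w $ (j, a))))"
      by (simp add: reindex[of "\<lambda>j. cinner (\<chi> a. w $ (h _, a)) (D (matrix_unit (h _) j) *v (\<chi> a. w $ (j, a)))"]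
          reindex[of "\<lambda>i. \<Sum>j\<in>UNIV. cinner (\<chi> a. w $ (i, a)) (D (matrix_unit i j) *v (\<chi> a. w $ (j, a)))"])
    also have "\<dots> = (\<Sum>i\<in>UNIV. \<Sum>j\<in>UNIV. \<Sum>a\<in>UNIV. \<Sum>b\<in>UNIV. cnj (w $ (i, a)) * (C $ (i, a) $ (j, b) * w $ (j, b)))"
      by (simp add: cinner_def matrix_vector_mult_def C_def sum_distrib_left)
    also have "\<dots> = (\<Sum>i\<in>UNIV. \<Sum>a\<in>UNIV. \<Sum>j\<in>UNIV. \<Sum>b\<in>UNIV. cnj (w $ (i, a)) * (C $ (i, a) $ (j, b) * w $ (j, b)))"
      by (intro sum.cong refl sum.swap)
    also have "\<dots> = cinner w (C *v w)"
      by (simp add: cinner_def matrix_vector_mult_def sum_UNIV_prod sum_distrib_left)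
    finally show "cinner w (C *v w) \<in> \<real>\<^sub>\<ge>\<^sub>0" .
  qed
  define S where "S = op_sqrt C"
  have SS: "S ** dagger S = C"
    by (simp add: S_def op_sqrt_hermitian[OF \<open>psd C\<close>] op_sqrt_mult[OF \<open>psd C\<close>])
  define V where "V = (\<lambda>f. \<chi> a i. S $ (i, a) $ f)"
  have "D X = kraus_map V X" for X
  proof -
    have "D X $ a $ b = kraus_map V X $ a $ b" for a b
    proof -
      have "D X $ a $ b = (\<Sum>i\<in>UNIV. \<Sum>j\<in>UNIV. X $ i $ j * (S ** dagger S) $ (i, a) $ (j, b))"
        unfolding SS by (simp add: C_def clinear_map_component[OF lin, of X a b])
      also have "\<dots> = (\<Sum>i\<in>UNIV. \<Sum>j\<in>UNIV. \<Sum>f\<in>UNIV. V f $ a $ i * X $ i $ j * cnj (V f $ b $ j))"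
        by (simp add: matrix_matrix_mult_def dagger_def V_def sum_distrib_left mult_ac)
      also have "\<dots> = (\<Sum>i\<in>UNIV. \<Sum>f\<in>UNIV. \<Sum>j\<in>UNIV. V f $ a $ i * X $ i $ j * cnj (V f $ b $ j))"
        by (intro sum.cong refl sum.swap)
      also have "\<dots> = (\<Sum>f\<in>UNIV. \<Sum>i\<in>UNIV. \<Sum>j\<in>UNIV. V f $ a $ i * X $ i $ j * cnj (V f $ b $ j))"
        by (rule sum.swap)
      finally show ?thesis by (simp add: kraus_map_component)
    qed
    then show ?thesis by (simp add: vec_eq_iff)
  qed
  then have DV: "D = kraus_map V" by blast
  have "(\<Sum>f\<in>UNIV. dagger (V f) ** V f) $ j $ i = mat 1 $ j $ i" for i j
    using tp[of "matrix_unit i j", unfolded DV trace_kraus_map trace_mult_matrix_unit]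
      trace_mult_matrix_unit[of "mat 1" i j] by simp
  then have "kraus_complete V" unfolding vec_eq_iff by blast
  with DV show ?thesis by (rule that)
qed

lemma kraus_map_compose:
  "kraus_map V \<circ> kraus_map W = kraus_map (\<lambda>p. V (fst p) ** W (snd p))"
  by (rule ext) (simp add: kraus_map_def sum_UNIV_prod matrix_sum_left matrix_sum_right dagger_mult matrix_mul_assoc)

text \<open>A subnormalised Kraus family is completed by re-preparing a fixed vector.\<close>

lemma kraus_completion:
  fixes K :: "'f::finite \<Rightarrow> complex^'b^'a"
  assumes "op_le (\<Sum>f\<in>UNIV. dagger (K f) ** K f) (mat 1)"
  obtains V :: "'f + 'b \<Rightarrow> complex^'b^'a" where "kraus_complete V" "\<And>f. V (Inl f) = K f"
proof -
  define G where "G = mat 1 - (\<Sum>f\<in>UNIV. dagger (K f) ** K f)"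
  have G: "psd G" using assms by (simp add: G_def op_le_def)
  fix a0 :: 'a
  define V where "V = case_sum K (\<lambda>j. matrix_unit a0 j ** op_sqrt G)"
  have mu: "dagger (matrix_unit a0 j) ** matrix_unit a0 j = (matrix_unit j j :: complex^'b^'b)" for j
  proof -
    have "(\<Sum>k\<in>UNIV. cnj (if k = a0 \<and> p = j then 1 else 0) * (if k = a0 \<and> q = j then 1 else 0))
        = (\<Sum>k\<in>UNIV. if k = a0 then (if p = j \<and> q = j then 1 else 0) else 0 :: complex)" for p q :: 'b
      by (rule sum.cong) auto
    then show ?thesis by (simp add: vec_eq_iff matrix_matrix_mult_def dagger_def matrix_unit_def)
  qed
  have mu1: "(\<Sum>j\<in>UNIV. matrix_unit j j) = (mat 1 :: complex^'b^'b)"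
  proof -
    have "(\<Sum>j\<in>UNIV. if p = j \<and> q = j then 1 else 0) = (\<Sum>j\<in>UNIV. if j = p then (if p = q then 1 else 0) else 0 :: complex)" for p q :: 'b
      by (rule sum.cong) auto
    then show ?thesis by (simp add: vec_eq_iff matrix_unit_def mat_def)
  qed
  have "(\<Sum>j\<in>UNIV. dagger (V (Inr j)) ** V (Inr j)) = op_sqrt G ** (\<Sum>j\<in>UNIV. matrix_unit j j) ** op_sqrt G"
    by (simp add: V_def dagger_mult op_sqrt_hermitian[OF G] matrix_sum_left matrix_sum_right mu[symmetric] matrix_mul_assoc)
  also have "\<dots> = G" by (simp add: mu1 op_sqrt_mult[OF G])
  finally have "(\<Sum>j\<in>UNIV. dagger (V (Inr j)) ** V (Inr j)) = G" .
  moreover have "(\<Sum>f\<in>UNIV. dagger (V f) ** V f)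
      = (\<Sum>f\<in>UNIV. dagger (V (Inl f)) ** V (Inl f)) + (\<Sum>j\<in>UNIV. dagger (V (Inr j)) ** V (Inr j))"
    unfolding UNIV_Plus_UNIV[symmetric] by (subst sum.Plus) auto
  ultimately have "kraus_complete V" by (simp add: V_def G_def)
  then show ?thesis by (rule that) (simp add: V_def)
qed

definition stinespring_kraus :: "complex^'a^('b::finite \<times> 'e::finite) \<Rightarrow> 'e \<Rightarrow> complex^'a^'b" where
  "stinespring_kraus U e = (\<chi> b a. U $ (b, e) $ a)"

lemma stinespring_kraus_map:
  assumes "stinespring_isometry U N" shows "N = kraus_map (stinespring_kraus U)"
proof
  fix X
  have "N X = ptrace_snd (U ** X ** dagger U)" using assms by (simp add: stinespring_isometry_def)
  then show "N X = kraus_map (stinespring_kraus U) X"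
    by (simp add: vec_eq_iff ptrace_snd_def kraus_map_component quadruple_product_component stinespring_kraus_def)
qed

subsection \<open>Maximally entangled vectors and entanglement fidelity\<close>

definition onb_projector :: "nat \<Rightarrow> (nat \<Rightarrow> complex^'n) \<Rightarrow> complex^'n^'n" where
  "onb_projector n b = (\<Sum>i<n. proj (b i))"

lemma proj_mult_vector: "proj x *v y = cinner x y *s x"
  by (simp add: vec_eq_iff proj_def matrix_vector_mult_def cinner_def sum_distrib_left sum_distrib_right mult_ac)

lemma dagger_proj: "dagger (proj x) = proj x"
  by (simp add: vec_eq_iff proj_def dagger_def mult.commute)

lemma trace_mult_proj: "trace (M ** proj x) = cinner x (M *v x)"
  by (simp add: trace_def matrix_matrix_mult_def proj_def cinner_def matrix_vector_mult_def sum_distrib_left mult_ac)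

lemma dagger_onb_projector: "dagger (onb_projector n b) = onb_projector n b"
  by (simp add: onb_projector_def dagger_sum dagger_proj)

lemma onb_projector_fixes:
  assumes "orthonormal_basis_of M b" "x \<in> M"
  shows "onb_projector (vec.dim M) b *v x = x"
proof -
  let ?P = "onb_projector (vec.dim M) b"
  have "?P *v b i = b i" if "i < vec.dim M" for i
  proof -
    have "?P *v b i = (\<Sum>j<vec.dim M. cinner (b j) (b i) *s b j)"
      by (simp add: onb_projector_def matrix_vector_sum_left proj_mult_vector)
    also have "\<dots> = (\<Sum>j<vec.dim M. if j = i then b i else 0)"
      using assms(1) that unfolding orthonormal_basis_of_def by (intro sum.cong) auto
    also have "\<dots> = b i" using that by simp
    finally show ?thesis .
  qed
  then have "b ` {..<vec.dim M} \<subseteq> {x. ?P *v x = x}" by auto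
  moreover have "vec.subspace {x. ?P *v x = x}"
    by (rule vec.subspaceI) (auto simp: matrix_vector_right_distrib vector_scalar_commute)
  ultimately have "vec.span (b ` {..<vec.dim M}) \<subseteq> {x. ?P *v x = x}" by (rule vec.span_minimal)
  then show ?thesis using assms unfolding orthonormal_basis_of_def by auto
qed

lemma onb_projector_in:
  assumes "orthonormal_basis_of M b" shows "onb_projector (vec.dim M) b *v x \<in> M"
proof -
  have "(\<Sum>j<vec.dim M. cinner (b j) x *s b j) \<in> vec.span (b ` {..<vec.dim M})"
    by (intro vec.span_sum vec.span_scale vec.span_base) auto
  then show ?thesis
    using assms by (simp add: onb_projector_def matrix_vector_sum_left proj_mult_vector orthonormal_basis_of_def)
qed

text \<open>Each projector fixes the range of the other; taking adjoints of the two products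
  identifies them. This frees later formulas from the bases hidden in
  \<open>max_entangled\<close>.\<close>

lemma onb_projector_unique:
  assumes b: "orthonormal_basis_of M b" and b': "orthonormal_basis_of M b'"
  shows "onb_projector (vec.dim M) b = onb_projector (vec.dim M) b'"
proof -
  let ?P = "onb_projector (vec.dim M) b" and ?Q = "onb_projector (vec.dim M) b'"
  have "?P ** ?Q = ?Q" "?Q ** ?P = ?P"
    using onb_projector_fixes[OF b onb_projector_in[OF b']] onb_projector_fixes[OF b' onb_projector_in[OF b]]
    by (simp_all add: matrix_eq matrix_vector_mul_assoc[symmetric])
  then show ?thesis by (metis dagger_mult dagger_onb_projector)
qed

lemma cinner_sum_sum: "cinner (sum f S) (sum g T) = (\<Sum>i\<in>S. \<Sum>j\<in>T. cinner (f i) (g j))"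
  by (subst cinner_sum_left) (simp only: cinner_sum_right)

lemma cinner_tensor_vec: "cinner (tensor_vec x y) (tensor_vec z w) = cinner x z * cinner y w"
  by (simp add: cinner_def tensor_vec_def sum_UNIV_prod sum_product mult_ac)

lemma tensor_mat_mult_vec: "tensor_mat A B *v tensor_vec x y = tensor_vec (A *v x) (B *v y)"
  by (simp add: vec_eq_iff matrix_vector_mult_def tensor_mat_def tensor_vec_def sum_UNIV_prod sum_product mult_ac)

lemma tensor_mat_1_component: "(tensor_mat (mat 1) M *v v) $ (a, i) = (\<Sum>k\<in>UNIV. M $ i $ k * v $ (a, k))"
proof -
  have "(tensor_mat (mat 1) M *v v) $ (a, i)
      = (\<Sum>a'\<in>UNIV. if a' = a then (\<Sum>k\<in>UNIV. M $ i $ k * v $ (a, k)) else 0)"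
    unfolding matrix_vector_mult_def tensor_mat_def sum_UNIV_prod mat_def vec_lambda_beta fst_conv snd_conv
    by (intro sum.cong refl) auto
  then show ?thesis by simp
qed

lemma id_tensor_kraus_map_proj:
  "id_tensor (kraus_map M) (proj v) = (\<Sum>g\<in>UNIV. proj (tensor_mat (mat 1) (M g) *v v))"
  by (simp add: vec_eq_iff id_tensor_def kraus_map_component proj_def tensor_mat_1_component sum_product
      split_paired_all mult_ac)

text \<open>Orthonormality of the first-factor basis collapses the amplitude of an operator
  \<open>A\<close> to the trace of \<open>A\<close> on the code space divided by the dimension. The
  value depends on the code only through its projector, not on the chosen maximally entangled
  vector, so codes may be handled as orthonormal frames.\<close>

lemma entanglement_fidelity_kraus_map:
  fixes M :: "'g::finite \<Rightarrow> complex^'a^'a"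
  assumes "max_entangled S \<phi>" and c: "orthonormal_basis_of S c"
  shows "entanglement_fidelity \<phi> (kraus_map M)
    = (\<Sum>g\<in>UNIV. (cmod (trace (M g ** onb_projector (vec.dim S) c)))\<^sup>2) / (real (vec.dim S))\<^sup>2"
proof -
  define n where "n = vec.dim S"
  obtain b b' where b: "orthonormal_basis_of S b" and b': "orthonormal_basis_of S b'"
    and \<phi>: "\<phi> = (1 / sqrt (real n)) *\<^sub>R (\<Sum>i<n. tensor_vec (b i) (b' i))"
    using assms(1) unfolding max_entangled_def n_def by blast
  define r where "r = complex_of_real (1 / sqrt (real n))"
  have \<phi>': "\<phi> = r *s (\<Sum>i<n. tensor_vec (b i) (b' i))" unfolding \<phi> r_def by (rule scaleR_eq_scale)
  have P: "onb_projector n c = onb_projector n b'"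
    unfolding n_def by (rule onb_projector_unique[OF c b'])
  have amp: "cinner \<phi> (tensor_mat (mat 1) A *v \<phi>) = trace (A ** onb_projector n c) / of_nat n" for A
  proof -
    have "cinner \<phi> (tensor_mat (mat 1) A *v \<phi>)
      = cnj r * r * (\<Sum>i<n. \<Sum>j<n. cinner (b i) (b j) * cinner (b' i) (A *v b' j))"
      by (simp add: \<phi>' vector_scalar_commute cinner_scale_left cinner_scale_right matrix_vector_sum_right
          tensor_mat_mult_vec cinner_sum_sum cinner_tensor_vec)
    also have "(\<Sum>i<n. \<Sum>j<n. cinner (b i) (b j) * cinner (b' i) (A *v b' j)) = (\<Sum>i<n. cinner (b' i) (A *v b' i))"
    proof (rule sum.cong)
      fix i assume "i \<in> {..<n}"
      then have "(\<Sum>j<n. cinner (b i) (b j) * cinner (b' i) (A *v b' j))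
          = (\<Sum>j<n. if j = i then cinner (b' i) (A *v b' i) else 0)"
        using b unfolding orthonormal_basis_of_def n_def by (intro sum.cong) auto
      then show "(\<Sum>j<n. cinner (b i) (b j) * cinner (b' i) (A *v b' j)) = cinner (b' i) (A *v b' i)"
        using \<open>i \<in> {..<n}\<close> by simp
    qed simp
    also have "\<dots> = trace (A ** onb_projector n c)"
      unfolding P by (simp add: onb_projector_def matrix_sum_right trace_sum trace_mult_proj)
    also have "cnj r * r = complex_of_real ((1 / sqrt (real n)) * (1 / sqrt (real n)))"
      unfolding r_def complex_cnj_complex_of_real of_real_mult ..
    also have "\<dots> = 1 / of_nat n" by simp
    finally show ?thesis by simp
  qed
  have "Re (cinner \<phi> (proj w *v \<phi>)) = (cmod (cinner \<phi> w))\<^sup>2" for w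
  proof -
    have "cinner \<phi> (proj w *v \<phi>) = cinner w \<phi> * cnj (cinner w \<phi>)"
      by (simp add: proj_mult_vector cinner_scale_right cnj_cinner)
    then have "cinner \<phi> (proj w *v \<phi>) = complex_of_real ((cmod (cinner w \<phi>))\<^sup>2)"
      by (simp only: complex_norm_square)
    then show ?thesis by (metis Re_complex_of_real cnj_cinner complex_mod_cnj)
  qed
  then show ?thesis
    by (simp add: id_tensor_kraus_map_proj matrix_vector_sum_left cinner_sum_right amp norm_divide power_divide
        sum_divide_distrib n_def)
qed

subsection \<open>The joint state of the reference and the environment\<close>

text \<open>The global vector read as a purification matrix: rows for reference and environment,
  columns for the channel output as purifying system.\<close>

definition ref_env_mat ::
  "complex^('a::finite \<times> ('b::finite \<times> 'e::finite)) \<Rightarrow> complex^'b^('a \<times> 'e)" where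
  "ref_env_mat \<psi> = (\<chi> p b. \<psi> $ (fst p, b, snd p))"

lemma ptrace_mid_proj: "ptrace_mid (proj \<psi>) = ref_env_mat \<psi> ** dagger (ref_env_mat \<psi>)"
  by (simp add: vec_eq_iff ptrace_mid_def proj_def ref_env_mat_def matrix_matrix_mult_def dagger_def)

lemma ref_env_mat_channel_vec:
  "ref_env_mat (channel_vec U \<phi>) $ (a, e) $ b = (\<Sum>k\<in>UNIV. stinespring_kraus U e $ b $ k * \<phi> $ (a, k))"
  by (simp add: ref_env_mat_def channel_vec_def tensor_mat_1_component stinespring_kraus_def)

lemma elog2_mono: "x \<le> y \<Longrightarrow> elog2 x \<le> elog2 y"
  by (auto simp: elog2_def)

lemma Hmin_ge:
  fixes \<rho> :: "complex^('a::finite \<times> 'b::finite)^('a \<times> 'b)"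
  assumes "state \<sigma>" "op_le \<rho> ((1 / real n) *\<^sub>R tensor_mat (mat 1 :: complex^'a^'a) \<sigma>)" "1 \<le> n"
  shows "ereal (log 2 (real n)) \<le> Hmin \<rho>"
proof -
  let ?L = "{l. 0 \<le> l \<and> op_le \<rho> (l *\<^sub>R tensor_mat (mat 1 :: complex^'a^'a) \<sigma>)}"
  have mem: "1 / real n \<in> ?L" using assms by simp
  have "Inf ?L \<le> 1 / real n" by (rule cInf_lower[OF mem]) (auto intro: bdd_belowI[of _ 0])
  then have "elog2 (Inf ?L) \<le> elog2 (1 / real n)" by (rule elog2_mono)
  also have "\<dots> = - ereal (log 2 (real n))" using assms(3) by (simp add: elog2_def log_divide)
  finally have "elog2 (Inf ?L) \<le> - ereal (log 2 (real n))" .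
  then have "Dmax \<rho> (tensor_mat (mat 1 :: complex^'a^'a) \<sigma>) \<le> - ereal (log 2 (real n))"
  proof -
    have ex: "\<exists>l\<ge>0. op_le \<rho> (l *\<^sub>R tensor_mat (mat 1 :: complex^'a^'a) \<sigma>)" using mem by blast
    show "Dmax \<rho> (tensor_mat (mat 1 :: complex^'a^'a) \<sigma>) \<le> - ereal (log 2 (real n))"
      if "elog2 (Inf ?L) \<le> - ereal (log 2 (real n))" unfolding Dmax_def if_P[OF ex] by (rule that)
  qed
  then have "ereal (log 2 (real n)) \<le> - Dmax \<rho> (tensor_mat (mat 1 :: complex^'a^'a) \<sigma>)"
    by (metis ereal_minus_le_minus ereal_uminus_uminus)
  then show ?thesis unfolding Hmin_def using assms(1) by (intro SUP_upper2[of \<sigma>]) auto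
qed

lemma tensor_mat_mult: "tensor_mat A B ** tensor_mat C D = tensor_mat (A ** C) (B ** D)"
  by (simp add: vec_eq_iff matrix_matrix_mult_def tensor_mat_def sum_UNIV_prod sum_product mult_ac)

lemma dagger_tensor_mat: "dagger (tensor_mat A B) = tensor_mat (dagger A) (dagger B)"
  by (simp add: vec_eq_iff tensor_mat_def dagger_def)

lemma tensor_mat_diff_left: "tensor_mat (A - B) C = tensor_mat A C - tensor_mat B C"
  by (simp add: vec_eq_iff tensor_mat_def algebra_simps)

lemma trace_tensor_mat: "trace (tensor_mat A B) = trace A * trace B"
  by (simp add: trace_def tensor_mat_def sum_UNIV_prod sum_product)

lemma psd_tensor_mat:
  assumes "psd A" "psd B" shows "psd (tensor_mat A B)"
proof -
  have "tensor_mat A B = tensor_mat (op_sqrt A) (op_sqrt B) ** dagger (tensor_mat (op_sqrt A) (op_sqrt B))"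
    using assms by (simp add: dagger_tensor_mat tensor_mat_mult op_sqrt_hermitian op_sqrt_mult)
  then show ?thesis by (metis psd_self_dagger)
qed

lemma onb_projector_idem:
  assumes "orthonormal_basis_of M b"
  shows "onb_projector (vec.dim M) b ** onb_projector (vec.dim M) b = onb_projector (vec.dim M) b"
  using onb_projector_fixes[OF assms onb_projector_in[OF assms]]
  by (simp add: matrix_eq matrix_vector_mul_assoc[symmetric])

lemma op_le_onb_projector:
  assumes "orthonormal_basis_of M b" shows "op_le (onb_projector (vec.dim M) b) (mat 1)"
proof -
  let ?P = "onb_projector (vec.dim M) b"
  have "(mat 1 - ?P) ** dagger (mat 1 - ?P) = mat 1 - ?P"
    by (simp add: dagger_diff dagger_onb_projector matrix_diff_ldistrib matrix_diff_rdistrib onb_projector_idem[OF assms])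
  then show ?thesis unfolding op_le_def by (metis psd_self_dagger)
qed

lemma state_exists: "\<exists>\<sigma> :: complex^'n^'n. state \<sigma>"
proof -
  fix i :: 'n
  have "proj (axis i 1 :: complex^'n) = proj (axis i 1) ** dagger (proj (axis i 1))"
    by (auto simp: vec_eq_iff proj_def dagger_def matrix_matrix_mult_def axis_def if_distrib cong: if_cong)
  then have "psd (proj (axis i 1 :: complex^'n))" by (metis psd_self_dagger)
  moreover have "trace (proj (axis i 1 :: complex^'n)) = 1"
    using trace_mult_proj[of "mat 1" "axis i 1 :: complex^'n"] by (simp add: cinner_axis)
  ultimately show ?thesis unfolding state_def by blast
qed

lemma sum_UNIV_swap3: "(\<Sum>a\<in>A. \<Sum>b\<in>B. \<Sum>c\<in>C. f a b c) = (\<Sum>c\<in>C. \<Sum>a\<in>A. \<Sum>b\<in>B. f a b c)"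
  for f :: "_ \<Rightarrow> _ \<Rightarrow> _ \<Rightarrow> 'z::comm_monoid_add"
proof -
  have "(\<Sum>a\<in>A. \<Sum>b\<in>B. \<Sum>c\<in>C. f a b c) = (\<Sum>a\<in>A. \<Sum>c\<in>C. \<Sum>b\<in>B. f a b c)"
    by (intro sum.cong refl sum.swap)
  also have "\<dots> = (\<Sum>c\<in>C. \<Sum>a\<in>A. \<Sum>b\<in>B. f a b c)" by (rule sum.swap)
  finally show ?thesis .
qed

text \<open>The isometry \<open>V\<close> carries the channel output to a purification of the same
  reference-environment state. Projecting it onto \<open>\<phi>\<close> leaves a vector \<open>x\<close> on the remaining systems,
  and \<open>\<phi> \<otimes> x / \<parallel>x\<parallel>\<close> purifies the required smoothed state.\<close>

lemma smooth_Hmin_ge_of_decoder: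
  fixes V :: "'f::finite \<Rightarrow> complex^'b^'a" and U :: "complex^'a^('b::finite \<times> 'e::finite)"
  assumes V: "kraus_complete V"
    and me: "max_entangled S \<phi>" and dim: "1 \<le> vec.dim S"
    and fid: "1 - \<epsilon>\<^sup>2 \<le> entanglement_fidelity \<phi> (kraus_map (\<lambda>p. V (fst p) ** stinespring_kraus U (snd p)))"
  shows "ereal (log 2 (real (vec.dim S))) \<le> smooth_Hmin \<epsilon> (ptrace_mid (proj (channel_vec U \<phi>)))"
proof -
  define n where "n = vec.dim S"
  have n: "1 \<le> n" using dim by (simp add: n_def)
  obtain b b' where b: "orthonormal_basis_of S b" and b': "orthonormal_basis_of S b'"
    and \<phi>: "\<phi> = (1 / sqrt (real n)) *\<^sub>R (\<Sum>i<n. tensor_vec (b i) (b' i))"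
    using me unfolding max_entangled_def n_def by blast
  let ?N = "stinespring_kraus U"
  let ?\<Psi> = "ref_env_mat (channel_vec U \<phi>)"
  define Y :: "complex^('a \<times> 'f)^('a \<times> 'e)" where
    "Y = (\<chi> p q. \<Sum>\<beta>\<in>UNIV. V (snd q) $ fst q $ \<beta> * ?\<Psi> $ p $ \<beta>)"
  \<comment> \<open>The Kraus family of the decoder is one isometry acting on the purifying system,
    so it leaves the state of reference and environment unchanged.\<close>
  have YY: "Y ** dagger Y = ptrace_mid (proj (channel_vec U \<phi>))"
  proof -
    have "(Y ** dagger Y) $ p $ p' = (?\<Psi> ** dagger ?\<Psi>) $ p $ p'" for p p'
    proof -
      have iso: "(\<Sum>f\<in>UNIV. \<Sum>a\<in>UNIV. V f $ a $ \<beta> * cnj (V f $ a $ \<gamma>)) = (if \<beta> = \<gamma> then 1 else 0)" for \<beta> \<gamma>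
      proof -
        have "(\<Sum>f\<in>UNIV. dagger (V f) ** V f) $ \<gamma> $ \<beta> = (if \<beta> = \<gamma> then 1 else 0)"
          unfolding V by (auto simp: mat_def)
        then show ?thesis by (simp add: matrix_matrix_mult_def dagger_def mult.commute)
      qed
      have "(Y ** dagger Y) $ p $ p'
        = (\<Sum>a\<in>UNIV. \<Sum>f\<in>UNIV. \<Sum>\<beta>\<in>UNIV. \<Sum>\<gamma>\<in>UNIV. (?\<Psi> $ p $ \<beta> * cnj (?\<Psi> $ p' $ \<gamma>)) * (V f $ a $ \<beta> * cnj (V f $ a $ \<gamma>)))"
        by (simp add: matrix_matrix_mult_def dagger_def Y_def sum_UNIV_prod sum_product mult_ac)
      also have "\<dots> = (\<Sum>\<beta>\<in>UNIV. \<Sum>\<gamma>\<in>UNIV. \<Sum>f\<in>UNIV. \<Sum>a\<in>UNIV. (?\<Psi> $ p $ \<beta> * cnj (?\<Psi> $ p' $ \<gamma>)) * (V f $ a $ \<beta> * cnj (V f $ a $ \<gamma>)))"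
        by (subst sum.swap, subst sum_UNIV_swap3, intro sum.cong refl, subst sum_UNIV_swap3, rule refl)
      also have "\<dots> = (\<Sum>\<beta>\<in>UNIV. \<Sum>\<gamma>\<in>UNIV. (?\<Psi> $ p $ \<beta> * cnj (?\<Psi> $ p' $ \<gamma>)) * (if \<beta> = \<gamma> then 1 else 0))"
        by (simp only: sum_distrib_left[symmetric] iso)
      also have "\<dots> = (?\<Psi> ** dagger ?\<Psi>) $ p $ p'"
        by (simp add: if_distrib matrix_matrix_mult_def dagger_def cong: if_cong)
      finally show ?thesis .
    qed
    then show ?thesis by (simp add: vec_eq_iff ptrace_mid_proj)
  qed
  define x where "x f e = cinner \<phi> (tensor_mat (mat 1) (V f ** ?N e) *v \<phi>)" for f e
  have Ycomp: "Y $ (a, e) $ (i, f) = (tensor_mat (mat 1) (V f ** ?N e) *v \<phi>) $ (a, i)" for a e i f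
  proof -
    have "Y $ (a, e) $ (i, f) = (\<Sum>\<beta>\<in>UNIV. \<Sum>k\<in>UNIV. V f $ i $ \<beta> * (?N e $ \<beta> $ k * \<phi> $ (a, k)))"
      by (simp add: Y_def ref_env_mat_channel_vec sum_distrib_left)
    also have "\<dots> = (\<Sum>k\<in>UNIV. \<Sum>\<beta>\<in>UNIV. V f $ i $ \<beta> * (?N e $ \<beta> $ k * \<phi> $ (a, k)))"
      by (rule sum.swap)
    finally show ?thesis
      by (simp add: tensor_mat_1_component matrix_matrix_mult_def sum_distrib_right sum_distrib_left mult_ac)
  qed
  define \<nu> where "\<nu> = sqrt (\<Sum>f\<in>UNIV. \<Sum>e\<in>UNIV. (cmod (x f e))\<^sup>2)"
  have cs: "x f e * cnj (x f e) = (complex_of_real (cmod (x f e)))\<^sup>2" for f e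
    by (metis complex_norm_square of_real_power)
  have \<nu>2: "\<nu>\<^sup>2 = (\<Sum>f\<in>UNIV. \<Sum>e\<in>UNIV. (cmod (x f e))\<^sup>2)" by (simp add: \<nu>_def sum_nonneg)
  have "entanglement_fidelity \<phi> (kraus_map (\<lambda>p. V (fst p) ** ?N (snd p))) = \<nu>\<^sup>2"
  proof -
    have "cinner \<phi> (proj w *v \<phi>) = complex_of_real ((cmod (cinner \<phi> w))\<^sup>2)" for w
      by (simp add: proj_mult_vector cinner_scale_right cnj_cinner[of \<phi> w, symmetric] complex_norm_square del: of_real_power)
    then show ?thesis
      by (simp add: id_tensor_kraus_map_proj matrix_vector_sum_left cinner_sum_right \<nu>2 sum_UNIV_prod x_def)
  qed
  with fid have \<nu>: "1 - \<epsilon>\<^sup>2 \<le> \<nu>\<^sup>2" by simp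
  \<comment> \<open>For \<open>\<nu> = 0\<close> the quotient is 0 and \<open>X\<close> becomes the
    zero matrix. This remains an admissible smoothing, because the fidelity hypothesis then gives
    \<open>1 \<le> \<epsilon>\<^sup>2\<close>.\<close>
  define \<chi>v where "\<chi>v f e = x f e / \<nu>" for f e
  define X :: "complex^('a \<times> 'f)^('a \<times> 'e)" where
    "X = (\<chi> p q. \<phi> $ (fst p, fst q) * \<chi>v (snd q) (snd p))"
  have inner_XY: "inner X Y = \<nu>"
  proof -
    have "inner X Y = Re (\<Sum>a\<in>UNIV. \<Sum>e\<in>UNIV. \<Sum>i\<in>UNIV. \<Sum>f\<in>UNIV. cnj (X $ (a, e) $ (i, f)) * Y $ (a, e) $ (i, f))"
      by (simp add: inner_vec_def inner_complex_def sum_UNIV_prod)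
    also have "(\<Sum>a\<in>UNIV. \<Sum>e\<in>UNIV. \<Sum>i\<in>UNIV. \<Sum>f\<in>UNIV. cnj (X $ (a, e) $ (i, f)) * Y $ (a, e) $ (i, f))
      = (\<Sum>e\<in>UNIV. \<Sum>a\<in>UNIV. \<Sum>i\<in>UNIV. \<Sum>f\<in>UNIV. cnj (X $ (a, e) $ (i, f)) * Y $ (a, e) $ (i, f))"
      by (rule sum.swap)
    also have "\<dots> = (\<Sum>e\<in>UNIV. \<Sum>f\<in>UNIV. \<Sum>a\<in>UNIV. \<Sum>i\<in>UNIV. cnj (X $ (a, e) $ (i, f)) * Y $ (a, e) $ (i, f))"
      by (intro sum.cong refl sum_UNIV_swap3)
    also have "\<dots> = (\<Sum>e\<in>UNIV. \<Sum>f\<in>UNIV. cnj (\<chi>v f e) * x f e)"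
      by (intro sum.cong refl)
        (simp add: X_def Ycomp x_def cinner_def sum_UNIV_prod sum_distrib_left mult_ac)
    also have "\<dots> = (\<Sum>f\<in>UNIV. \<Sum>e\<in>UNIV. cnj (\<chi>v f e) * x f e)"
      by (rule sum.swap)
    also have "\<dots> = complex_of_real ((\<Sum>f\<in>UNIV. \<Sum>e\<in>UNIV. (cmod (x f e))\<^sup>2) / \<nu>)"
      by (simp add: \<chi>v_def sum_divide_distrib mult.commute[of "cnj _"] cs)
    also have "\<dots> = complex_of_real \<nu>" unfolding \<nu>2[symmetric] by (simp add: power2_eq_square)
    finally show ?thesis by simp
  qed
  define \<omega> :: "complex^'e^'e" where "\<omega> = (\<chi> e e'. \<Sum>f\<in>UNIV. \<chi>v f e * cnj (\<chi>v f e'))"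
  have \<omega>_psd: "psd \<omega>"
  proof -
    have "\<omega> = (\<chi> e f. \<chi>v f e) ** dagger (\<chi> e f. \<chi>v f e)"
      by (simp add: vec_eq_iff \<omega>_def matrix_matrix_mult_def dagger_def)
    then show ?thesis by (metis psd_self_dagger)
  qed
  have tr\<omega>: "trace \<omega> = (if \<nu> = 0 then 0 else 1)"
  proof -
    have "trace \<omega> = (\<Sum>f\<in>UNIV. \<Sum>e\<in>UNIV. \<chi>v f e * cnj (\<chi>v f e))"
      unfolding trace_def \<omega>_def by (simp, rule sum.swap)
    also have "\<dots> = complex_of_real ((\<Sum>f\<in>UNIV. \<Sum>e\<in>UNIV. (cmod (x f e))\<^sup>2) / \<nu>\<^sup>2)"
      by (simp add: \<chi>v_def sum_divide_distrib cs power2_eq_square[of "complex_of_real \<nu>"])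
    also have "\<dots> = (if \<nu> = 0 then 0 else 1)" unfolding \<nu>2[symmetric] by simp
    finally show ?thesis .
  qed
  \<comment> \<open>The reference marginal of the maximally entangled vector is its projector
    divided by \<open>n\<close>. Enlarging the projector to the identity keeps the factor
    \<open>1 / n\<close>, which is the source of the min-entropy \<open>log 2 n\<close>.\<close>
  have XX: "X ** dagger X = (1 / real n) *\<^sub>R tensor_mat (onb_projector n b) \<omega>"
  proof -
    define r where "r = complex_of_real (1 / sqrt (real n))"
    have rr: "r * cnj r = complex_of_real (1 / real n)"
      unfolding r_def by (simp flip: of_real_mult)
    have \<phi>c: "\<phi> $ (a, i) = r * (\<Sum>k<n. b k $ a * b' k $ i)" for a i
      unfolding \<phi> r_def scaleR_eq_scale vector_smult_component by (simp add: tensor_vec_def)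
    have red: "(\<Sum>i\<in>UNIV. \<phi> $ (a, i) * cnj (\<phi> $ (a', i))) = complex_of_real (1 / real n) * onb_projector n b $ a $ a'" for a a'
    proof -
      have "(\<Sum>i\<in>UNIV. \<phi> $ (a, i) * cnj (\<phi> $ (a', i)))
        = r * cnj r * (\<Sum>i\<in>UNIV. \<Sum>k<n. \<Sum>l<n. (b k $ a * cnj (b l $ a')) * (cnj (b' l $ i) * b' k $ i))"
      proof -
        have "\<phi> $ (a, i) * cnj (\<phi> $ (a', i))
            = r * cnj r * (\<Sum>k<n. \<Sum>l<n. (b k $ a * cnj (b l $ a')) * (cnj (b' l $ i) * b' k $ i))" for i
        proof -
          have "\<phi> $ (a, i) * cnj (\<phi> $ (a', i))
              = r * cnj r * ((\<Sum>k<n. b k $ a * b' k $ i) * (\<Sum>l<n. cnj (b l $ a') * cnj (b' l $ i)))"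
            by (simp add: \<phi>c)
          also have "(\<Sum>k<n. b k $ a * b' k $ i) * (\<Sum>l<n. cnj (b l $ a') * cnj (b' l $ i))
              = (\<Sum>k<n. \<Sum>l<n. (b k $ a * cnj (b l $ a')) * (cnj (b' l $ i) * b' k $ i))"
            unfolding sum_product by (simp add: mult_ac)
          finally show ?thesis .
        qed
        then show ?thesis by (simp only: sum_distrib_left)
      qed
      also have "(\<Sum>i\<in>UNIV. \<Sum>k<n. \<Sum>l<n. (b k $ a * cnj (b l $ a')) * (cnj (b' l $ i) * b' k $ i))
        = (\<Sum>k<n. \<Sum>l<n. \<Sum>i\<in>UNIV. (b k $ a * cnj (b l $ a')) * (cnj (b' l $ i) * b' k $ i))"
        by (rule sum_UNIV_swap3[symmetric])
      also have "\<dots> = (\<Sum>k<n. \<Sum>l<n. (b k $ a * cnj (b l $ a')) * cinner (b' l) (b' k))"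
        by (simp add: cinner_def sum_distrib_left)
      also have "\<dots> = (\<Sum>k<n. \<Sum>l<n. if l = k then b k $ a * cnj (b k $ a') else 0)"
        using b' unfolding orthonormal_basis_of_def n_def by (intro sum.cong refl) auto
      also have "\<dots> = onb_projector n b $ a $ a'" by (simp add: onb_projector_def proj_def)
      finally show ?thesis by (simp add: rr)
    qed
    have "(X ** dagger X) $ (a, e) $ (a', e') = ((1 / real n) *\<^sub>R tensor_mat (onb_projector n b) \<omega>) $ (a, e) $ (a', e')" for a e a' e'
    proof -
      have "(X ** dagger X) $ (a, e) $ (a', e') = (\<Sum>i\<in>UNIV. \<phi> $ (a, i) * cnj (\<phi> $ (a', i))) * \<omega> $ e $ e'"
      proof -
        have "(X ** dagger X) $ (a, e) $ (a', e')
            = (\<Sum>i\<in>UNIV. \<Sum>f\<in>UNIV. (\<phi> $ (a, i) * cnj (\<phi> $ (a', i))) * (\<chi>v f e * cnj (\<chi>v f e')))"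
          by (simp add: matrix_matrix_mult_def dagger_def X_def sum_UNIV_prod mult_ac)
        then show ?thesis by (simp add: sum_product \<omega>_def)
      qed
      then show ?thesis
        unfolding vector_scaleR_component red by (simp add: tensor_mat_def scaleR_conv_of_real)
    qed
    then show ?thesis by (simp add: vec_eq_iff)
  qed
  obtain \<sigma> :: "complex^'e^'e" where \<sigma>: "state \<sigma>" and X\<sigma>: "op_le (X ** dagger X) ((1 / real n) *\<^sub>R tensor_mat (mat 1 :: complex^'a^'a) \<sigma>)"
  proof (cases "\<nu> = 0")
    case True
    then have "X = 0" by (simp add: X_def \<chi>v_def zero_vec_def)
    obtain \<sigma> :: "complex^'e^'e" where "state \<sigma>" using state_exists by blast
    then show ?thesis using that[of \<sigma>] \<open>X = 0\<close>
      by (simp add: op_le_def psd_scaleR psd_tensor_mat state_def)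
  next
    case False
    have "psd (tensor_mat (mat 1 - onb_projector n b) \<omega>)"
      using op_le_onb_projector[OF b] \<omega>_psd unfolding n_def op_le_def by (rule psd_tensor_mat)
    then have "psd ((1 / real n) *\<^sub>R tensor_mat (mat 1 - onb_projector n b) \<omega>)"
      by (rule psd_scaleR) simp
    then have "op_le (X ** dagger X) ((1 / real n) *\<^sub>R tensor_mat (mat 1 :: complex^'a^'a) \<omega>)"
      unfolding XX op_le_def scaleR_diff_right[symmetric] tensor_mat_diff_left .
    then show ?thesis using that[of \<omega>] tr\<omega> False \<omega>_psd by (simp add: state_def)
  qed
  have "X ** dagger X \<in> smoothing_ball \<epsilon> (ptrace_mid (proj (channel_vec U \<phi>)))"
  proof -
    have "Re (trace (X ** dagger X)) \<le> Re (trace ((1 / real n) *\<^sub>R tensor_mat (onb_projector n b) \<omega>))"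
      unfolding XX by simp
    also have "\<dots> = (1 / real n) * Re (trace (onb_projector n b) * trace \<omega>)"
      by (simp add: trace_scaleR trace_tensor_mat)
    also have "trace (onb_projector n b) = of_nat n"
    proof -
      have "trace (proj (b i)) = 1" if "i < n" for i
        using trace_mult_proj[of "mat 1" "b i"] b that unfolding orthonormal_basis_of_def n_def by simp
      then show ?thesis by (simp add: onb_projector_def trace_sum)
    qed
    also have "(1 / real n) * Re (of_nat n * trace \<omega>) \<le> 1" by (simp add: tr\<omega>)
    finally have "substate (X ** dagger X)" by (simp add: substate_def psd_self_dagger)
    moreover have "1 - \<epsilon>\<^sup>2 \<le> (fidelity (X ** dagger X) (Y ** dagger Y))\<^sup>2"
    proof -
      have "0 \<le> \<nu>" by (simp add: \<nu>_def sum_nonneg)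
      moreover have "\<nu> \<le> fidelity (X ** dagger X) (Y ** dagger Y)"
        using fidelity_ge_inner[of X Y] by (simp add: inner_XY)
      ultimately have "\<nu>\<^sup>2 \<le> (fidelity (X ** dagger X) (Y ** dagger Y))\<^sup>2" by (intro power_mono)
      with \<nu> show ?thesis by simp
    qed
    ultimately show ?thesis unfolding smoothing_ball_def YY by simp
  qed
  then show ?thesis
    unfolding smooth_Hmin_def n_def[symmetric] using Hmin_ge[OF \<sigma> X\<sigma> n] by (rule SUP_upper2)
qed

subsection \<open>The optimal code and decoder\<close>

definition orthonormal :: "nat \<Rightarrow> (nat \<Rightarrow> complex^'n) \<Rightarrow> bool" where
  "orthonormal s u \<longleftrightarrow> (\<forall>i<s. \<forall>j<s. cinner (u i) (u j) = (if i = j then 1 else 0))"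

lemma orthonormalD: "orthonormal s u \<Longrightarrow> i < s \<Longrightarrow> j < s \<Longrightarrow> cinner (u i) (u j) = (if i = j then 1 else 0)"
  by (simp add: orthonormal_def)

lemma orthonormal_span:
  fixes c :: "nat \<Rightarrow> complex^'n"
  assumes "orthonormal m c"
  shows "vec.dim (vec.span (c ` {..<m})) = m" and "orthonormal_basis_of (vec.span (c ` {..<m})) c"
proof -
  note on = orthonormalD[OF assms]
  have inj: "inj_on c {..<m}"
  proof (rule inj_onI)
    fix i j assume "i \<in> {..<m}" "j \<in> {..<m}" "c i = c j"
    then show "i = j" using on[of i i] on[of i j] by (auto split: if_splits)
  qed
  have ind: "vec.independent (c ` {..<m})"
  proof (rule vec.independent_if_scalars_zero)
    fix f v assume 0: "(\<Sum>x\<in>c ` {..<m}. f x *s x) = 0" and "v \<in> c ` {..<m}"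
    then obtain i where i: "i < m" "v = c i" by auto
    have "0 = cinner (c i) (\<Sum>j<m. f (c j) *s c j)"
      using 0 by (simp add: sum.reindex[OF inj])
    also have "\<dots> = (\<Sum>j<m. f (c j) * cinner (c i) (c j))" by (simp add: cinner_sum_right cinner_scale_right)
    also have "\<dots> = (\<Sum>j<m. if j = i then f (c i) else 0)" using on i by (intro sum.cong) auto
    finally show "f v = 0" using i by simp
  qed simp
  have "card (c ` {..<m}) = m" by (simp add: card_image[OF inj])
  then show dim: "vec.dim (vec.span (c ` {..<m})) = m"
    using vec.dim_span_eq_card_independent[OF ind] by simp
  then show "orthonormal_basis_of (vec.span (c ` {..<m})) c"
    unfolding orthonormal_basis_of_def by (simp add: on)
qed

lemma continuous_on_cinner [continuous_intros]:
  fixes f g :: "'z::topological_space \<Rightarrow> complex^'n"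
  assumes "continuous_on S f" "continuous_on S g"
  shows "continuous_on S (\<lambda>x. cinner (f x) (g x))"
  unfolding cinner_def by (intro continuous_intros assms)

lemma continuous_on_dagger [continuous_intros]:
  fixes f :: "'z::topological_space \<Rightarrow> complex^'n^'m"
  assumes "continuous_on S f" shows "continuous_on S (\<lambda>x. dagger (f x))"
  unfolding dagger_def by (intro continuous_intros assms)

lemma continuous_on_matrix_mult [continuous_intros]:
  fixes f :: "'z::topological_space \<Rightarrow> complex^'n^'m" and g :: "'z \<Rightarrow> complex^'k^'n"
  assumes "continuous_on S f" "continuous_on S g" shows "continuous_on S (\<lambda>x. f x ** g x)"
  unfolding matrix_matrix_mult_def by (intro continuous_intros assms)

lemma continuous_on_trace [continuous_intros]:
  fixes f :: "'z::topological_space \<Rightarrow> complex^'n^'n"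
  assumes "continuous_on S f" shows "continuous_on S (\<lambda>x. trace (f x))"
  unfolding trace_def by (intro continuous_intros assms)

lemma continuous_on_proj [continuous_intros]:
  fixes f :: "'z::topological_space \<Rightarrow> complex^'n"
  assumes "continuous_on S f" shows "continuous_on S (\<lambda>x. proj (f x))"
  unfolding proj_def by (intro continuous_intros assms)

text \<open>The trace of the completeness relation fixes the sum of the squared Hilbert-Schmidt
  norms, hence boundedness. Families are encoded as vectors of matrices to live in a Euclidean
  space.\<close>

lemma compact_kraus_families:
  "compact {V :: complex^'b^'a^'f. (\<Sum>f\<in>UNIV. dagger (V $ f) ** V $ f) = mat 1}" (is "compact ?S")
proof -
  have "closed ?S" by (intro closed_Collect_eq continuous_intros)
  moreover have "bounded ?S"
  proof (rule boundedI)
    fix V assume "V \<in> ?S"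
    then have "trace (\<Sum>f\<in>UNIV. dagger (V $ f) ** V $ f) = trace (mat 1 :: complex^'b^'b)" by simp
    then have "complex_of_real (\<Sum>f\<in>UNIV. (norm (V $ f))\<^sup>2) = of_nat CARD('b)"
      by (simp add: trace_sum trace_dagger_mult_self) (simp add: trace_def mat_def)
    then have "(\<Sum>f\<in>UNIV. (norm (V $ f))\<^sup>2) = real CARD('b)"
      by (metis of_real_eq_iff of_real_of_nat_eq)
    then show "norm V \<le> sqrt (real CARD('b))" by (simp add: norm_vec_def L2_set_def)
  qed
  ultimately show ?thesis by (simp add: compact_eq_bounded_closed)
qed

text \<open>An orthonormal frame of any length is stored in the rows of a square matrix indexed by
  \<open>J\<close>, with zero rows elsewhere, so that the type does not depend on the dimension of
  the code.\<close>

lemma compact_frames: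
  "compact {W :: complex^'a^'a. (\<forall>i j. i \<in> J \<longrightarrow> j \<in> J \<longrightarrow> cinner (W $ i) (W $ j) = (if i = j then 1 else 0)) \<and>
    (\<forall>i. i \<notin> J \<longrightarrow> W $ i = 0)}" (is "compact ?S")
proof -
  have "?S = (\<Inter>i\<in>J. \<Inter>j\<in>J. {W. cinner (W $ i) (W $ j) = (if i = j then 1 else 0)}) \<inter> (\<Inter>i\<in>-J. {W. W $ i = 0})"
    by auto
  also have "closed \<dots>"
    by (intro closed_Int closed_INT ballI closed_Collect_eq continuous_intros)
  finally have "closed ?S" .
  moreover have "bounded ?S"
  proof (rule boundedI)
    fix W assume "W \<in> ?S"
    then have "(norm (W $ i))\<^sup>2 \<le> 1" for i
      by (cases "i \<in> J") (use cinner_self[of "W $ i"] in \<open>auto simp flip: of_real_power\<close>)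
    then have "(\<Sum>i\<in>UNIV. (norm (W $ i))\<^sup>2) \<le> (\<Sum>i\<in>(UNIV :: 'a set). 1)" by (intro sum_mono)
    then show "norm W \<le> sqrt (real CARD('a))" by (simp add: norm_vec_def L2_set_def)
  qed
  ultimately show ?thesis by (simp add: compact_eq_bounded_closed)
qed

lemma quantum_channel_exists: "\<exists>D :: complex^'b^'b \<Rightarrow> complex^'a^'a. quantum_channel D"
proof -
  obtain V :: "unit + 'b \<Rightarrow> complex^'b^'a" where "kraus_complete V"
    by (rule kraus_completion[of "\<lambda>_ :: unit. 0 :: complex^'b^'a"]) (auto simp: op_le_def)
  then show ?thesis using quantum_channel_kraus_map by blast
qed

text \<open>\<open>ent_fidelity\<close> is a supremum over subspaces and decoders; the converse
  needs it attained and the direct part needs it to be an upper bound. The assignment \<Phi> is an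
  arbitrary choice without continuity, so the maximum is taken for \<open>val\<close>, the trace
  formula in a frame and a Kraus family. This is continuous on a compact set, and every code with
  its decoder corresponds to a point of that set and conversely.\<close>

lemma optimal_decoder:
  fixes N :: "complex^'a^'a \<Rightarrow> complex^'b^'b" and U :: "complex^'a^('b::finite \<times> 'e::finite)"
    and \<Phi> :: "(complex^'a) set \<Rightarrow> complex^('a::finite \<times> 'a)"
  assumes U: "stinespring_isometry U N"
    and \<Phi>: "\<And>M. vec.subspace M \<Longrightarrow> M \<noteq> {0} \<Longrightarrow> max_entangled M (\<Phi> M)"
    and m: "1 \<le> m" "m \<le> CARD('a)"
  obtains S and V :: "'b \<times> 'a \<Rightarrow> complex^'b^'a" where "vec.subspace S" "vec.dim S = m"
    "kraus_complete V"
    "ent_fidelity \<Phi> N m = entanglement_fidelity (\<Phi> S) (kraus_map V \<circ> N)"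
    "\<And>M D. vec.subspace M \<Longrightarrow> vec.dim M = m \<Longrightarrow> quantum_channel D \<Longrightarrow>
      entanglement_fidelity (\<Phi> M) (D \<circ> N) \<le> ent_fidelity \<Phi> N m"
proof -
  note N = stinespring_kraus_map[OF U]
  obtain J :: "'a set" where J: "card J = m" using obtain_subset_with_card_n[OF m(2)] by blast
  obtain g where g: "bij_betw g {..<m} J"
    using ex_bij_betw_nat_finite[of J] J by (auto simp: lessThan_atLeast0)
  define Fr where "Fr = {W :: complex^'a^'a. (\<forall>i j. i \<in> J \<longrightarrow> j \<in> J \<longrightarrow> cinner (W $ i) (W $ j) = (if i = j then 1 else 0)) \<and>
    (\<forall>i. i \<notin> J \<longrightarrow> W $ i = 0)}"
  define Iso where "Iso = {V :: complex^'b^'a^('b \<times> 'a). (\<Sum>f\<in>UNIV. dagger (V $ f) ** V $ f) = mat 1}"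
  define val where "val W V = (\<Sum>p\<in>UNIV. (cmod (trace (V $ fst p ** stinespring_kraus U (snd p) ** (\<Sum>j\<in>J. proj (W $ j)))))\<^sup>2) / (real m)\<^sup>2"
    for W :: "complex^'a^'a" and V :: "complex^'b^'a^('b \<times> 'a)"
  define F where "F M D = entanglement_fidelity (\<Phi> M) (D \<circ> N)"
    for M and D :: "complex^'b^'b \<Rightarrow> complex^'a^'a"
  have F_val: "F M (kraus_map (\<lambda>f. V $ f)) = val W V"
    if "vec.subspace M" "vec.dim M = m" "orthonormal_basis_of M b" "onb_projector m b = (\<Sum>j\<in>J. proj (W $ j))" for M b W V
  proof -
    have "M \<noteq> {0}" using that(2) m(1) by auto
    from entanglement_fidelity_kraus_map[OF \<Phi>[OF that(1) this] that(3), of "\<lambda>p. V $ fst p ** stinespring_kraus U (snd p)"]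
    show ?thesis unfolding F_def val_def N kraus_map_compose that(2) that(4) .
  qed
  have dominated: "\<exists>W\<in>Fr. \<exists>V\<in>Iso. F M D = val W V"
    if M: "vec.subspace M" "vec.dim M = m" and D: "quantum_channel D" for M D
  proof -
    obtain K :: "'b \<times> 'a \<Rightarrow> complex^'b^'a" where K: "D = kraus_map K" "kraus_complete K"
      by (rule kraus_representation[OF D], rule that)
    have "M \<noteq> {0}" using M m(1) by auto
    then obtain b where b: "orthonormal_basis_of M b" using \<Phi>[OF M(1)] unfolding max_entangled_def by blast
    define gi where "gi = the_inv_into {..<m} g"
    have gi: "gi j < m" "g (gi j) = j" if "j \<in> J" for j
      using that g the_inv_into_into[of g "{..<m}" j "{..<m}"] f_the_inv_into_f_bij_betw[OF g, of j]
      by (auto simp: gi_def bij_betw_def)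
    have gg: "gi (g i) = i" if "i < m" for i
      using that g by (auto simp: gi_def bij_betw_def the_inv_into_f_f)
    define W :: "complex^'a^'a" where "W = (\<chi> j. if j \<in> J then b (gi j) else 0)"
    define V :: "complex^'b^'a^('b \<times> 'a)" where "V = (\<chi> f. K f)"
    have "W \<in> Fr"
      using b gi unfolding Fr_def W_def orthonormal_basis_of_def M(2) by auto metis+
    moreover have "V \<in> Iso" using K by (simp add: Iso_def V_def)
    moreover have "onb_projector m b = (\<Sum>j\<in>J. proj (W $ j))"
    proof -
      have "(\<Sum>j\<in>J. proj (W $ j)) = (\<Sum>i<m. proj (W $ g i))" by (rule sum.reindex_bij_betw[OF g, symmetric])
      also have "\<dots> = onb_projector m b" unfolding onb_projector_def
        using g gg by (intro sum.cong) (auto simp: W_def bij_betw_def)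
      finally show ?thesis by simp
    qed
    moreover have "D = kraus_map (\<lambda>f. V $ f)" by (simp add: K V_def)
    ultimately show ?thesis using F_val[OF M b] by metis
  qed
  have attained: "\<exists>S. vec.subspace S \<and> vec.dim S = m \<and> (\<forall>V. F S (kraus_map (\<lambda>f. V $ f)) = val W V)" if "W \<in> Fr" for W
  proof -
    define c where "c i = W $ g i" for i
    have on: "orthonormal m c"
      unfolding orthonormal_def
    proof (intro allI impI)
      fix i j assume "i < m" "j < m"
      then have "g i \<in> J" "g j \<in> J" "g i = g j \<longleftrightarrow> i = j" using g by (auto simp: bij_betw_def inj_on_def)
      then show "cinner (c i) (c j) = (if i = j then 1 else 0)" using \<open>W \<in> Fr\<close> by (simp add: c_def Fr_def)
    qed
    have "onb_projector m c = (\<Sum>j\<in>J. proj (W $ j))"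
      unfolding onb_projector_def c_def by (rule sum.reindex_bij_betw[OF g])
    with orthonormal_span[OF on] F_val[of "vec.span (c ` {..<m})" c W] show ?thesis
      by (intro exI[of _ "vec.span (c ` {..<m})"]) auto
  qed
  have "compact (Fr \<times> Iso)" unfolding Fr_def Iso_def by (intro compact_Times compact_frames compact_kraus_families)
  moreover have "Fr \<times> Iso \<noteq> {}"
  proof -
    have "(\<chi> i. if i \<in> J then axis i 1 else 0) \<in> Fr"
      by (auto simp: Fr_def cinner_axis) (auto simp: axis_def)
    moreover obtain D :: "complex^'b^'b \<Rightarrow> complex^'a^'a" where D: "quantum_channel D"
      using quantum_channel_exists by blast
    obtain K :: "'b \<times> 'a \<Rightarrow> complex^'b^'a" where "kraus_complete K"
      by (rule kraus_representation[OF D], rule that)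
    then have "(\<chi> f. K f) \<in> Iso" by (simp add: Iso_def)
    ultimately show ?thesis by blast
  qed
  moreover have "continuous_on (Fr \<times> Iso) (\<lambda>p. val (fst p) (snd p))"
    unfolding val_def using m(1) by (intro continuous_intros) auto
  ultimately obtain p where p: "p \<in> Fr \<times> Iso" and max: "\<And>q. q \<in> Fr \<times> Iso \<Longrightarrow> val (fst q) (snd q) \<le> val (fst p) (snd p)"
    using continuous_attains_sup[of "Fr \<times> Iso" "\<lambda>p. val (fst p) (snd p)"] by blast
  define W V where "W = fst p" and "V = snd p"
  have WV: "W \<in> Fr" "V \<in> Iso" using p by (auto simp: W_def V_def)
  have max: "val W' V' \<le> val W V" if "W' \<in> Fr" "V' \<in> Iso" for W' V'
    using max[of "(W', V')"] that by (simp add: W_def V_def)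
  obtain S where S: "vec.subspace S" "vec.dim S = m" and SV: "F S (kraus_map (\<lambda>f. V $ f)) = val W V"
    using attained[OF WV(1)] by blast
  have V: "(\<Sum>f\<in>UNIV. dagger (V $ f) ** V $ f) = mat 1" using WV(2) by (simp add: Iso_def)
  have le: "F M D \<le> F S (kraus_map (\<lambda>f. V $ f))" if "vec.subspace M" "vec.dim M = m" "quantum_channel D" for M D
    using dominated[OF that] max SV by auto
  have "ent_fidelity \<Phi> N m = F S (kraus_map (\<lambda>f. V $ f))"
    unfolding ent_fidelity_def F_def[symmetric]
    by (rule cSup_eq_maximum) (use S le quantum_channel_kraus_map[OF V] in blast)+
  with S V le show ?thesis by (intro that[of S "\<lambda>f. V $ f"]) (auto simp: F_def)
qed

lemma capacity_converse:
  fixes N :: "complex^'a^'a \<Rightarrow> complex^'b^'b" and U :: "complex^'a^('b::finite \<times> 'e::finite)"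
    and \<Phi> :: "(complex^'a) set \<Rightarrow> complex^('a::finite \<times> 'a)"
  assumes U: "stinespring_isometry U N"
    and \<Phi>: "\<And>M. vec.subspace M \<Longrightarrow> M \<noteq> {0} \<Longrightarrow> max_entangled M (\<Phi> M)"
    and m: "1 \<le> m" "m \<le> CARD('a)" and fid: "1 - \<epsilon>\<^sup>2 \<le> ent_fidelity \<Phi> N m"
  shows "ereal (log 2 (real m)) \<le> (SUP M\<in>{M. vec.subspace M \<and> M \<noteq> {0}}. - smooth_Hmax \<epsilon> (channel_vec U (\<Phi> M)))"
proof -
  obtain S and V :: "'b \<times> 'a \<Rightarrow> complex^'b^'a" where S: "vec.subspace S" "vec.dim S = m"
    and V: "kraus_complete V"
    and eq: "ent_fidelity \<Phi> N m = entanglement_fidelity (\<Phi> S) (kraus_map V \<circ> N)"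
    by (rule optimal_decoder[OF U \<Phi> m]) (assumption | rule that)+
  have S0: "S \<noteq> {0}" using S(2) m(1) by auto
  have "1 - \<epsilon>\<^sup>2 \<le> entanglement_fidelity (\<Phi> S) (kraus_map (\<lambda>p. V (fst p) ** stinespring_kraus U (snd p)))"
    using fid[unfolded eq, unfolded stinespring_kraus_map[OF U] kraus_map_compose] .
  from smooth_Hmin_ge_of_decoder[OF V \<Phi>[OF S(1) S0] _ this]
  have "ereal (log 2 (real m)) \<le> - smooth_Hmax \<epsilon> (channel_vec U (\<Phi> S))"
    using m(1) S(2) by (simp add: smooth_Hmax_def)
  then show ?thesis using S(1) S0 by (intro SUP_upper2[of S]) auto
qed

subsection \<open>Decoding from an operator bound\<close>

lemma inner_mult_left_swap: "inner C (A ** B) = inner (dagger A ** C) B"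
  for A :: "complex^'n^'m" and B :: "complex^'k^'n"
  using inner_mult_left[of A B C] by (simp add: inner_commute)

lemma inner_matrix: "inner A B = Re (\<Sum>i\<in>UNIV. \<Sum>j\<in>UNIV. cnj (A $ i $ j) * B $ i $ j)" for A B :: "complex^'n^'m"
  by (simp add: inner_vec_def inner_complex_def)

text \<open>Conjugate the inequality \<open>op_le B (mat 1)\<close> by the square root of
  \<open>B\<close>.\<close>

lemma psd_square_le:
  assumes "psd B" "op_le B (mat 1)" shows "op_le (B ** B) B"
proof -
  let ?r = "op_sqrt B"
  have "?r ** B ** ?r = B ** B"
    by (metis matrix_mul_assoc op_sqrt_mult[OF assms(1)])
  then show ?thesis
    using op_le_conj[OF assms(2), of ?r] by (simp add: op_sqrt_hermitian[OF assms(1)] op_sqrt_mult[OF assms(1)])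
qed

text \<open>Both vectors factor through \<open>G\<close> as \<open>\<Psi> = \<surd>G V\<close> and \<open>T = \<surd>G W\<close>, and \<open>W\<^sup>* V\<close> is the
  (nearly optimal) operation carrying one purification to the other.\<close>

lemma overlap_contraction:
  fixes \<Psi> :: "complex^'b^'x" and T :: "complex^'r^'x"
  assumes G: "psd G" and \<Psi>: "op_le (\<Psi> ** dagger \<Psi>) G" and T: "op_le (T ** dagger T) G"
  obtains K where "contraction K" "3 / 2 * ((norm \<Psi>)\<^sup>2 + (norm T)\<^sup>2) - 2 * Re (trace G) \<le> inner (T ** K) \<Psi>"
proof -
  define g where "g = op_sqrt G"
  have g: "psd g" "g ** g = G" "dagger g = g"
    by (simp_all add: g_def op_sqrt_psd[OF G] op_sqrt_mult[OF G] op_sqrt_hermitian[OF G])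
  have gn: "inner g g = Re (trace G)" by (simp add: inner_eq_trace g)
  obtain V where V: "contraction V" "\<Psi> = g ** V"
    by (rule douglas_factorization[OF g(1), of \<Psi>]) (use \<Psi> g(2) in simp)
  obtain W where W: "contraction W" "T = g ** W"
    by (rule douglas_factorization[OF g(1), of T]) (use T g(2) in simp)
  \<comment> \<open>The defect \<open>B\<close> lies between 0 and the identity, so its square is
    below \<open>B\<close>. This bounds the squared norm of \<open>g ** B\<close> by its overlap
    with \<open>g\<close>, which is exactly the trace missing from \<open>g ** X\<close>.\<close>
  have defect: "(norm (g - g ** (X ** dagger X)))\<^sup>2 \<le> Re (trace G) - (norm (g ** X))\<^sup>2"
    "inner g (g - g ** (X ** dagger X)) = Re (trace G) - (norm (g ** X))\<^sup>2"
    if X: "contraction X" for X :: "complex^'k^'x"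
  proof -
    define B where "B = mat 1 - X ** dagger X"
    have B: "psd B" "op_le B (mat 1)"
      using contraction_dagger[OF X] psd_self_dagger[of X]
      by (simp_all add: B_def contraction_iff_op_le op_le_def)
    have gB: "g - g ** (X ** dagger X) = g ** B" by (simp add: B_def matrix_diff_ldistrib)
    show eq: "inner g (g - g ** (X ** dagger X)) = Re (trace G) - (norm (g ** X))\<^sup>2"
    proof -
      have "inner (g ** X) (g ** X) = inner g (g ** (X ** dagger X))"
        by (simp only: inner_mult_right matrix_mul_assoc)
      then show ?thesis by (simp add: inner_diff_right gn power2_norm_eq_inner)
    qed
    have "(norm (g ** B))\<^sup>2 = Re (trace (g ** (B ** B) ** g))"
      unfolding power2_norm_eq_inner inner_eq_trace dagger_mult psd_hermitian[OF B(1)] g(3)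
      by (metis matrix_mul_assoc trace_mult_commute)
    also have "\<dots> \<le> Re (trace (g ** B ** g))"
      using op_le_trace[OF op_le_conj[OF psd_square_le[OF B], of g]] by (simp add: g(3))
    also have "trace (g ** B ** g) = trace (g ** (g ** B))"
      by (metis matrix_mul_assoc trace_mult_commute)
    also have "Re (trace (g ** (g ** B))) = inner g (g ** B)" by (simp add: inner_eq_trace g(3))
    finally show "(norm (g - g ** (X ** dagger X)))\<^sup>2 \<le> Re (trace G) - (norm (g ** X))\<^sup>2"
      unfolding gB[symmetric] eq .
  qed
  let ?a = "g - g ** (W ** dagger W)" and ?c = "g - g ** (V ** dagger V)"
  have "inner (T ** (dagger W ** V)) \<Psi> = inner (g ** (W ** dagger W)) (g ** (V ** dagger V))"
    unfolding V(2) W(2) matrix_mul_assoc by (simp add: inner_mult_right matrix_mul_assoc)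
  also have "\<dots> = inner (g - ?a) (g - ?c)" by simp
  also have "\<dots> = inner g g - inner g ?c - inner g ?a + inner ?a ?c"
    by (simp only: inner_diff_left inner_diff_right inner_commute) 
  also have "\<dots> = Re (trace G) - (Re (trace G) - (norm \<Psi>)\<^sup>2) - (Re (trace G) - (norm T)\<^sup>2) + inner ?a ?c"
    by (simp only: gn defect(2)[OF V(1)] defect(2)[OF W(1)] V(2)[symmetric] W(2)[symmetric])
  finally have "inner (T ** (dagger W ** V)) \<Psi>
    = Re (trace G) - (Re (trace G) - (norm \<Psi>)\<^sup>2) - (Re (trace G) - (norm T)\<^sup>2) + inner ?a ?c" .
  \<comment> \<open>Expanding the square of \<open>?a + ?c\<close> costs half of each missing trace.
    This is what turns the coefficients 1 and -1 of the preceding identity into 3/2 and -2.\<close>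
  moreover have "inner ?a ?c \<ge> - (((Re (trace G) - (norm T)\<^sup>2) + (Re (trace G) - (norm \<Psi>)\<^sup>2)) / 2)"
  proof -
    have "0 \<le> (norm (?a + ?c))\<^sup>2" by simp
    also have "\<dots> = (norm ?a)\<^sup>2 + (norm ?c)\<^sup>2 + 2 * inner ?a ?c"
      unfolding power2_norm_eq_inner by (simp only: inner_add_left inner_add_right inner_commute)
    finally show ?thesis
      using defect(1)[OF W(1)] defect(1)[OF V(1)] unfolding V(2)[symmetric] W(2)[symmetric] by argo
  qed
  ultimately have "3 / 2 * ((norm \<Psi>)\<^sup>2 + (norm T)\<^sup>2) - 2 * Re (trace G) \<le> inner (T ** (dagger W ** V)) \<Psi>"
    by argo
  moreover have "contraction (dagger W ** V)" by (rule contraction_mult[OF contraction_dagger[OF W(1)] V(1)])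
  ultimately show ?thesis by (intro that)
qed

text \<open>The operator that attaches the reference vector \<open>u\<close> to an environment
  vector. Its adjoint is the partial inner product with \<open>u\<close>, so multiplying by it cuts
  out the block of a matrix along \<open>u\<close>.\<close>

definition lift :: "complex^'a \<Rightarrow> complex^'e^('a::finite \<times> 'e::finite)" where
  "lift u = (\<chi> p e. if snd p = e then u $ fst p else 0)"

lemma dagger_lift_mult: "(dagger (lift u) ** Z) $ e $ b = (\<Sum>a\<in>UNIV. cnj (u $ a) * Z $ (a, e) $ b)"
proof -
  have "(dagger (lift u) ** Z) $ e $ b
      = (\<Sum>a\<in>UNIV. \<Sum>e'\<in>UNIV. if e' = e then cnj (u $ a) * Z $ (a, e) $ b else 0)"
    unfolding matrix_matrix_mult_def dagger_def lift_def sum_UNIV_prod vec_lambda_beta fst_conv snd_conv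
    by (intro sum.cong refl) auto
  then show ?thesis by simp
qed

lemma dagger_lift_lift: "dagger (lift u) ** lift v = (\<chi> e e'. if e = e' then cinner u v else 0)"
  unfolding vec_eq_iff dagger_lift_mult by (auto simp: lift_def cinner_def)

lemma dagger_lift_lift_orthonormal:
  "cinner u v = 1 \<Longrightarrow> dagger (lift u) ** lift v = mat 1"
  "cinner u v = 0 \<Longrightarrow> dagger (lift u) ** lift v = 0"
  by (simp_all add: dagger_lift_lift mat_def vec_eq_iff)

lemma mult_lift_component: "(A ** dagger (lift v)) $ x $ p = A $ x $ snd p * cnj (v $ fst p)"
proof -
  have "(A ** dagger (lift v)) $ x $ p = (\<Sum>e\<in>UNIV. if e = snd p then A $ x $ snd p * cnj (v $ fst p) else 0)"
    unfolding matrix_matrix_mult_def dagger_def lift_def vec_lambda_beta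
    by (intro sum.cong refl) auto
  then show ?thesis by simp
qed

lemma lift_mult_component: "(lift v ** A) $ p $ x = v $ fst p * A $ snd p $ x"
proof -
  have "(lift v ** A) $ p $ x = (\<Sum>e\<in>UNIV. if e = snd p then v $ fst p * A $ snd p $ x else 0)"
    unfolding matrix_matrix_mult_def lift_def vec_lambda_beta
    by (intro sum.cong refl) auto
  then show ?thesis by simp
qed

lemma lift_conj: "lift u ** A ** dagger (lift u) = tensor_mat (proj u) A"
  by (simp add: vec_eq_iff mult_lift_component lift_mult_component tensor_mat_def proj_def mult_ac)

lemma tensor_mat_sum_left: "tensor_mat (sum f S) A = (\<Sum>i\<in>S. tensor_mat (f i) A)"
  by (simp add: vec_eq_iff tensor_mat_def sum_distrib_right)

lemma tensor_onb_projector: "tensor_mat (onb_projector s u) A = (\<Sum>k<s. lift (u k) ** A ** dagger (lift (u k)))"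
  by (simp add: onb_projector_def tensor_mat_sum_left lift_conj)

lemma tensor_mat_1_1: "tensor_mat (mat 1) (mat 1) = mat 1"
  by (simp add: vec_eq_iff tensor_mat_def mat_def prod_eq_iff)

lemma orthonormal_projector:
  assumes "orthonormal s u"
  shows "onb_projector s u ** onb_projector s u = onb_projector s u" "op_le (onb_projector s u) (mat 1)"
  using onb_projector_idem[OF orthonormal_span(2)[OF assms]] op_le_onb_projector[OF orthonormal_span(2)[OF assms]]
  unfolding orthonormal_span(1)[OF assms] by -

text \<open>The projector inequality of the frame, tensored with the identity of the environment and
  evaluated at \<open>z\<close>.\<close>

lemma bessel_lift_vec:
  assumes "orthonormal s u" shows "(\<Sum>k<s. (norm (dagger (lift (u k)) *v z))\<^sup>2) \<le> (norm z)\<^sup>2"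
proof -
  have "psd (tensor_mat (mat 1 - onb_projector s u) (mat 1))"
    using orthonormal_projector(2)[OF assms] by (intro psd_tensor_mat) (simp_all add: op_le_def)
  then have "0 \<le> inner z ((mat 1 - tensor_mat (onb_projector s u) (mat 1)) *v z)"
    unfolding tensor_mat_diff_left tensor_mat_1_1 psd_iff by blast
  also have "\<dots> = (norm z)\<^sup>2 - (\<Sum>k<s. inner z ((lift (u k) ** dagger (lift (u k))) *v z))"
    by (simp add: tensor_onb_projector matrix_vector_mult_diff_rdistrib inner_diff_right power2_norm_eq_inner
        matrix_vector_sum_left inner_sum_right)
  also have "\<dots> = (norm z)\<^sup>2 - (\<Sum>k<s. (norm (dagger (lift (u k)) *v z))\<^sup>2)"
    by (simp add: matrix_vector_mul_assoc[symmetric] inner_matrix_vector power2_norm_eq_inner)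
  finally show ?thesis by simp
qed

lemma norm_cnj_vec: "norm (\<chi> i. cnj (y $ i)) = norm y"
  by (simp add: norm_vec_def)

lemma trace_onb_projector:
  assumes "orthonormal s u" shows "trace (onb_projector s u) = of_nat s"
proof -
  have "trace (proj (u i)) = 1" if "i < s" for i
    using trace_mult_proj[of "mat 1" "u i"] orthonormalD[OF assms that that] by simp
  then show ?thesis by (simp add: onb_projector_def trace_sum)
qed

text \<open>The contraction from \<open>overlap_contraction\<close> carries the channel output
  towards a purification of the ideal product state. Cut along the reference vectors
  \<open>u k\<close>, it becomes a decoder that writes the codeword \<open>w k\<close> and keeps an
  environment index \<open>f\<close> as Kraus index. Hypothesis \<open>rel\<close> says that the
  block of \<open>\<Psi>\<close> along \<open>u k\<close> is the channel acting on
  \<open>w k\<close>.\<close>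

lemma code_decoder:
  fixes u w :: "nat \<Rightarrow> complex^'a" and \<Psi> :: "complex^'b^('a::finite \<times> 'e::finite)" and Ne :: "'e \<Rightarrow> complex^'a^'b"
  assumes u: "orthonormal s u" and w: "orthonormal s w" and s: "1 \<le> s" and m: "1 \<le> m"
    and rel: "\<And>k e b. k < s \<Longrightarrow> (dagger (lift (u k)) ** \<Psi>) $ e $ b = complex_of_real (1 / sqrt (real m)) * (Ne e *v w k) $ b"
    and R: "psd R" "Re (trace R) \<le> 1"
    and G: "psd G" "op_le ((1 / real s) *\<^sub>R tensor_mat (onb_projector s u) R) G"
      "op_le ((real m / real s) *\<^sub>R (tensor_mat (onb_projector s u) (mat 1) ** (\<Psi> ** dagger \<Psi>) ** tensor_mat (onb_projector s u) (mat 1))) G"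
    and tr: "(\<Sum>k<s. (norm (dagger (lift (u k)) ** \<Psi>))\<^sup>2) = real s / real m"
    and t: "Re (trace G) \<le> Re (trace R) + t" "2 * t \<le> 1"
  obtains V :: "'e + 'b \<Rightarrow> complex^'b^'a" where "kraus_complete V"
    "(1 - 2 * t)\<^sup>2 \<le> (\<Sum>p\<in>UNIV. (cmod (trace (V (fst p) ** Ne (snd p) ** onb_projector s w)))\<^sup>2) / (real s)\<^sup>2"
proof -
  define \<omega> where "\<omega> = op_sqrt R"
  have \<omega>: "dagger \<omega> = \<omega>" "\<omega> ** \<omega> = R" "(norm \<omega>)\<^sup>2 = Re (trace R)"
    by (simp_all add: \<omega>_def op_sqrt_hermitian[OF R(1)] op_sqrt_mult[OF R(1)] norm_op_sqrt[OF R(1)])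
  let ?P = "onb_projector s u"
  \<comment> \<open>\<open>T\<close> purifies the product of the maximally mixed code state and
    \<open>R\<close>; \<open>\<Psi>S\<close> purifies the code state cut out of
    \<open>\<Psi>\<close> and rescaled to unit norm.\<close>
  define T where "T = (1 / sqrt (real s)) *\<^sub>R tensor_mat ?P \<omega>"
  define \<Psi>S where "\<Psi>S = sqrt (real m / real s) *\<^sub>R (tensor_mat ?P (mat 1) ** \<Psi>)"
  have hP: "dagger (tensor_mat ?P A) = tensor_mat ?P (dagger A)" for A :: "complex^'e^'e"
    by (simp add: dagger_tensor_mat dagger_onb_projector)
  have TT: "T ** dagger T = (1 / real s) *\<^sub>R tensor_mat ?P R"
    by (simp add: T_def dagger_scaleR hP \<omega> tensor_mat_mult orthonormal_projector(1)[OF u] matrix_scaleR_left matrix_scaleR_right)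
  have \<Psi>\<Psi>: "\<Psi>S ** dagger \<Psi>S = (real m / real s) *\<^sub>R (tensor_mat ?P (mat 1) ** (\<Psi> ** dagger \<Psi>) ** tensor_mat ?P (mat 1))"
    by (simp add: \<Psi>S_def dagger_scaleR dagger_mult hP matrix_scaleR_left matrix_scaleR_right matrix_mul_assoc)
  have normT: "(norm T)\<^sup>2 = Re (trace R)"
  proof -
    have "(norm T)\<^sup>2 = Re (trace (T ** dagger T))" by (simp add: trace_self_dagger)
    then show ?thesis using s by (simp add: TT trace_scaleR trace_tensor_mat trace_onb_projector[OF u])
  qed
  have normP: "(norm \<Psi>S)\<^sup>2 = 1"
  proof -
    have "(norm (tensor_mat ?P (mat 1) ** \<Psi>))\<^sup>2 = inner \<Psi> (tensor_mat ?P (mat 1) ** (tensor_mat ?P (mat 1) ** \<Psi>))"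
      by (simp add: power2_norm_eq_inner inner_mult_left hP)
    also have "\<dots> = inner \<Psi> (tensor_mat ?P (mat 1) ** \<Psi>)"
      by (simp add: matrix_mul_assoc tensor_mat_mult orthonormal_projector(1)[OF u])
    also have "\<dots> = (\<Sum>k<s. inner \<Psi> (lift (u k) ** (dagger (lift (u k)) ** \<Psi>)))"
      by (simp add: tensor_onb_projector matrix_sum_left inner_sum_right matrix_mul_assoc)
    also have "\<dots> = (\<Sum>k<s. (norm (dagger (lift (u k)) ** \<Psi>))\<^sup>2)"
      by (simp add: inner_mult_left_swap power2_norm_eq_inner)
    finally have "(norm (tensor_mat ?P (mat 1) ** \<Psi>))\<^sup>2 = real s / real m" by (simp add: tr)
    then show ?thesis using s m by (simp add: \<Psi>S_def power_mult_distrib)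
  qed
  obtain K where K: "contraction K"
    and ov: "3 / 2 * ((norm \<Psi>S)\<^sup>2 + (norm T)\<^sup>2) - 2 * Re (trace G) \<le> inner (T ** K) \<Psi>S"
    by (rule overlap_contraction[of G \<Psi>S T]) (use G TT \<Psi>\<Psi> in simp_all)
  \<comment> \<open>The overlap is at least \<open>3 / 2 - Re (trace R) / 2 - 2 * t\<close>, and the
    trace of \<open>R\<close> is at most 1.\<close>
  then have ov: "1 - 2 * t \<le> inner (T ** K) \<Psi>S" using t(1) R(2) unfolding normT normP by argo
  define k1 where "k1 k = dagger (lift (u k)) ** K" for k
  \<comment> \<open>The entries are conjugated because an operator on the purifying system
    multiplies a purification matrix from the right by its transpose, while the overlap moves
    \<open>K\<close> to the other side as an adjoint.\<close>
  define V1 where "V1 f = (\<chi> a b. \<Sum>k<s. w k $ a * cnj (k1 k $ f $ b))" for f :: 'e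
  define z where "z k f y = (\<Sum>b\<in>UNIV. cnj (k1 k $ f $ b) * y $ b)" for k f y
  have V1_y: "V1 f *v y = (\<Sum>l<s. z l f y *s w l)" for f y
  proof -
    have "(V1 f *v y) $ a = (\<Sum>b\<in>UNIV. \<Sum>l<s. w l $ a * cnj (k1 l $ f $ b) * y $ b)" for a
      by (simp add: V1_def matrix_vector_mult_def sum_distrib_right)
    then have "(V1 f *v y) $ a = (\<Sum>l<s. \<Sum>b\<in>UNIV. w l $ a * cnj (k1 l $ f $ b) * y $ b)" for a
      by (subst sum.swap)
    then show ?thesis by (simp add: vec_eq_iff sum_distrib_right sum_distrib_left mult_ac z_def)
  qed
  have V1_w: "cinner (w k) (V1 f *v y) = z k f y" if "k < s" for k f y
  proof -
    have "cinner (w k) (V1 f *v y) = (\<Sum>l<s. z l f y * cinner (w k) (w l))"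
      by (simp add: V1_y cinner_sum_right cinner_scale_right)
    also have "\<dots> = (\<Sum>l<s. if l = k then z k f y else 0)"
      using orthonormalD[OF w] that by (intro sum.cong) auto
    finally show ?thesis using that by simp
  qed
  have V1_norm: "(norm (V1 f *v y))\<^sup>2 = (\<Sum>k<s. (cmod (z k f y))\<^sup>2)" for f y
  proof -
    have "complex_of_real ((norm (V1 f *v y))\<^sup>2) = cinner (V1 f *v y) (V1 f *v y)" by (simp add: cinner_self)
    also have "\<dots> = (\<Sum>l<s. cnj (z l f y) * cinner (w l) (V1 f *v y))"
      by (subst (1) V1_y) (simp add: cinner_sum_left cinner_scale_left)
    also have "\<dots> = (\<Sum>l<s. cnj (z l f y) * z l f y)" by (intro sum.cong) (simp_all add: V1_w)
    also have "\<dots> = complex_of_real (\<Sum>l<s. (cmod (z l f y))\<^sup>2)"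
      by (simp only: of_real_sum complex_norm_square mult.commute)
    finally show ?thesis unfolding of_real_eq_iff .
  qed
  have V1_le: "op_le (\<Sum>f\<in>UNIV. dagger (V1 f) ** V1 f) (mat 1)"
  proof (rule op_leI)
    fix y
    have "inner y ((\<Sum>f\<in>UNIV. dagger (V1 f) ** V1 f) *v y) = (\<Sum>f\<in>UNIV. (norm (V1 f *v y))\<^sup>2)"
      by (simp add: matrix_vector_sum_left inner_sum_right matrix_vector_mul_assoc[symmetric] inner_matrix_vector power2_norm_eq_inner)
    also have "\<dots> = (\<Sum>k<s. \<Sum>f\<in>UNIV. (cmod (z k f y))\<^sup>2)"
      unfolding V1_norm by (rule sum.swap)
    also have "\<dots> = (\<Sum>k<s. (norm (k1 k *v (\<chi> b. cnj (y $ b))))\<^sup>2)"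
    proof (intro sum.cong refl)
      fix k
      have "cmod (z k f y) = cmod (\<Sum>b\<in>UNIV. k1 k $ f $ b * cnj (y $ b))" for f
        unfolding z_def by (subst complex_mod_cnj[symmetric]) simp
      then show "(\<Sum>f\<in>UNIV. (cmod (z k f y))\<^sup>2) = (norm (k1 k *v (\<chi> b. cnj (y $ b))))\<^sup>2"
        by (simp add: norm_vec_def L2_set_def sum_nonneg matrix_vector_mult_def)
    qed
    also have "\<dots> \<le> (norm (K *v (\<chi> b. cnj (y $ b))))\<^sup>2"
      unfolding k1_def matrix_vector_mul_assoc[symmetric] by (rule bessel_lift_vec[OF u])
    also have "\<dots> \<le> (norm (\<chi> b. cnj (y $ b)))\<^sup>2" using K by (simp add: contraction_def power_mono)
    finally show "inner y ((\<Sum>f\<in>UNIV. dagger (V1 f) ** V1 f) *v y) \<le> inner y (mat 1 *v y)"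
      by (simp add: norm_cnj_vec power2_norm_eq_inner)
  qed (simp_all add: dagger_sum dagger_mult)
  \<comment> \<open>\<open>V1\<close> is only a subnormalized family; the operators added to
    complete it contribute nonnegative terms to the fidelity.\<close>
  obtain V :: "'e + 'b \<Rightarrow> complex^'b^'a" where V: "kraus_complete V" "\<And>f. V (Inl f) = V1 f"
    by (rule kraus_completion[OF V1_le], rule that)
  define x where "x f e = trace (V1 f ** Ne e ** onb_projector s w)" for f e
  have x: "x f e = (\<Sum>k<s. cinner (w k) (V1 f *v (Ne e *v w k)))" for f e
    by (simp add: x_def onb_projector_def matrix_sum_right trace_sum trace_mult_proj matrix_vector_mul_assoc)
  have "inner (T ** K) \<Psi>S = (sqrt (real m) / real s) * inner (tensor_mat ?P \<omega> ** K) \<Psi>"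
  proof -
    have "inner (tensor_mat ?P \<omega> ** K) (tensor_mat ?P (mat 1) ** \<Psi>) = inner (tensor_mat ?P \<omega> ** K) \<Psi>"
      unfolding inner_commute[of "tensor_mat ?P \<omega> ** K"] inner_mult_left hP
      by (simp add: matrix_mul_assoc tensor_mat_mult orthonormal_projector(1)[OF u])
    then show ?thesis using s
      by (simp add: T_def \<Psi>S_def matrix_scaleR_left real_sqrt_divide field_simps)
  qed
  also have "inner (tensor_mat ?P \<omega> ** K) \<Psi> = (\<Sum>k<s. inner (\<omega> ** k1 k) (dagger (lift (u k)) ** \<Psi>))"
    unfolding tensor_onb_projector matrix_sum_left inner_sum_left k1_def matrix_mul_assoc[symmetric] inner_mult_left ..
  also have "\<dots> = (\<Sum>k<s. Re (\<Sum>e\<in>UNIV. \<Sum>f\<in>UNIV. cnj (\<omega> $ e $ f) * (\<Sum>b\<in>UNIV. cnj (k1 k $ f $ b) * (dagger (lift (u k)) ** \<Psi>) $ e $ b)))"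
  proof (intro sum.cong refl)
    fix k
    have "inner (\<omega> ** k1 k) Z = Re (\<Sum>e\<in>UNIV. \<Sum>b\<in>UNIV. \<Sum>f\<in>UNIV. cnj (\<omega> $ e $ f) * cnj (k1 k $ f $ b) * Z $ e $ b)" for Z
      unfolding inner_matrix matrix_matrix_mult_def vec_lambda_beta cnj_sum complex_cnj_mult sum_distrib_right ..
    then have "inner (\<omega> ** k1 k) Z = Re (\<Sum>e\<in>UNIV. \<Sum>f\<in>UNIV. \<Sum>b\<in>UNIV. cnj (\<omega> $ e $ f) * cnj (k1 k $ f $ b) * Z $ e $ b)" for Z
      by (simp only: sum.swap[of _ "UNIV :: 'e set" "UNIV :: 'b set"])
    then show "inner (\<omega> ** k1 k) (dagger (lift (u k)) ** \<Psi>) = Re (\<Sum>e\<in>UNIV. \<Sum>f\<in>UNIV. cnj (\<omega> $ e $ f) * (\<Sum>b\<in>UNIV. cnj (k1 k $ f $ b) * (dagger (lift (u k)) ** \<Psi>) $ e $ b))"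
      by (simp only: sum_distrib_left mult.assoc)
  qed
  also have "\<dots> = (\<Sum>k<s. Re (\<Sum>e\<in>UNIV. \<Sum>f\<in>UNIV. cnj (\<omega> $ e $ f) * (complex_of_real (1 / sqrt (real m)) * cinner (w k) (V1 f *v (Ne e *v w k)))))"
    by (intro sum.cong refl) (simp add: rel V1_w z_def sum_distrib_left mult_ac)
  also have "\<dots> = Re (\<Sum>k<s. \<Sum>e\<in>UNIV. \<Sum>f\<in>UNIV. cnj (\<omega> $ e $ f) * (complex_of_real (1 / sqrt (real m)) * cinner (w k) (V1 f *v (Ne e *v w k))))"
    by (simp only: Re_sum)
  also have "(\<Sum>k<s. \<Sum>e\<in>UNIV. \<Sum>f\<in>UNIV. cnj (\<omega> $ e $ f) * (complex_of_real (1 / sqrt (real m)) * cinner (w k) (V1 f *v (Ne e *v w k))))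
    = (\<Sum>e\<in>UNIV. \<Sum>f\<in>UNIV. \<Sum>k<s. cnj (\<omega> $ e $ f) * (complex_of_real (1 / sqrt (real m)) * cinner (w k) (V1 f *v (Ne e *v w k))))"
    by (rule sum_UNIV_swap3[symmetric])
  also have "\<dots> = complex_of_real (1 / sqrt (real m)) * (\<Sum>e\<in>UNIV. \<Sum>f\<in>UNIV. cnj (\<omega> $ e $ f) * x f e)"
    unfolding x by (simp only: sum_distrib_left mult.left_commute)
  finally have "inner (T ** K) \<Psi>S = Re (\<Sum>e\<in>UNIV. \<Sum>f\<in>UNIV. cnj (\<omega> $ e $ f) * x f e) / real s"
    using m s by (simp add: field_simps)
  also have "Re (\<Sum>e\<in>UNIV. \<Sum>f\<in>UNIV. cnj (\<omega> $ e $ f) * x f e) = inner \<omega> (\<chi> e f. x f e)"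
    by (simp add: inner_vec_def inner_complex_def)
  \<comment> \<open>The overlap adds the amplitudes \<open>x f e\<close> coherently with weights
    \<omega>. Since \<omega> has norm at most 1, it is dominated by the root of the sum of squares,
    which is what the entanglement fidelity contains.\<close>
  also have "\<dots> \<le> norm \<omega> * norm ((\<chi> e f. x f e) :: complex^'e^'e)" by (rule norm_cauchy_schwarz)
  also have "\<dots> \<le> norm ((\<chi> e f. x f e) :: complex^'e^'e)"
  proof -
    have "(norm \<omega>)\<^sup>2 \<le> 1\<^sup>2" using R(2) \<omega>(3) by simp
    then have "norm \<omega> \<le> 1" by (rule power2_le_imp_le) simp
    then show ?thesis by (simp add: mult_left_le_one_le)
  qed
  finally have "1 - 2 * t \<le> norm ((\<chi> e f. x f e) :: complex^'e^'e) / real s"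
    using ov s by (simp add: divide_right_mono)
  then have "(1 - 2 * t)\<^sup>2 \<le> (norm ((\<chi> e f. x f e) :: complex^'e^'e) / real s)\<^sup>2"
    using t(2) by (intro power_mono) auto
  also have "\<dots> = (\<Sum>e\<in>UNIV. \<Sum>f\<in>UNIV. (cmod (x f e))\<^sup>2) / (real s)\<^sup>2"
    by (simp add: power_divide norm_vec_def L2_set_def sum_nonneg)
  also have "(\<Sum>e\<in>UNIV. \<Sum>f\<in>UNIV. (cmod (x f e))\<^sup>2) = (\<Sum>f\<in>UNIV. \<Sum>e\<in>UNIV. (cmod (x f e))\<^sup>2)"
    by (rule sum.swap)
  also have "(\<Sum>f\<in>UNIV. \<Sum>e\<in>UNIV. (cmod (x f e))\<^sup>2) / (real s)\<^sup>2
      \<le> (\<Sum>p\<in>UNIV. (cmod (trace (V (fst p) ** Ne (snd p) ** onb_projector s w)))\<^sup>2) / (real s)\<^sup>2"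
  proof (rule divide_right_mono)
    let ?y = "\<lambda>f. \<Sum>e\<in>UNIV. (cmod (trace (V f ** Ne e ** onb_projector s w)))\<^sup>2"
    have "(\<Sum>f\<in>UNIV. \<Sum>e\<in>UNIV. (cmod (x f e))\<^sup>2) = (\<Sum>f\<in>UNIV. ?y (Inl f))" by (simp add: x_def V(2))
    also have "\<dots> \<le> (\<Sum>f\<in>UNIV. ?y (Inl f)) + (\<Sum>j\<in>UNIV. ?y (Inr j))" by (simp add: sum_nonneg)
    also have "\<dots> = sum ?y UNIV" unfolding UNIV_Plus_UNIV[symmetric] by (subst sum.Plus) auto
    finally show "(\<Sum>f\<in>UNIV. \<Sum>e\<in>UNIV. (cmod (x f e))\<^sup>2) \<le> (\<Sum>p\<in>UNIV. (cmod (trace (V (fst p) ** Ne (snd p) ** onb_projector s w)))\<^sup>2)"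
      by (simp add: sum_UNIV_prod)
  qed simp
  finally show ?thesis using V(1) by (intro that)
qed

subsection \<open>Averaging over phases and over subsets\<close>

text \<open>Fourth roots of unity instead of signs: the products
  \<open>cnj (\<theta> i) * \<theta> j\<close> for a pair and for its reversal are orthogonal only
  if the square of a single phase averages to zero.\<close>

definition quartic_phases :: "nat \<Rightarrow> (nat \<Rightarrow> complex) set" where
  "quartic_phases m = PiE {..<m} (\<lambda>_. {1, \<i>, -1, -\<i>})"

lemma finite_quartic_phases: "finite (quartic_phases m)"
  by (simp add: quartic_phases_def finite_PiE)

lemma quartic_phases_nonempty: "quartic_phases m \<noteq> {}"
  by (simp add: quartic_phases_def PiE_eq_empty_iff)

lemma quartic_phases_norm: "\<theta> \<in> quartic_phases m \<Longrightarrow> i < m \<Longrightarrow> cmod (\<theta> i) = 1"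
  by (auto simp: quartic_phases_def dest!: PiE_mem[of _ _ _ i])

text \<open>Rotating one coordinate by \<i> permutes the phase vectors, so the sum equals
  \<open>c\<close> times itself.\<close>

lemma sum_phase_rotate:
  assumes p: "p < m" and rot: "\<And>\<theta>. \<theta> \<in> quartic_phases m \<Longrightarrow> F (\<theta>(p := \<i> * \<theta> p)) = c * F \<theta>" and c: "c \<noteq> 1"
  shows "(\<Sum>\<theta>\<in>quartic_phases m. F \<theta>) = (0 :: complex)"
proof -
  have mem: "\<theta>(p := z * \<theta> p) \<in> quartic_phases m" if "\<theta> \<in> quartic_phases m" "z \<in> {\<i>, -\<i>}" for \<theta> z
    using that p unfolding quartic_phases_def by (auto simp: PiE_iff extensional_def)
  have "(\<Sum>\<theta>\<in>quartic_phases m. F \<theta>) = (\<Sum>\<theta>\<in>quartic_phases m. F (\<theta>(p := \<i> * \<theta> p)))"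
    by (rule sum.reindex_bij_witness[where i = "\<lambda>\<theta>. \<theta>(p := \<i> * \<theta> p)" and j = "\<lambda>\<theta>. \<theta>(p := -\<i> * \<theta> p)"])
      (use mem[of _ \<i>] mem[of _ "-\<i>"] in auto)
  also have "\<dots> = c * (\<Sum>\<theta>\<in>quartic_phases m. F \<theta>)" by (simp add: rot sum_distrib_left)
  finally have "(1 - c) * (\<Sum>\<theta>\<in>quartic_phases m. F \<theta>) = 0" by (simp add: algebra_simps)
  then show ?thesis using c by simp
qed

definition off_diagonal :: "nat \<Rightarrow> (nat \<times> nat) set" where
  "off_diagonal m = {(i, j). i < m \<and> j < m \<and> i \<noteq> j}"

lemma finite_off_diagonal: "finite (off_diagonal m)"
  by (rule finite_subset[of _ "{..<m} \<times> {..<m}"]) (auto simp: off_diagonal_def)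

lemma phase_orthogonality:
  assumes "p \<in> off_diagonal m" "q \<in> off_diagonal m"
  shows "(\<Sum>\<theta>\<in>quartic_phases m. (cnj (\<theta> (fst p)) * \<theta> (snd p)) * cnj (cnj (\<theta> (fst q)) * \<theta> (snd q)))
    = (if p = q then of_nat (card (quartic_phases m)) else 0)"
proof -
  obtain i j k l where pq: "p = (i, j)" "q = (k, l)" by (cases p, cases q)
  then have ij: "i < m" "j < m" "i \<noteq> j" "k < m" "l < m" "k \<noteq> l" using assms by (auto simp: off_diagonal_def)
  let ?F = "\<lambda>\<theta>. (cnj (\<theta> i) * \<theta> j) * cnj (cnj (\<theta> k) * \<theta> l)"
  consider "p = q" | "i \<noteq> k" "i = l" | "i \<noteq> k" "i \<noteq> l" | "i = k" "j \<noteq> l" using pq by auto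
  then show ?thesis
  proof cases
    case 1
    have "?F \<theta> = 1" if "\<theta> \<in> quartic_phases m" for \<theta>
    proof -
      have "cmod (cnj (\<theta> i) * \<theta> j) = 1" using that ij by (simp add: norm_mult quartic_phases_norm)
      then have "(cnj (\<theta> i) * \<theta> j) * cnj (cnj (\<theta> i) * \<theta> j) = 1"
        using complex_norm_square[of "cnj (\<theta> i) * \<theta> j"] by simp
      then show ?thesis using 1 pq by simp
    qed
    then show ?thesis using 1 pq by simp
  next
    \<comment> \<open>The phase \<open>\<theta> i\<close> occurs twice, both times conjugated, so
      the rotation multiplies the term by -1. The reversed pair falls into this case.\<close>
    case 2
    have "(\<Sum>\<theta>\<in>quartic_phases m. ?F \<theta>) = 0"
      by (rule sum_phase_rotate[of i m _ "cnj \<i> * cnj \<i>"]) (use ij 2 in \<open>auto simp: mult_ac\<close>)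
    then show ?thesis using 2 pq by simp
  next
    case 3
    have "(\<Sum>\<theta>\<in>quartic_phases m. ?F \<theta>) = 0"
      by (rule sum_phase_rotate[of i m _ "cnj \<i>"]) (use ij 3 in \<open>auto simp: mult_ac complex_eq_iff\<close>)
    then show ?thesis using 3 pq by simp
  next
    case 4
    have "(\<Sum>\<theta>\<in>quartic_phases m. ?F \<theta>) = 0"
      by (rule sum_phase_rotate[of j m _ "\<i>"]) (use ij 4 in \<open>auto simp: mult_ac complex_eq_iff\<close>)
    then show ?thesis using 4 pq by simp
  qed
qed

text \<open>Parseval's identity: expanding the square leaves only the terms with equal pairs, by
  \<open>phase_orthogonality\<close>.\<close>

lemma phase_average:
  "(\<Sum>\<theta>\<in>quartic_phases m. (cmod (\<Sum>p\<in>off_diagonal m. cnj (\<theta> (fst p)) * \<theta> (snd p) * r p))\<^sup>2)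
    = real (card (quartic_phases m)) * (\<Sum>p\<in>off_diagonal m. (cmod (r p))\<^sup>2)"
proof -
  let ?D = "off_diagonal m" and ?Q = "quartic_phases m"
  let ?t = "\<lambda>\<theta> p. cnj (\<theta> (fst p)) * \<theta> (snd p)"
  have "complex_of_real (\<Sum>\<theta>\<in>?Q. (cmod (\<Sum>p\<in>?D. ?t \<theta> p * r p))\<^sup>2)
    = (\<Sum>\<theta>\<in>?Q. \<Sum>p\<in>?D. \<Sum>q\<in>?D. (?t \<theta> p * r p) * cnj (?t \<theta> q * r q))"
    unfolding of_real_sum complex_norm_square cnj_sum sum_product ..
  also have "\<dots> = (\<Sum>p\<in>?D. \<Sum>q\<in>?D. \<Sum>\<theta>\<in>?Q. (?t \<theta> p * r p) * cnj (?t \<theta> q * r q))"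
    by (rule sum_UNIV_swap3[symmetric])
  also have "\<dots> = (\<Sum>p\<in>?D. \<Sum>q\<in>?D. (r p * cnj (r q)) * (\<Sum>\<theta>\<in>?Q. ?t \<theta> p * cnj (?t \<theta> q)))"
    unfolding sum_distrib_left by (intro sum.cong refl) (simp add: mult_ac)
  also have "\<dots> = (\<Sum>p\<in>?D. \<Sum>q\<in>?D. if q = p then (r p * cnj (r p)) * of_nat (card ?Q) else 0)"
  proof (intro sum.cong refl)
    fix p q assume "p \<in> ?D" "q \<in> ?D"
    from phase_orthogonality[OF this]
    show "(r p * cnj (r q)) * (\<Sum>\<theta>\<in>?Q. ?t \<theta> p * cnj (?t \<theta> q))
        = (if q = p then (r p * cnj (r p)) * of_nat (card ?Q) else 0)" by (simp only:) auto
  qed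
  also have "\<dots> = (\<Sum>p\<in>?D. (r p * cnj (r p)) * of_nat (card ?Q))"
    by (simp add: finite_off_diagonal)
  also have "\<dots> = complex_of_real (real (card ?Q) * (\<Sum>p\<in>?D. (cmod (r p))\<^sup>2))"
    by (simp add: sum_distrib_left complex_norm_square mult_ac del: of_real_power)
  finally show ?thesis unfolding of_real_eq_iff .
qed

text \<open>Deleting a uniformly random element does not change the expectation of the normalised
  objective, so some element can be deleted without increasing it.\<close>

lemma subset_average:
  fixes f :: "'k \<Rightarrow> 'k \<Rightarrow> real" and g :: "'k \<Rightarrow> real"
  assumes fin: "finite A" and diag: "\<And>k. f k k = 0" and s: "1 \<le> s" "s \<le> card A"
  shows "\<exists>K\<subseteq>A. card K = s \<and> (\<Sum>k\<in>K. \<Sum>l\<in>K. f k l) + (\<Sum>k\<in>K. g k)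
    \<le> real s * (real s - 1) / (real (card A) * (real (card A) - 1)) * (\<Sum>k\<in>A. \<Sum>l\<in>A. f k l)
      + real s / real (card A) * (\<Sum>k\<in>A. g k)"
proof -
  define H where "H K = real s * (real s - 1) / (real (card K) * (real (card K) - 1)) * (\<Sum>k\<in>K. \<Sum>l\<in>K. f k l)
      + real s / real (card K) * (\<Sum>k\<in>K. g k)" for K
  have step: "\<exists>x\<in>K. H (K - {x}) \<le> H K" if K: "finite K" "card K = Suc n" and n: "s \<le> n" for K n
  proof (rule ccontr)
    assume "\<not> ?thesis"
    then have lt: "H K < H (K - {x})" if "x \<in> K" for x using that by auto
    have ne: "K \<noteq> {}" using K by auto
    define F where "F = (\<Sum>k\<in>K. \<Sum>l\<in>K. f k l)"
    define G where "G = (\<Sum>k\<in>K. g k)"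
    \<comment> \<open>Removing a row and a column subtracts the diagonal entry twice; this is
      harmless because the diagonal of \<open>f\<close> is zero.\<close>
    have F1: "(\<Sum>k\<in>K - {x}. \<Sum>l\<in>K - {x}. f k l) = F - (\<Sum>l\<in>K. f x l) - (\<Sum>k\<in>K. f k x)" if "x \<in> K" for x
      using that K(1) by (simp add: sum_diff1 sum_subtractf F_def diag)
    have "(\<Sum>x\<in>K. F - (\<Sum>l\<in>K. f x l) - (\<Sum>k\<in>K. f k x)) = real (Suc n) * F - F - F"
      using sum.swap[of "\<lambda>x k. f k x" K K] by (simp add: sum_subtractf K F_def)
    then have F2: "(\<Sum>x\<in>K. \<Sum>k\<in>K - {x}. \<Sum>l\<in>K - {x}. f k l) = (real n - 1) * F"
      by (simp add: F1 algebra_simps)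
    have G2: "(\<Sum>x\<in>K. \<Sum>k\<in>K - {x}. g k) = real n * G"
      using K by (simp add: sum_diff1 sum_subtractf G_def algebra_simps)
    have cK: "card (K - {x}) = n" if "x \<in> K" for x using K that by simp
    have "(\<Sum>x\<in>K. H (K - {x})) = real s * (real s - 1) / (real n * (real n - 1)) * ((real n - 1) * F) + real s / real n * (real n * G)"
    proof -
      have "H (K - {x}) = real s * (real s - 1) / (real n * (real n - 1)) * (\<Sum>k\<in>K - {x}. \<Sum>l\<in>K - {x}. f k l)
          + real s / real n * (\<Sum>k\<in>K - {x}. g k)" if "x \<in> K" for x
        unfolding H_def cK[OF that] ..
      then show ?thesis by (simp only: sum.distrib sum_distrib_left[symmetric] F2 G2 cong: sum.cong)
    qed
    also have "\<dots> = real (Suc n) * H K"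
    proof -
      have n1: "real n > 0" using s n by simp
      have "real s * (real s - 1) / (real n * (real n - 1)) * ((real n - 1) * F) = real s * (real s - 1) / real n * F"
      \<comment> \<open>For \<open>n = 1\<close> the denominator is 0, but then \<open>s = 1\<close>
        and the factor \<open>s - 1\<close> makes both sides 0.\<close>
      proof (cases "n = 1")
        case True then have "s = 1" using s n by simp
        then show ?thesis by simp
      next
        case False then show ?thesis using n1 by (simp add: field_simps)
      qed
      moreover have "real (Suc n) * H K = real s * (real s - 1) / real n * F + real s * G"
      proof -
        have "real (Suc n) * (x / (real (Suc n) * (real (Suc n) - 1)) * F + real s / real (Suc n) * G)
            = x / real n * F + real s * G" for x
          using n1 by (simp add: distrib_left)
        then show ?thesis unfolding H_def K(2) F_def[symmetric] G_def[symmetric] .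
      qed
      ultimately show ?thesis using n1 by simp
    qed
    finally have "(\<Sum>x\<in>K. H (K - {x})) = (\<Sum>x\<in>K. H K)" by (simp add: K)
    moreover have "(\<Sum>x\<in>K. H K) < (\<Sum>x\<in>K. H (K - {x}))"
      by (rule sum_strict_mono[OF K(1) ne lt])
    ultimately show False by simp
  qed
  have "\<exists>K\<subseteq>A. card K = card A - d \<and> H K \<le> H A" if "d \<le> card A - s" for d
    using that
  proof (induction d)
    case (Suc d)
    then obtain K where K: "K \<subseteq> A" "card K = card A - d" "H K \<le> H A" by auto
    have "card K = Suc (card A - Suc d)" "s \<le> card A - Suc d" using K(2) Suc.prems s by auto
    then obtain x where "x \<in> K" "H (K - {x}) \<le> H K" using step[of K] finite_subset[OF K(1) fin] by blast
    then show ?case using K \<open>card K = Suc (card A - Suc d)\<close>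
      by (intro exI[of _ "K - {x}"]) auto
  qed auto
  from this[of "card A - s"] obtain K where K: "K \<subseteq> A" "card K = s" "H K \<le> H A" using s by auto
  have "H K = (\<Sum>k\<in>K. \<Sum>l\<in>K. f k l) + (\<Sum>k\<in>K. g k)"
  \<comment> \<open>For \<open>s = 1\<close> the first coefficient of \<open>H\<close> is 0 by the
    convention for division, and the double sum is the single entry
    \<open>f x x = 0\<close>.\<close>
  proof (cases "s = 1")
    case True
    then obtain x where "K = {x}" using K(2) card_1_singletonE by metis
    then show ?thesis using True by (simp add: H_def diag)
  next
    case False
    then show ?thesis using s by (simp add: H_def K(2))
  qed
  then show ?thesis using K by (auto simp: H_def)
qed

subsection \<open>Random codes\<close>

definition fourier_coeff :: "nat \<Rightarrow> (nat \<Rightarrow> complex) \<Rightarrow> nat \<Rightarrow> nat \<Rightarrow> complex" where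
  "fourier_coeff m \<theta> k i = \<theta> i * cis (2 * pi * real k / real m) ^ i / complex_of_real (sqrt (real m))"

lemma fourier_coeff_orthonormal:
  assumes \<theta>: "\<theta> \<in> quartic_phases m" and kl: "k < m" "l < m"
  shows "(\<Sum>i<m. cnj (fourier_coeff m \<theta> k i) * fourier_coeff m \<theta> l i) = (if k = l then 1 else 0)"
proof -
  let ?w = "\<lambda>k. cis (2 * pi * real k / real m)"
  have m: "m > 0" using kl by simp
  define z where "z = cnj (?w k) * ?w l"
  have sq: "complex_of_real (sqrt (real m)) * complex_of_real (sqrt (real m)) = of_nat m"
    by (simp flip: of_real_mult)
  have "cnj (fourier_coeff m \<theta> k i) * fourier_coeff m \<theta> l i = z ^ i / of_nat m" if "i < m" for i
  proof -
    have "cnj (\<theta> i) * \<theta> i = 1"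
      using complex_norm_square[of "\<theta> i"] quartic_phases_norm[OF \<theta> that] by (simp add: mult.commute)
    moreover have "cnj (fourier_coeff m \<theta> k i) * fourier_coeff m \<theta> l i
        = (cnj (\<theta> i) * \<theta> i) * (cnj (?w k) ^ i * ?w l ^ i) / (complex_of_real (sqrt (real m)) * complex_of_real (sqrt (real m)))"
      by (simp add: fourier_coeff_def)
    ultimately show ?thesis unfolding sq by (simp add: z_def power_mult_distrib)
  qed
  then have eq: "(\<Sum>i<m. cnj (fourier_coeff m \<theta> k i) * fourier_coeff m \<theta> l i) = (\<Sum>i<m. z ^ i) / of_nat m"
    by (simp add: sum_divide_distrib)
  have wk: "cnj (?w k) * ?w k = 1" using complex_norm_square[of "?w k"] by (simp add: mult.commute)
  show ?thesis
  proof (cases "k = l")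
    case True
    then have "z = 1" using wk by (simp add: z_def)
    then have "(\<Sum>i<m. z ^ i) / of_nat m = 1" using m by simp
    then show ?thesis using True unfolding eq by simp
  next
    case False
    have "z \<noteq> 1"
    proof
      assume "z = 1"
      then have "cnj (?w k) * ?w l = cnj (?w k) * ?w k" by (simp only: z_def wk)
      moreover have "cnj (?w k) \<noteq> 0" using wk by (metis mult_zero_left zero_neq_one)
      ultimately have "?w l = ?w k" by (metis mult_left_cancel)
      moreover have "inj_on ?w {..<m}" using Complex.bij_betw_roots_unity[OF m] by (simp add: bij_betw_def)
      ultimately show False using False kl by (auto simp: inj_on_def)
    qed
    moreover have "z ^ m = 1"
    proof -
      have "?w j ^ m = 1" if "j < m" for j using Complex.bij_betw_roots_unity[OF m] that by (auto simp: bij_betw_def)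
      then show ?thesis using kl by (simp add: z_def power_mult_distrib flip: complex_cnj_power)
    qed
    ultimately have "(\<Sum>i<m. z ^ i) = 0" by (simp add: geometric_sum)
    then show ?thesis using False by (simp add: eq)
  qed
qed

definition code_vec :: "nat \<Rightarrow> (nat \<Rightarrow> complex) \<Rightarrow> (nat \<Rightarrow> complex^'n) \<Rightarrow> complex^'n" where
  "code_vec m c b = (\<Sum>i<m. c i *s b i)"

lemma cinner_code_vec:
  assumes b: "orthonormal m b"
  shows "cinner (code_vec m c b) (code_vec m d b) = (\<Sum>i<m. cnj (c i) * d i)"
proof -
  have "cinner (code_vec m c b) (code_vec m d b) = (\<Sum>i<m. \<Sum>j<m. cnj (c i) * d j * cinner (b i) (b j))"
    by (simp add: code_vec_def cinner_sum_sum cinner_scale_left cinner_scale_right mult_ac)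
  also have "\<dots> = (\<Sum>i<m. \<Sum>j<m. if j = i then cnj (c i) * d i else 0)"
    using orthonormalD[OF b] by (intro sum.cong refl) auto
  finally show ?thesis by simp
qed

text \<open>The conjugate coefficients give the partner frame. A maximally entangled vector pairs
  the reference vector with coefficients \<open>c\<close> with the input vector with coefficients
  \<open>cnj c\<close>, so a code selected on the reference is sent through the channel in
  conjugated form.\<close>

lemma orthonormal_code_vec:
  assumes "orthonormal m b" "\<theta> \<in> quartic_phases m"
  shows "orthonormal m (\<lambda>k. code_vec m (fourier_coeff m \<theta> k) b)"
    "orthonormal m (\<lambda>k. code_vec m (\<lambda>i. cnj (fourier_coeff m \<theta> k i)) b)"
proof -
  show "orthonormal m (\<lambda>k. code_vec m (fourier_coeff m \<theta> k) b)"
    unfolding orthonormal_def by (simp add: cinner_code_vec[OF assms(1)] fourier_coeff_orthonormal[OF assms(2)])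
  have "(\<Sum>i<m. fourier_coeff m \<theta> k i * cnj (fourier_coeff m \<theta> l i)) = (if k = l then 1 else 0)" if "k < m" "l < m" for k l
    using arg_cong[OF fourier_coeff_orthonormal[OF assms(2) that], of cnj] by (simp add: if_distrib cong: if_cong)
  then show "orthonormal m (\<lambda>k. code_vec m (\<lambda>i. cnj (fourier_coeff m \<theta> k i)) b)"
    unfolding orthonormal_def by (simp add: cinner_code_vec[OF assms(1)])
qed

text \<open>The partial matrix element of \<open>Z\<close> between \<open>u\<close> and
  \<open>v\<close> on the reference, an operator on the environment.\<close>

definition slice :: "complex^'a \<Rightarrow> complex^'a \<Rightarrow> complex^('a::finite \<times> 'e::finite)^('a \<times> 'e) \<Rightarrow> complex^'e^'e" where
  "slice u v Z = dagger (lift u) ** Z ** lift v"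

lemma slice_component: "slice u v Z $ e $ e' = cinner u ((\<chi> a a'. Z $ (a, e) $ (a', e')) *v v)"
proof -
  have "slice u v Z $ e $ e' = (\<Sum>a\<in>UNIV. cnj (u $ a) * (Z ** lift v) $ (a, e) $ e')"
    unfolding slice_def matrix_mul_assoc[symmetric] dagger_lift_mult ..
  moreover have "(Z ** lift v) $ p $ e' = (\<Sum>a'\<in>UNIV. Z $ p $ (a', e') * v $ a')" for p
  proof -
    have "(Z ** lift v) $ p $ e' = (\<Sum>a'\<in>UNIV. \<Sum>x\<in>UNIV. if x = e' then Z $ p $ (a', e') * v $ a' else 0)"
      unfolding matrix_matrix_mult_def lift_def sum_UNIV_prod vec_lambda_beta fst_conv snd_conv
      by (intro sum.cong refl) auto
    then show ?thesis by simp
  qed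
  ultimately show ?thesis by (simp add: cinner_def matrix_vector_mult_def)
qed

lemma slice_code_vec_component:
  "slice (code_vec m c b) (code_vec m d b) Z $ e $ e'
    = (\<Sum>i<m. \<Sum>j<m. cnj (c i) * d j * slice (b i) (b j) Z $ e $ e')"
  by (simp add: slice_component code_vec_def matrix_vector_sum_right vector_scalar_commute cinner_sum_sum
      cinner_scale_left cinner_scale_right mult_ac)

lemma norm_matrix_components: "(norm A)\<^sup>2 = (\<Sum>i\<in>UNIV. \<Sum>j\<in>UNIV. (cmod (A $ i $ j))\<^sup>2)" for A :: "complex^'n^'m"
  by (simp add: norm_vec_def L2_set_def sum_nonneg)

lemma bessel_lift:
  fixes Z :: "complex^'k^('a::finite \<times> 'e::finite)"
  assumes "orthonormal s u" shows "(\<Sum>k<s. (norm (dagger (lift (u k)) ** Z))\<^sup>2) \<le> (norm Z)\<^sup>2"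
proof -
  have "(\<Sum>k<s. (norm (dagger (lift (u k)) ** Z))\<^sup>2)
      = (\<Sum>k<s. \<Sum>j\<in>UNIV. (norm (dagger (lift (u k)) *v (Z *v axis j 1)))\<^sup>2)"
    by (simp add: norm_matrix_columns[of "_ ** Z"] matrix_vector_mul_assoc[symmetric])
  also have "\<dots> = (\<Sum>j\<in>UNIV. \<Sum>k<s. (norm (dagger (lift (u k)) *v (Z *v axis j 1)))\<^sup>2)" by (rule sum.swap)
  also have "\<dots> \<le> (\<Sum>j\<in>UNIV. (norm (Z *v axis j 1))\<^sup>2)" by (intro sum_mono bessel_lift_vec assms)
  also have "\<dots> = (norm Z)\<^sup>2" by (simp add: norm_matrix_columns[of Z])
  finally show ?thesis .
qed

lemma bessel_slice:
  assumes "orthonormal s u" shows "(\<Sum>k<s. \<Sum>l<s. (norm (slice (u k) (u l) Z))\<^sup>2) \<le> (norm Z)\<^sup>2"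
proof -
  have "(norm (slice (u k) (u l) Z))\<^sup>2 = (norm (dagger (lift (u l)) ** dagger (dagger (lift (u k)) ** Z)))\<^sup>2" for k l
    using norm_dagger[of "slice (u k) (u l) Z"] by (simp add: slice_def dagger_mult)
  then have "(\<Sum>k<s. \<Sum>l<s. (norm (slice (u k) (u l) Z))\<^sup>2) \<le> (\<Sum>k<s. (norm (dagger (dagger (lift (u k)) ** Z)))\<^sup>2)"
    by (simp only:) (intro sum_mono bessel_lift assms)
  also have "\<dots> \<le> (norm Z)\<^sup>2" unfolding norm_dagger by (rule bessel_lift[OF assms])
  finally show ?thesis .
qed

lemma bessel_trace_slice:
  assumes u: "orthonormal s u" and W: "psd W"
  shows "(\<Sum>k<s. Re (trace (slice (u k) (u k) W))) \<le> Re (trace W)" "0 \<le> Re (trace (slice v v W))"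
proof -
  have eq: "Re (trace (slice v v W)) = (norm (dagger (lift v) ** op_sqrt W))\<^sup>2" for v
  proof -
    have "slice v v W = (dagger (lift v) ** op_sqrt W) ** dagger (dagger (lift v) ** op_sqrt W)"
      unfolding slice_def dagger_mult op_sqrt_hermitian[OF W] dagger_dagger
      by (metis matrix_mul_assoc op_sqrt_mult[OF W])
    then show ?thesis by (simp add: trace_self_dagger)
  qed
  show "0 \<le> Re (trace (slice v v W))" by (simp add: eq)
  show "(\<Sum>k<s. Re (trace (slice (u k) (u k) W))) \<le> Re (trace W)"
    unfolding eq norm_op_sqrt[OF W, symmetric] by (rule bessel_lift[OF u])
qed

text \<open>Because the Fourier basis is flat, the diagonal terms reproduce the average \<open>\<Sum>\<^sub>i slice (b i) (b i) Z\<close>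
  exactly, and the random phases make the off-diagonal terms orthogonal.\<close>

lemma exists_good_phases:
  fixes b :: "nat \<Rightarrow> complex^'a" and Z :: "complex^('a::finite \<times> 'e::finite)^('a \<times> 'e)"
  assumes b: "orthonormal m b" and m: "1 \<le> m"
  shows "\<exists>\<theta>\<in>quartic_phases m. (\<Sum>k<m. (norm (real m *\<^sub>R slice (code_vec m (fourier_coeff m \<theta> k) b) (code_vec m (fourier_coeff m \<theta> k) b) Z
    - (\<Sum>i<m. slice (b i) (b i) Z)))\<^sup>2) \<le> real m * (norm Z)\<^sup>2"
proof (rule ccontr)
  let ?w = "\<lambda>k. cis (2 * pi * real k / real m)" and ?Q = "quartic_phases m"
  define X where "X \<theta> k = real m *\<^sub>R slice (code_vec m (fourier_coeff m \<theta> k) b) (code_vec m (fourier_coeff m \<theta> k) b) Z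
    - (\<Sum>i<m. slice (b i) (b i) Z)" for \<theta> k
  define r where "r k e e' p = cnj (?w k ^ fst p) * ?w k ^ snd p * slice (b (fst p)) (b (snd p)) Z $ e $ e'" for k e e' p
  have X: "X \<theta> k $ e $ e' = (\<Sum>p\<in>off_diagonal m. cnj (\<theta> (fst p)) * \<theta> (snd p) * r k e e' p)"
    if \<theta>: "\<theta> \<in> ?Q" for \<theta> k e e'
  proof -
    define y where "y p = cnj (\<theta> (fst p)) * \<theta> (snd p) * r k e e' p" for p
    have sq: "complex_of_real (sqrt (real m)) * complex_of_real (sqrt (real m)) = of_nat m"
      by (simp flip: of_real_mult)
    have "cnj (fourier_coeff m \<theta> k i) * fourier_coeff m \<theta> k j * slice (b i) (b j) Z $ e $ e' = y (i, j) / of_nat m" for i j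
    proof -
      have "cnj (fourier_coeff m \<theta> k i) * fourier_coeff m \<theta> k j * slice (b i) (b j) Z $ e $ e'
        = y (i, j) / (complex_of_real (sqrt (real m)) * complex_of_real (sqrt (real m)))"
        by (simp add: fourier_coeff_def y_def r_def)
      then show ?thesis unfolding sq .
    qed
    then have 1: "slice (code_vec m (fourier_coeff m \<theta> k) b) (code_vec m (fourier_coeff m \<theta> k) b) Z $ e $ e' = (\<Sum>i<m. \<Sum>j<m. y (i, j)) / of_nat m"
      by (simp add: slice_code_vec_component sum_divide_distrib)
    have "X \<theta> k $ e $ e' = of_nat m * ((\<Sum>i<m. \<Sum>j<m. y (i, j)) / of_nat m) - (\<Sum>i<m. slice (b i) (b i) Z $ e $ e')"
      unfolding X_def vector_minus_component vector_scaleR_component 1 by (simp add: scaleR_conv_of_real)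
    also have "of_nat m * ((\<Sum>i<m. \<Sum>j<m. y (i, j)) / of_nat m) = (\<Sum>i<m. \<Sum>j<m. y (i, j))"
      using m by simp
    also have "\<dots> = (\<Sum>p\<in>{..<m} \<times> {..<m}. y p)"
      by (simp add: sum.cartesian_product)
    also have "{..<m} \<times> {..<m} = off_diagonal m \<union> (\<lambda>i. (i, i)) ` {..<m}" by (auto simp: off_diagonal_def)
    also have "sum y \<dots> = sum y (off_diagonal m) + sum y ((\<lambda>i. (i, i)) ` {..<m})"
      by (rule sum.union_disjoint) (use finite_off_diagonal in \<open>auto simp: off_diagonal_def\<close>)
    also have "sum y ((\<lambda>i. (i, i)) ` {..<m}) = (\<Sum>i<m. y (i, i))"
      by (subst sum.reindex) (auto simp: inj_on_def)
    also have "\<dots> = (\<Sum>i<m. slice (b i) (b i) Z $ e $ e')"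
    proof (intro sum.cong refl)
      fix i assume "i \<in> {..<m}"
      then have "cnj (\<theta> i) * \<theta> i = 1"
        using complex_norm_square[of "\<theta> i"] quartic_phases_norm[OF \<theta>, of i] by (simp add: mult.commute)
      moreover have "cnj (?w k ^ i) * ?w k ^ i = 1"
        using complex_norm_square[of "?w k ^ i"] by (simp add: mult.commute norm_power)
      ultimately show "y (i, i) = slice (b i) (b i) Z $ e $ e'" by (simp add: y_def r_def)
    qed
    finally show ?thesis by (simp add: y_def)
  qed
  have rn: "cmod (r k e e' p) = cmod (slice (b (fst p)) (b (snd p)) Z $ e $ e')" for k e e' p
    by (simp add: r_def norm_mult norm_power)
  have "(\<Sum>\<theta>\<in>?Q. (norm (X \<theta> k))\<^sup>2) \<le> real (card ?Q) * (norm Z)\<^sup>2" for k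
  proof -
    have "(\<Sum>\<theta>\<in>?Q. (norm (X \<theta> k))\<^sup>2)
      = (\<Sum>\<theta>\<in>?Q. \<Sum>e\<in>UNIV. \<Sum>e'\<in>UNIV. (cmod (\<Sum>p\<in>off_diagonal m. cnj (\<theta> (fst p)) * \<theta> (snd p) * r k e e' p))\<^sup>2)"
      by (intro sum.cong refl) (simp only: norm_matrix_components X)
    also have "\<dots> = (\<Sum>e\<in>UNIV. \<Sum>e'\<in>UNIV. \<Sum>\<theta>\<in>?Q. (cmod (\<Sum>p\<in>off_diagonal m. cnj (\<theta> (fst p)) * \<theta> (snd p) * r k e e' p))\<^sup>2)"
      by (rule sum_UNIV_swap3[symmetric])
    also have "\<dots> = real (card ?Q) * (\<Sum>e\<in>UNIV. \<Sum>e'\<in>UNIV. \<Sum>p\<in>off_diagonal m. (cmod (slice (b (fst p)) (b (snd p)) Z $ e $ e'))\<^sup>2)"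
      unfolding phase_average rn by (simp only: sum_distrib_left)
    also have "(\<Sum>e\<in>UNIV. \<Sum>e'\<in>UNIV. \<Sum>p\<in>off_diagonal m. (cmod (slice (b (fst p)) (b (snd p)) Z $ e $ e'))\<^sup>2)
        = (\<Sum>p\<in>off_diagonal m. (norm (slice (b (fst p)) (b (snd p)) Z))\<^sup>2)"
      unfolding norm_matrix_components by (rule sum_UNIV_swap3)
    also have "\<dots> \<le> (\<Sum>p\<in>{..<m} \<times> {..<m}. (norm (slice (b (fst p)) (b (snd p)) Z))\<^sup>2)"
      by (rule sum_mono2) (auto simp: off_diagonal_def)
    also have "\<dots> = (\<Sum>i<m. \<Sum>j<m. (norm (slice (b i) (b j) Z))\<^sup>2)"
      by (simp add: sum.cartesian_product case_prod_unfold)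
    also have "\<dots> \<le> (norm Z)\<^sup>2" by (rule bessel_slice[OF b])
    finally show ?thesis by (simp add: mult_left_mono)
  qed
  then have "(\<Sum>k<m. \<Sum>\<theta>\<in>?Q. (norm (X \<theta> k))\<^sup>2) \<le> (\<Sum>k<m. real (card ?Q) * (norm Z)\<^sup>2)"
    by (intro sum_mono)
  then have "(\<Sum>\<theta>\<in>?Q. \<Sum>k<m. (norm (X \<theta> k))\<^sup>2) \<le> (\<Sum>\<theta>\<in>?Q. real m * (norm Z)\<^sup>2)"
    by (subst sum.swap) (simp add: mult_ac)
  moreover assume "\<not> ?thesis"
  then have "real m * (norm Z)\<^sup>2 < (\<Sum>k<m. (norm (X \<theta> k))\<^sup>2)" if "\<theta> \<in> ?Q" for \<theta>
    using that unfolding X_def by (simp add: not_le)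
  then have "(\<Sum>\<theta>\<in>?Q. real m * (norm Z)\<^sup>2) < (\<Sum>\<theta>\<in>?Q. \<Sum>k<m. (norm (X \<theta> k))\<^sup>2)"
    by (intro sum_strict_mono finite_quartic_phases quartic_phases_nonempty)
  ultimately show False by simp
qed

text \<open>Thinning a basis of \<open>m\<close> vectors to \<open>s\<close> amplifies each squared
  off-diagonal block by \<open>(m / s)\<^sup>2\<close>, matched by the chance that a pair survives,
  so these blocks cost at most \<open>(norm Z)\<^sup>2\<close>. The diagonal blocks deviate from
  their mean as controlled by the phases and cost at most as much again; this is the factor 2. The
  \<open>W\<close> term is linear, so thinning does not raise its average. The weight \<alpha> lets
  one subset serve both.\<close>

lemma exists_good_code:
  fixes b :: "nat \<Rightarrow> complex^'a" and Z W :: "complex^('a::finite \<times> 'e::finite)^('a \<times> 'e)"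
  assumes b: "orthonormal m b" and s: "1 \<le> s" "s \<le> m" and W: "psd W" and \<alpha>: "0 \<le> \<alpha>"
  obtains c :: "nat \<Rightarrow> nat \<Rightarrow> complex" where "orthonormal s (\<lambda>k. code_vec m (c k) b)"
    "\<And>b' :: nat \<Rightarrow> complex^'a. orthonormal m b' \<Longrightarrow> orthonormal s (\<lambda>k. code_vec m (\<lambda>i. cnj (c k i)) b')"
    "\<alpha> * (\<Sum>k<s. \<Sum>l<s. (norm ((real m / real s) *\<^sub>R slice (code_vec m (c k) b) (code_vec m (c l) b) Z
        - (if k = l then (1 / real s) *\<^sub>R (\<Sum>i<m. slice (b i) (b i) Z) else 0)))\<^sup>2)
      + real m / real s * (\<Sum>k<s. Re (trace (slice (code_vec m (c k) b) (code_vec m (c k) b) W)))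
      \<le> 2 * \<alpha> * (norm Z)\<^sup>2 + Re (trace W)"
proof -
  have m: "1 \<le> m" using s by simp
  define R where "R = (\<Sum>i<m. slice (b i) (b i) Z)"
  obtain \<theta> where \<theta>: "\<theta> \<in> quartic_phases m"
    and diag: "(\<Sum>k<m. (norm (real m *\<^sub>R slice (code_vec m (fourier_coeff m \<theta> k) b) (code_vec m (fourier_coeff m \<theta> k) b) Z - R))\<^sup>2) \<le> real m * (norm Z)\<^sup>2"
    using exists_good_phases[OF b m, of Z] unfolding R_def by blast
  define u where "u k = code_vec m (fourier_coeff m \<theta> k) b" for k
  have u: "orthonormal m u" unfolding u_def by (rule orthonormal_code_vec(1)[OF b \<theta>])
  define X where "X k l = (real m / real s) *\<^sub>R slice (u k) (u l) Z - (if k = l then (1 / real s) *\<^sub>R R else 0)" for k l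
  \<comment> \<open>Diagonal blocks are moved into \<open>g\<close>, since
    \<open>subset_average\<close> requires a zero diagonal and rescales pairs and single indices
    differently.\<close>
  define f where "f k l = (if k = l then 0 else \<alpha> * (norm (X k l))\<^sup>2)" for k l
  define g where "g k = \<alpha> * (norm (X k k))\<^sup>2 + real m / real s * Re (trace (slice (u k) (u k) W))" for k
  obtain K where K: "K \<subseteq> {..<m}" "card K = s" and le: "(\<Sum>k\<in>K. \<Sum>l\<in>K. f k l) + (\<Sum>k\<in>K. g k)
    \<le> real s * (real s - 1) / (real m * (real m - 1)) * (\<Sum>k<m. \<Sum>l<m. f k l) + real s / real m * (\<Sum>k<m. g k)"
    using subset_average[of "{..<m}" f s g] s by (auto simp: f_def)
  have "real s * (real s - 1) / (real m * (real m - 1)) * (\<Sum>k<m. \<Sum>l<m. f k l) \<le> \<alpha> * (norm Z)\<^sup>2"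
  proof -
    have "(\<Sum>k<m. \<Sum>l<m. f k l) \<le> (\<Sum>k<m. \<Sum>l<m. \<alpha> * (real m / real s)\<^sup>2 * (norm (slice (u k) (u l) Z))\<^sup>2)"
      using \<alpha> by (intro sum_mono) (simp add: f_def X_def power_mult_distrib power_divide)
    also have "\<dots> = \<alpha> * (real m / real s)\<^sup>2 * (\<Sum>k<m. \<Sum>l<m. (norm (slice (u k) (u l) Z))\<^sup>2)"
      by (simp only: sum_distrib_left)
    also have "\<dots> \<le> \<alpha> * (real m / real s)\<^sup>2 * (norm Z)\<^sup>2"
      using \<alpha> by (intro mult_left_mono bessel_slice[OF u]) simp
    finally have 1: "(\<Sum>k<m. \<Sum>l<m. f k l) \<le> \<alpha> * (real m / real s)\<^sup>2 * (norm Z)\<^sup>2" .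
    have 0: "0 \<le> (\<Sum>k<m. \<Sum>l<m. f k l)" using \<alpha> by (intro sum_nonneg) (simp add: f_def)
    \<comment> \<open>Sampling without replacement picks a pair at most as often as independent
      sampling would.\<close>
    have ratio: "real s * (real s - 1) / (real m * (real m - 1)) \<le> (real s / real m)\<^sup>2"
    proof (cases "m = 1")
      case False
      then have "real m - 1 > 0" using m by simp
      moreover have "(real s - 1) * real m \<le> real s * (real m - 1)" using s by (simp add: algebra_simps)
      ultimately have "(real s - 1) / (real m - 1) \<le> real s / real m" using m by (simp add: field_simps)
      then have "real s / real m * ((real s - 1) / (real m - 1)) \<le> real s / real m * (real s / real m)"
        by (rule mult_left_mono) simp
      then show ?thesis by (simp add: power2_eq_square)
    qed simp
    have "real s * (real s - 1) / (real m * (real m - 1)) * (\<Sum>k<m. \<Sum>l<m. f k l) \<le> (real s / real m)\<^sup>2 * (\<alpha> * (real m / real s)\<^sup>2 * (norm Z)\<^sup>2)"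
      using ratio 1 0 by (intro mult_mono) auto
    also have "\<dots> = \<alpha> * (norm Z)\<^sup>2" using s by (simp add: field_simps power2_eq_square)
    finally show ?thesis .
  qed
  moreover have "real s / real m * (\<Sum>k<m. g k) \<le> \<alpha> * (norm Z)\<^sup>2 + Re (trace W)"
  proof -
    have "X k k = (1 / real s) *\<^sub>R (real m *\<^sub>R slice (u k) (u k) Z - R)" for k
      by (simp add: X_def scaleR_diff_right)
    then have "(\<Sum>k<m. g k) = \<alpha> * (1 / real s)\<^sup>2 * (\<Sum>k<m. (norm (real m *\<^sub>R slice (u k) (u k) Z - R))\<^sup>2)
        + real m / real s * (\<Sum>k<m. Re (trace (slice (u k) (u k) W)))"
      by (simp add: g_def sum.distrib sum_distrib_left power_mult_distrib power_divide)
    also have "\<dots> \<le> \<alpha> * (1 / real s)\<^sup>2 * (real m * (norm Z)\<^sup>2) + real m / real s * Re (trace W)"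
      using \<alpha> diag bessel_trace_slice(1)[OF u W] by (intro add_mono mult_left_mono) (simp_all add: u_def)
    finally have "real s / real m * (\<Sum>k<m. g k) \<le> real s / real m * (\<alpha> * (1 / real s)\<^sup>2 * (real m * (norm Z)\<^sup>2) + real m / real s * Re (trace W))"
      by (rule mult_left_mono) simp
    also have "\<dots> = (1 / real s) * (\<alpha> * (norm Z)\<^sup>2) + Re (trace W)"
      using s by (simp add: field_simps power2_eq_square)
    also have "(1 / real s) * (\<alpha> * (norm Z)\<^sup>2) \<le> 1 * (\<alpha> * (norm Z)\<^sup>2)"
      using s \<alpha> by (intro mult_right_mono) auto
    finally show ?thesis by simp
  qed
  ultimately have obj: "(\<Sum>k\<in>K. \<Sum>l\<in>K. f k l) + (\<Sum>k\<in>K. g k) \<le> 2 * \<alpha> * (norm Z)\<^sup>2 + Re (trace W)"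
    using le by linarith
  have finK: "finite K" using K(1) finite_subset by blast
  then obtain h where h: "bij_betw h {..<s} K"
    using ex_bij_betw_nat_finite[of K] K(2) by (auto simp: lessThan_atLeast0)
  have hK: "h k < m" if "k < s" for k using h K(1) that by (auto simp: bij_betw_def)
  have hinj: "h k = h l \<longleftrightarrow> k = l" if "k < s" "l < s" for k l using h that by (auto simp: bij_betw_def inj_on_def)
  have sub: "orthonormal s (\<lambda>k. v (h k))" if "orthonormal m v" for v :: "nat \<Rightarrow> complex^'a"
    using that hK hinj by (simp add: orthonormal_def)
  have "(\<Sum>k\<in>K. \<Sum>l\<in>K. f k l) + (\<Sum>k\<in>K. g k)
    = \<alpha> * (\<Sum>k\<in>K. \<Sum>l\<in>K. (norm (X k l))\<^sup>2) + real m / real s * (\<Sum>k\<in>K. Re (trace (slice (u k) (u k) W)))"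
  proof -
    have "(\<Sum>l\<in>K. f k l) + \<alpha> * (norm (X k k))\<^sup>2 = (\<Sum>l\<in>K. \<alpha> * (norm (X k l))\<^sup>2)" if "k \<in> K" for k
      using sum.remove[OF finK that, of "f k"] sum.remove[OF finK that, of "\<lambda>l. \<alpha> * (norm (X k l))\<^sup>2"]
      by (simp add: f_def)
    then have "(\<Sum>k\<in>K. (\<Sum>l\<in>K. f k l) + \<alpha> * (norm (X k k))\<^sup>2) = \<alpha> * (\<Sum>k\<in>K. \<Sum>l\<in>K. (norm (X k l))\<^sup>2)"
      by (simp add: sum_distrib_left)
    then show ?thesis by (simp add: g_def sum.distrib sum_distrib_left)
  qed
  also have "(\<Sum>k\<in>K. \<Sum>l\<in>K. (norm (X k l))\<^sup>2) = (\<Sum>k<s. \<Sum>l<s. (norm (X (h k) (h l)))\<^sup>2)"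
    by (simp only: sum.reindex_bij_betw[OF h, symmetric])
  also have "(\<Sum>k\<in>K. Re (trace (slice (u k) (u k) W))) = (\<Sum>k<s. Re (trace (slice (u (h k)) (u (h k)) W)))"
    by (simp only: sum.reindex_bij_betw[OF h, symmetric])
  also have "(\<Sum>k<s. \<Sum>l<s. (norm (X (h k) (h l)))\<^sup>2)
      = (\<Sum>k<s. \<Sum>l<s. (norm ((real m / real s) *\<^sub>R slice (u (h k)) (u (h l)) Z - (if k = l then (1 / real s) *\<^sub>R R else 0)))\<^sup>2)"
    by (intro sum.cong refl) (simp add: X_def hinj)
  finally have bound: "\<alpha> * (\<Sum>k<s. \<Sum>l<s. (norm ((real m / real s) *\<^sub>R slice (u (h k)) (u (h l)) Z
        - (if k = l then (1 / real s) *\<^sub>R R else 0)))\<^sup>2)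
      + real m / real s * (\<Sum>k<s. Re (trace (slice (u (h k)) (u (h k)) W)))
      \<le> 2 * \<alpha> * (norm Z)\<^sup>2 + Re (trace W)" using obj by simp
  show ?thesis
    by (rule that[of "\<lambda>k. fourier_coeff m \<theta> (h k)", folded u_def R_def, OF sub[OF u] _ bound])
      (rule sub[OF orthonormal_code_vec(2)[OF _ \<theta>]])
qed

subsection \<open>One-shot decoupling\<close>

lemma tensor_mat_add_right: "tensor_mat A (B + C) = tensor_mat A B + tensor_mat A C"
  by (simp add: vec_eq_iff tensor_mat_def algebra_simps)

lemma tensor_mat_1_lift: "tensor_mat (mat 1) h ** lift u = lift u ** h"
proof -
  have "(tensor_mat (mat 1) h ** lift u) $ (a', e') $ e = (lift u ** h) $ (a', e') $ e" for a' e' e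
  proof -
    have "(tensor_mat (mat 1) h ** lift u) $ (a', e') $ e
      = (\<Sum>a\<in>UNIV. \<Sum>x\<in>UNIV. if x = e then (if a = a' then u $ a' * h $ e' $ e else 0) else 0)"
      unfolding matrix_matrix_mult_def tensor_mat_def lift_def mat_def sum_UNIV_prod vec_lambda_beta fst_conv snd_conv
      by (intro sum.cong refl) auto
    then show ?thesis by (simp add: lift_mult_component)
  qed
  then show ?thesis by (simp add: vec_eq_iff)
qed

lemma norm_matrix_vector_sq: "(norm (A *v x))\<^sup>2 = inner x ((dagger A ** A) *v x)"
  by (simp only: power2_norm_eq_inner matrix_vector_mul_assoc[symmetric] inner_matrix_vector[of x "dagger A"] dagger_dagger)

lemma dagger_lift_tensor_mat_1: "dagger (lift u) ** tensor_mat (mat 1) h = h ** dagger (lift u)"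
  using arg_cong[OF tensor_mat_1_lift[of "dagger h" u], of dagger] by (simp add: dagger_mult dagger_tensor_mat)

lemma slice_add: "slice u v (A + B) = slice u v A + slice u v B"
  by (simp add: slice_def matrix_add_ldistrib matrix_mult_add_rdistrib)

text \<open>Blocks placed along different pairs of frame vectors are orthogonal for the
  Hilbert-Schmidt inner product, and placing a block preserves its norm; Pythagoras applies.\<close>

lemma norm_sum_lift:
  fixes M :: "nat \<Rightarrow> nat \<Rightarrow> complex^'e^'e"
  assumes u: "orthonormal s u"
  shows "(norm (\<Sum>k<s. \<Sum>l<s. lift (u k) ** M k l ** dagger (lift (u l))))\<^sup>2 = (\<Sum>k<s. \<Sum>l<s. (norm (M k l))\<^sup>2)"
proof -
  let ?f = "\<lambda>p. lift (u (fst p)) ** M (fst p) (snd p) ** dagger (lift (u (snd p)))"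
  have ll: "dagger (lift (u i)) ** lift (u j) = (if i = j then mat 1 else 0 :: complex^'e^'e)" if "i < s" "j < s" for i j
    using dagger_lift_lift_orthonormal orthonormalD[OF u that] by auto
  have inn: "inner (?f (k, l)) (?f (i, j)) = (if k = i \<and> l = j then (norm (M k l))\<^sup>2 else 0)"
    if "k < s" "l < s" "i < s" "j < s" for k l i j
  proof -
    have "inner (?f (k, l)) (?f (i, j)) = inner (M k l ** dagger (lift (u l))) ((dagger (lift (u k)) ** lift (u i)) ** M i j ** dagger (lift (u j)))"
      by (simp add: matrix_mul_assoc[symmetric] inner_mult_left)
    also have "\<dots> = inner (M k l) ((dagger (lift (u k)) ** lift (u i)) ** M i j ** (dagger (lift (u j)) ** lift (u l)))"
      by (simp add: matrix_mul_assoc inner_mult_right)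
    finally show ?thesis using ll that by (auto simp: power2_norm_eq_inner)
  qed
  have "(norm (\<Sum>p\<in>{..<s} \<times> {..<s}. ?f p))\<^sup>2 = (\<Sum>p\<in>{..<s} \<times> {..<s}. (norm (?f p))\<^sup>2)"
  proof (rule norm_sum_Pythagorean)
    show "pairwise (\<lambda>p q. orthogonal (?f p) (?f q)) ({..<s} \<times> {..<s})"
      unfolding pairwise_def orthogonal_def
    proof (intro ballI impI)
      fix p q assume pq: "p \<in> {..<s} \<times> {..<s}" "q \<in> {..<s} \<times> {..<s}" "p \<noteq> q"
      then show "inner (?f p) (?f q) = 0"
        using inn[of "fst p" "snd p" "fst q" "snd q"] by (auto simp: prod_eq_iff)
    qed
  qed simp
  also have "\<dots> = (\<Sum>p\<in>{..<s} \<times> {..<s}. (norm (M (fst p) (snd p)))\<^sup>2)"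
  proof (intro sum.cong refl)
    fix p assume "p \<in> {..<s} \<times> {..<s}"
    then show "(norm (?f p))\<^sup>2 = (norm (M (fst p) (snd p)))\<^sup>2"
      using inn[of "fst p" "snd p" "fst p" "snd p"] by (auto simp: power2_norm_eq_inner)
  qed
  finally show ?thesis by (simp add: sum.cartesian_product case_prod_unfold)
qed

lemma positive_definite_inverse_sqrt:
  fixes \<sigma> :: "complex^'n^'n"
  assumes \<sigma>: "psd \<sigma>" and pd: "\<And>v. v \<noteq> 0 \<Longrightarrow> 0 < inner v (\<sigma> *v v)"
  obtains g h where "dagger g = g" "dagger h = h" "g ** g = \<sigma>" "g ** h = mat 1" "h ** g = mat 1"
proof -
  let ?g = "op_sqrt \<sigma>"
  note g = op_sqrt_hermitian[OF \<sigma>] op_sqrt_mult[OF \<sigma>]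
  have "v = 0" if "?g *v v = 0" for v
  proof (rule ccontr)
    assume "v \<noteq> 0"
    from pd[OF this] have "0 < inner v (?g *v (?g *v v))" by (simp add: matrix_vector_mul_assoc g(2))
    then show False by (simp add: that)
  qed
  then obtain h where hg: "h ** ?g = mat 1" using matrix_left_invertible_ker[of ?g] by blast
  then have gh: "?g ** h = mat 1" using matrix_left_right_inverse by blast
  have "dagger h ** ?g = mat 1" using arg_cong[OF gh, of dagger] by (simp add: dagger_mult g(1))
  then have "dagger h = h" by (metis gh matrix_mul_assoc matrix_mul_lid matrix_mul_rid)
  with g gh hg show ?thesis by (intro that)
qed

text \<open>The weight \<open>h\<close> inverts \<open>g\<close>, so the hypothesis becomes
  \<open>op_le (h ** \<rho> ** h) (\<kappa> *\<^sub>R mat 1)\<close>. Hence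
  \<open>op_sqrt \<rho> ** h\<close> and its adjoint have operator norm at most the root of
  \<kappa>; one more factor \<open>op_sqrt \<rho>\<close> contributes the trace. This passes from a
  min-entropy bound to a second-moment one.\<close>

lemma weighted_norm_bound:
  fixes \<rho> :: "complex^'x^'x"
  assumes \<rho>: "psd \<rho>" and le: "op_le \<rho> (\<kappa> *\<^sub>R (g ** g))" and g: "dagger g = g" and h: "dagger h = h" "g ** h = mat 1"
    and \<kappa>: "0 < \<kappa>"
  shows "(norm (h ** \<rho>))\<^sup>2 \<le> \<kappa> * Re (trace \<rho>)"
proof -
  let ?r = "op_sqrt \<rho>"
  note r = op_sqrt_hermitian[OF \<rho>] op_sqrt_mult[OF \<rho>]
  have "h ** (g ** g) ** h = (h ** g) ** (g ** h)" by (simp add: matrix_mul_assoc)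
  moreover have hg: "h ** g = mat 1" using arg_cong[OF h(2), of dagger] by (simp add: dagger_mult g h(1))
  ultimately have "op_le (h ** \<rho> ** h) (\<kappa> *\<^sub>R mat 1)"
    using op_le_conj[OF le, of h] by (simp add: h matrix_scaleR_left matrix_scaleR_right)
  have "(norm ((?r ** h) *v y))\<^sup>2 \<le> \<kappa> * (norm y)\<^sup>2" for y
  proof -
    have "(norm ((?r ** h) *v y))\<^sup>2 = inner y ((h ** (?r ** ?r) ** h) *v y)"
      by (simp add: norm_matrix_vector_sq dagger_mult h(1) r(1) matrix_mul_assoc)
    also have "\<dots> \<le> inner y ((\<kappa> *\<^sub>R mat 1) *v y)"
      unfolding r(2) by (rule op_le_quadratic) fact
    finally show ?thesis by (simp add: matrix_vector_scaleR_left power2_norm_eq_inner)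
  qed
  then have "contraction ((1 / sqrt \<kappa>) *\<^sub>R (?r ** h))"
    unfolding contraction_def
  proof (intro allI)
    fix y assume *: "\<And>y. (norm ((?r ** h) *v y))\<^sup>2 \<le> \<kappa> * (norm y)\<^sup>2"
    have "norm ((?r ** h) *v y) \<le> sqrt \<kappa> * norm y"
    proof (rule power2_le_imp_le)
      show "(norm ((?r ** h) *v y))\<^sup>2 \<le> (sqrt \<kappa> * norm y)\<^sup>2"
        using *[of y] \<kappa> by (simp add: power_mult_distrib)
    qed (use \<kappa> in simp)
    then show "norm (((1 / sqrt \<kappa>) *\<^sub>R (?r ** h)) *v y) \<le> norm y"
      using \<kappa> by (simp add: matrix_vector_scaleR_left field_simps)
  qed
  from contraction_dagger[OF this] have c: "contraction ((1 / sqrt \<kappa>) *\<^sub>R (h ** ?r))"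
    by (simp add: dagger_scaleR dagger_mult r h)
  have "(norm ((h ** ?r) *v y))\<^sup>2 \<le> \<kappa> * (norm y)\<^sup>2" for y
  proof -
    have "norm ((1 / sqrt \<kappa>) *\<^sub>R ((h ** ?r) *v y)) \<le> norm y"
      using c by (simp add: contraction_def matrix_vector_scaleR_left)
    then have "norm ((h ** ?r) *v y) \<le> sqrt \<kappa> * norm y" using \<kappa> by (simp add: field_simps)
    then have "(norm ((h ** ?r) *v y))\<^sup>2 \<le> (sqrt \<kappa> * norm y)\<^sup>2" by (intro power_mono) auto
    then show ?thesis using \<kappa> by (simp add: power_mult_distrib)
  qed
  from norm_mult_bounded[of "h ** ?r", OF this, of ?r] show ?thesis
    by (simp add: matrix_mul_assoc[symmetric] r(2) norm_op_sqrt[OF \<rho>])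
qed

text \<open>The operator form of bounding a trace norm by a weighted Hilbert-Schmidt norm. Since
  \<open>g ** h = mat 1\<close>, the quadratic form of \<open>Z\<close> is the inner product of
  \<open>g *v (P *v x)\<close> and \<open>(h ** Z) *v x\<close>, and Young's inequality with
  parameter \<open>c\<close> splits it. No sign of \<open>Z\<close> is assumed.\<close>

lemma op_le_amgm:
  fixes Z :: "complex^'x^'x"
  assumes Z: "dagger Z = Z" "P ** Z = Z" and P: "dagger P = P" and g: "dagger g = g" and h: "dagger h = h" "g ** h = mat 1" and c: "0 < c"
  shows "op_le Z ((c / 2) *\<^sub>R (P ** (g ** g) ** P) + (1 / (2 * c)) *\<^sub>R (dagger (h ** Z) ** (h ** Z)))"
proof (rule op_leI)
  fix x
  let ?a = "g *v (P *v x)" and ?b = "(h ** Z) *v x"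
  have hg: "h ** g = mat 1" using arg_cong[OF h(2), of dagger] by (simp add: dagger_mult g h(1))
  have "inner x (Z *v x) = inner (P *v x) (Z *v x)"
    by (metis Z(2) P inner_matrix_vector matrix_vector_mul_assoc)
  also have "\<dots> = inner (P *v x) (g *v ((h ** Z) *v x))"
    by (simp add: matrix_vector_mul_assoc matrix_mul_assoc h(2))
  also have "\<dots> = inner ?a ?b" by (simp add: inner_matrix_vector g)
  also have "\<dots> \<le> c / 2 * (norm ?a)\<^sup>2 + 1 / (2 * c) * (norm ?b)\<^sup>2"
  proof -
    have "0 \<le> (norm (c *\<^sub>R ?a - ?b))\<^sup>2" by simp
    also have "\<dots> = c\<^sup>2 * (norm ?a)\<^sup>2 + (norm ?b)\<^sup>2 - 2 * c * inner ?a ?b"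
      unfolding power2_norm_eq_inner
      by (simp add: inner_diff_left inner_diff_right inner_commute[of ?b ?a] power2_eq_square algebra_simps)
    finally have "2 * c * inner ?a ?b \<le> c\<^sup>2 * (norm ?a)\<^sup>2 + (norm ?b)\<^sup>2" by simp
    then have "inner ?a ?b \<le> (c\<^sup>2 * (norm ?a)\<^sup>2 + (norm ?b)\<^sup>2) / (2 * c)"
      using c by (simp add: pos_le_divide_eq mult.commute)
    also have "\<dots> = c / 2 * (norm ?a)\<^sup>2 + 1 / (2 * c) * (norm ?b)\<^sup>2"
      using c by (simp add: add_divide_distrib power2_eq_square)
    finally show ?thesis .
  qed
  also have "\<dots> = inner x (((c / 2) *\<^sub>R (P ** (g ** g) ** P) + (1 / (2 * c)) *\<^sub>R (dagger (h ** Z) ** (h ** Z))) *v x)"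
  proof -
    have 1: "inner x ((P ** (g ** g) ** P) *v x) = (norm ?a)\<^sup>2"
      using norm_matrix_vector_sq[of "g ** P" x] by (simp add: dagger_mult g P matrix_mul_assoc matrix_vector_mul_assoc)
    have 2: "inner x ((dagger (h ** Z) ** (h ** Z)) *v x) = (norm ?b)\<^sup>2"
      by (rule norm_matrix_vector_sq[symmetric])
    show ?thesis
      by (simp add: matrix_vector_mult_add_rdistrib matrix_vector_scaleR_left inner_add_right 1 2)
  qed
  finally show "inner x (Z *v x) \<le> \<dots>" .
next
  show "dagger ((c / 2) *\<^sub>R (P ** (g ** g) ** P) + (1 / (2 * c)) *\<^sub>R (dagger (h ** Z) ** (h ** Z)))
    = (c / 2) *\<^sub>R (P ** (g ** g) ** P) + (1 / (2 * c)) *\<^sub>R (dagger (h ** Z) ** (h ** Z))"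
    by (simp add: dagger_add dagger_scaleR dagger_mult P g matrix_mul_assoc)
qed (rule Z(1))

lemma kraus_norm_sum:
  fixes Ne :: "'e::finite \<Rightarrow> complex^'a^'b"
  assumes "kraus_complete Ne"
  shows "(\<Sum>e\<in>UNIV. (norm (Ne e *v x))\<^sup>2) = (norm x)\<^sup>2"
proof -
  have "(\<Sum>e\<in>UNIV. (norm (Ne e *v x))\<^sup>2) = inner x ((\<Sum>e\<in>UNIV. dagger (Ne e) ** Ne e) *v x)"
    by (simp add: norm_matrix_vector_sq matrix_vector_sum_left inner_sum_right)
  then show ?thesis by (simp add: assms power2_norm_eq_inner)
qed

text \<open>A complete Kraus family preserves the total squared norm, so every unit codeword carries
  the same weight.\<close>

lemma codeword_block_norm:
  fixes \<Psi> :: "complex^'b^('a::finite \<times> 'e::finite)" and Ne :: "'e \<Rightarrow> complex^'a^'b"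
  assumes rel: "\<And>e \<beta>. (dagger (lift v) ** \<Psi>) $ e $ \<beta> = complex_of_real (1 / sqrt (real m)) * (Ne e *v y) $ \<beta>"
    and Ne: "kraus_complete Ne" and y: "cinner y y = 1" and m: "1 \<le> m"
  shows "(norm (dagger (lift v) ** \<Psi>))\<^sup>2 = 1 / real m"
proof -
  have "(norm (dagger (lift v) ** \<Psi>))\<^sup>2 = (\<Sum>e\<in>UNIV. \<Sum>\<beta>\<in>UNIV. (cmod ((Ne e *v y) $ \<beta>))\<^sup>2) / real m"
    using m by (simp add: norm_matrix_components rel norm_mult power_mult_distrib norm_divide power_divide sum_divide_distrib)
  also have "\<dots> = (\<Sum>e\<in>UNIV. (norm (Ne e *v y))\<^sup>2) / real m"
    by (simp add: norm_vec_def L2_set_def sum_nonneg)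
  also have "(\<Sum>e\<in>UNIV. (norm (Ne e *v y))\<^sup>2) = 1"
    using y by (simp add: kraus_norm_sum[OF Ne] cinner_self del: of_real_power)
  finally show ?thesis .
qed

text \<open>The common bound is \<open>\<tau> + Q + Q2\<close>: the ideal product state, an operator
  dominating the deviation of the projected smoothed state from it, and the projected error term
  \<open>W\<close>, of which only the trace matters. Their positivity puts both states required by
  \<open>code_decoder\<close> below the sum.\<close>

lemma decoupling_code:
  fixes b b' :: "nat \<Rightarrow> complex^'a" and \<Psi> :: "complex^'b^('a::finite \<times> 'e::finite)" and Ne :: "'e \<Rightarrow> complex^'a^'b"
    and \<rho>' W :: "complex^('a \<times> 'e)^('a \<times> 'e)"
  assumes b: "orthonormal m b" and b': "orthonormal m b'" and s: "1 \<le> s" "s \<le> m"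
    and rel: "\<And>i e \<beta>. i < m \<Longrightarrow> (dagger (lift (b i)) ** \<Psi>) $ e $ \<beta> = complex_of_real (1 / sqrt (real m)) * (Ne e *v b' i) $ \<beta>"
    and Ne: "kraus_complete Ne"
    and \<rho>': "psd \<rho>'" "Re (trace \<rho>') \<le> 1" and W: "psd W" and le: "op_le (\<Psi> ** dagger \<Psi>) (\<rho>' + W)"
    and \<sigma>: "state \<sigma>" and bound: "op_le \<rho>' (\<kappa> *\<^sub>R tensor_mat (mat 1 :: complex^'a^'a) \<sigma>)" and \<kappa>: "0 < \<kappa>"
    and t: "t = 2 * sqrt (real s * \<kappa>) + Re (trace W)" "2 * t \<le> 1"
  obtains w :: "nat \<Rightarrow> complex^'a" and V :: "'e + 'b \<Rightarrow> complex^'b^'a" where "orthonormal s w"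
    "kraus_complete V"
    "(1 - 2 * t)\<^sup>2 \<le> (\<Sum>p\<in>UNIV. (cmod (trace (V (fst p) ** Ne (snd p) ** onb_projector s w)))\<^sup>2) / (real s)\<^sup>2"
proof -
  define d where "d = real CARD('e)"
  have d: "0 < d" by (simp add: d_def)
  text \<open>Regularisation makes the weight invertible at the cost of a factor 2 in its trace.\<close>
  define \<sigma>' where "\<sigma>' = \<sigma> + (1 / d) *\<^sub>R mat 1"
  have \<sigma>psd: "psd \<sigma>" using \<sigma> by (simp add: state_def)
  have \<sigma>'psd: "psd \<sigma>'" unfolding \<sigma>'_def using d by (intro psd_add \<sigma>psd psd_scaleR) auto
  have tr\<sigma>': "Re (trace \<sigma>') = 2"
    using \<sigma> d by (simp add: \<sigma>'_def trace_add trace_scaleR state_def) (simp add: trace_def mat_def d_def)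
  have pd: "0 < inner v (\<sigma>' *v v)" if "v \<noteq> 0" for v
  proof -
    have "0 \<le> inner v (\<sigma> *v v)" using \<sigma>psd by (simp add: psd_iff)
    moreover have "0 < (1 / d) * inner v v" using that d by simp
    ultimately show ?thesis
      by (simp add: \<sigma>'_def matrix_vector_mult_add_rdistrib matrix_vector_scaleR_left inner_add_right)
  qed
  obtain g h where g: "dagger g = g" "g ** g = \<sigma>'" and h: "dagger h = h" "g ** h = mat 1"
    using positive_definite_inverse_sqrt[OF \<sigma>'psd pd] by blast
  let ?g = "tensor_mat (mat 1 :: complex^'a^'a) g" and ?h = "tensor_mat (mat 1 :: complex^'a^'a) h"
  have gg: "?g ** ?g = tensor_mat (mat 1) \<sigma>'" by (simp add: tensor_mat_mult g)
  have G: "dagger ?g = ?g" "dagger ?h = ?h" "?g ** ?h = mat 1"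
    by (simp_all add: dagger_tensor_mat g h tensor_mat_mult tensor_mat_1_1)
  have "op_le \<rho>' (\<kappa> *\<^sub>R (?g ** ?g))"
  proof (rule op_le_trans[OF bound])
    have "psd (\<kappa> *\<^sub>R tensor_mat (mat 1 :: complex^'a^'a) ((1 / d) *\<^sub>R mat 1))"
      using \<kappa> d by (intro psd_scaleR psd_tensor_mat) auto
    then show "op_le (\<kappa> *\<^sub>R tensor_mat (mat 1 :: complex^'a^'a) \<sigma>) (\<kappa> *\<^sub>R (?g ** ?g))"
      unfolding gg by (simp add: op_le_def \<sigma>'_def tensor_mat_add_right scaleR_add_right)
  qed
  from weighted_norm_bound[OF \<rho>'(1) this G \<kappa>] have hn: "(norm (?h ** \<rho>'))\<^sup>2 \<le> \<kappa>"
    using mult_left_mono[OF \<rho>'(2), of \<kappa>] \<kappa> by argo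
  \<comment> \<open>The environment marginal of the part of \<open>\<rho>'\<close> seen by the frame
    \<open>b\<close>. Its trace may be below 1 because \<open>\<rho>'\<close> need not live on that
    frame.\<close>
  define R where "R = (\<Sum>i<m. slice (b i) (b i) \<rho>')"
  have R: "psd R" unfolding R_def slice_def using psd_conj[OF \<rho>'(1), of "dagger (lift _)"] by (intro psd_sum) simp
  have R1: "Re (trace R) \<le> 1"
    using bessel_trace_slice(1)[OF b \<rho>'(1)] \<rho>'(2) by (simp add: R_def trace_sum)
  have sl: "slice u v (?h ** \<rho>') = h ** slice u v \<rho>'" for u v
    by (simp add: slice_def matrix_mul_assoc dagger_lift_tensor_mat_1)
  \<comment> \<open>This value balances the two contributions \<open>c * s\<close> and
    \<open>\<kappa> / c\<close> to the trace of \<open>Q\<close>: both become the root of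
    \<open>s * \<kappa>\<close>, which gives the factor 2 in \<open>t\<close>. The trace 2 of
    \<open>\<sigma>'\<close> cancels the half in front of the weight term.\<close>
  define c where "c = sqrt (\<kappa> / real s)"
  have c: "0 < c" using \<kappa> s by (simp add: c_def)
  obtain C :: "nat \<Rightarrow> nat \<Rightarrow> complex" where u: "orthonormal s (\<lambda>k. code_vec m (C k) b)"
    and w: "orthonormal s (\<lambda>k. code_vec m (\<lambda>i. cnj (C k i)) b')"
    and obj: "1 / (2 * c) * (\<Sum>k<s. \<Sum>l<s. (norm ((real m / real s) *\<^sub>R slice (code_vec m (C k) b) (code_vec m (C l) b) (?h ** \<rho>')
        - (if k = l then (1 / real s) *\<^sub>R (\<Sum>i<m. slice (b i) (b i) (?h ** \<rho>')) else 0)))\<^sup>2)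
      + real m / real s * (\<Sum>k<s. Re (trace (slice (code_vec m (C k) b) (code_vec m (C k) b) W)))
      \<le> 2 * (1 / (2 * c)) * (norm (?h ** \<rho>'))\<^sup>2 + Re (trace W)"
    by (rule exists_good_code[OF b s W, of "1 / (2 * c)" "?h ** \<rho>'"]) (use c b' in \<open>auto intro: that\<close>)
  define u where "u k = code_vec m (C k) b" for k
  define w where "w k = code_vec m (\<lambda>i. cnj (C k i)) b'" for k
  have u: "orthonormal s u" and w: "orthonormal s w" using u w by (simp_all add: u_def[abs_def] w_def[abs_def])
  have rel': "(dagger (lift (u k)) ** \<Psi>) $ e $ \<beta> = complex_of_real (1 / sqrt (real m)) * (Ne e *v w k) $ \<beta>" for k e \<beta>
  proof -
    have "(dagger (lift (u k)) ** \<Psi>) $ e $ \<beta> = (\<Sum>a\<in>UNIV. \<Sum>i<m. cnj (C k i) * (cnj (b i $ a) * \<Psi> $ (a, e) $ \<beta>))"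
      by (simp add: dagger_lift_mult u_def code_vec_def sum_distrib_right sum_distrib_left mult_ac)
    also have "\<dots> = (\<Sum>i<m. \<Sum>a\<in>UNIV. cnj (C k i) * (cnj (b i $ a) * \<Psi> $ (a, e) $ \<beta>))" by (rule sum.swap)
    also have "\<dots> = (\<Sum>i<m. cnj (C k i) * (dagger (lift (b i)) ** \<Psi>) $ e $ \<beta>)"
      by (simp add: dagger_lift_mult sum_distrib_left)
    also have "\<dots> = (\<Sum>i<m. cnj (C k i) * (complex_of_real (1 / sqrt (real m)) * (Ne e *v b' i) $ \<beta>))"
      by (intro sum.cong refl) (simp add: rel)
    also have "\<dots> = complex_of_real (1 / sqrt (real m)) * (Ne e *v w k) $ \<beta>"
      by (simp add: w_def code_vec_def matrix_vector_sum_right vector_scalar_commute sum_distrib_left mult_ac)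
    finally show ?thesis .
  qed
  let ?P = "tensor_mat (onb_projector s u) (mat 1 :: complex^'e^'e)"
  have P: "dagger ?P = ?P" by (simp add: dagger_tensor_mat dagger_onb_projector)
  have PP: "?P ** ?P = ?P" by (simp add: tensor_mat_mult orthonormal_projector(1)[OF u])
  have Plift: "?P = (\<Sum>k<s. lift (u k) ** dagger (lift (u k)))" by (simp add: tensor_onb_projector)
  define \<tau> where "\<tau> = (1 / real s) *\<^sub>R tensor_mat (onb_projector s u) R"
  define Z where "Z = (real m / real s) *\<^sub>R (?P ** \<rho>' ** ?P) - \<tau>"
  define Q where "Q = (c / 2) *\<^sub>R (?P ** (?g ** ?g) ** ?P) + (1 / (2 * c)) *\<^sub>R (dagger (?h ** Z) ** (?h ** Z))"
  define Q2 where "Q2 = (real m / real s) *\<^sub>R (?P ** W ** ?P)"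
  have \<tau>h: "dagger \<tau> = \<tau>"
    by (simp add: \<tau>_def dagger_scaleR dagger_tensor_mat dagger_onb_projector psd_hermitian[OF R])
  have Zh: "dagger Z = Z"
    by (simp add: Z_def dagger_diff dagger_scaleR dagger_mult P \<tau>h psd_hermitian[OF \<rho>'(1)] matrix_mul_assoc)
  have PZ: "?P ** Z = Z"
    by (simp add: Z_def \<tau>_def matrix_diff_ldistrib matrix_scaleR_right matrix_mul_assoc PP tensor_mat_mult orthonormal_projector(1)[OF u])
  have ZQ: "op_le Z Q" unfolding Q_def by (rule op_le_amgm[OF Zh PZ P G c])
  have Q: "psd Q" unfolding Q_def
    using psd_conj[OF psd_self_dagger[of ?g], of ?P] c psd_dagger_self[of "?h ** Z"]
    by (intro psd_add psd_scaleR) (simp_all add: G P)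
  have Q2: "psd Q2" unfolding Q2_def using psd_conj[OF W, of ?P] by (intro psd_scaleR) (simp_all add: P)
  have \<tau>: "psd \<tau>" unfolding \<tau>_def
  proof (intro psd_scaleR psd_tensor_mat R)
    show "psd (onb_projector s u)"
      using psd_self_dagger[of "onb_projector s u"] by (simp add: dagger_onb_projector orthonormal_projector(1)[OF u])
  qed simp
  define GG where "GG = \<tau> + (Q + Q2)"
  have G1: "psd GG" unfolding GG_def by (intro psd_add \<tau> Q Q2)
  have G2: "op_le \<tau> GG" unfolding GG_def op_le_def using psd_add[OF Q Q2] by simp
  have G3: "op_le ((real m / real s) *\<^sub>R (?P ** (\<Psi> ** dagger \<Psi>) ** ?P)) GG"
  proof -
    have "op_le ((real m / real s) *\<^sub>R (?P ** (\<Psi> ** dagger \<Psi>) ** ?P)) ((real m / real s) *\<^sub>R (?P ** (\<rho>' + W) ** ?P))"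
      using op_le_conj[OF le, of ?P] by (intro op_le_scaleR) (simp_all add: P)
    also have "(real m / real s) *\<^sub>R (?P ** (\<rho>' + W) ** ?P) = (\<tau> + Z) + Q2"
      by (simp add: Z_def Q2_def matrix_add_ldistrib matrix_mult_add_rdistrib scaleR_add_right)
    also have "op_le \<dots> ((\<tau> + Q) + Q2)" by (intro op_le_add ZQ op_le_refl)
    finally (op_le_trans) show ?thesis by (simp add: GG_def add.assoc)
  qed
  have tr\<tau>: "Re (trace \<tau>) = Re (trace R)"
    using s by (simp add: \<tau>_def trace_scaleR trace_tensor_mat trace_onb_projector[OF u])
  have trQ: "Re (trace Q) = c * real s + 1 / (2 * c) * (norm (?h ** Z))\<^sup>2"
  proof -
    have "?P ** (?g ** ?g) ** ?P = tensor_mat (onb_projector s u) \<sigma>'"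
      by (simp add: g(2) tensor_mat_mult orthonormal_projector(1)[OF u])
    then show ?thesis
      by (simp add: Q_def trace_add trace_scaleR trace_dagger_mult_self trace_tensor_mat trace_onb_projector[OF u] tr\<sigma>' del: of_real_power)
  qed
  have trQ2: "Re (trace Q2) = real m / real s * (\<Sum>k<s. Re (trace (slice (u k) (u k) W)))"
  proof -
    have "trace (?P ** W ** ?P) = trace (?P ** W)" by (metis PP matrix_mul_assoc trace_mult_commute)
    also have "\<dots> = (\<Sum>k<s. trace (lift (u k) ** (dagger (lift (u k)) ** W)))"
      by (simp add: Plift matrix_sum_left trace_sum matrix_mul_assoc)
    also have "\<dots> = (\<Sum>k<s. trace (slice (u k) (u k) W))"
      by (intro sum.cong refl) (simp add: slice_def trace_mult_commute[of "lift _"])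
    finally show ?thesis by (simp add: Q2_def trace_scaleR)
  qed
  \<comment> \<open>The weight acts on the environment alone, so it commutes with the lifts, and the
    weighted norm splits into exactly the blocks controlled by the choice of the code.\<close>
  have hZ: "(norm (?h ** Z))\<^sup>2 = (\<Sum>k<s. \<Sum>l<s. (norm ((real m / real s) *\<^sub>R slice (u k) (u l) (?h ** \<rho>')
        - (if k = l then (1 / real s) *\<^sub>R (\<Sum>i<m. slice (b i) (b i) (?h ** \<rho>')) else 0)))\<^sup>2)"
  proof -
    define M where "M k l = (real m / real s) *\<^sub>R slice (u k) (u l) \<rho>' - (if k = l then (1 / real s) *\<^sub>R R else 0)" for k l
    have "?P ** \<rho>' ** ?P = (\<Sum>k<s. \<Sum>l<s. lift (u k) ** slice (u k) (u l) \<rho>' ** dagger (lift (u l)))"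
      by (simp add: Plift matrix_sum_left matrix_sum_right slice_def matrix_mul_assoc) (rule sum.swap)
    moreover have "tensor_mat (onb_projector s u) R = (\<Sum>k<s. \<Sum>l<s. lift (u k) ** (if k = l then R else 0) ** dagger (lift (u l)))"
      unfolding tensor_onb_projector
      by (intro sum.cong refl) (simp add: if_distrib if_distribR cong: if_cong)
    moreover have "lift (u k) ** M k l ** dagger (lift (u l)) = (real m / real s) *\<^sub>R (lift (u k) ** slice (u k) (u l) \<rho>' ** dagger (lift (u l)))
        - (1 / real s) *\<^sub>R (lift (u k) ** (if k = l then R else 0) ** dagger (lift (u l)))" for k l
      by (cases "k = l") (simp_all add: M_def matrix_diff_ldistrib matrix_diff_rdistrib matrix_scaleR_left matrix_scaleR_right)
    ultimately have "Z = (\<Sum>k<s. \<Sum>l<s. lift (u k) ** M k l ** dagger (lift (u l)))"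
      by (simp only: Z_def \<tau>_def scaleR_sum_right sum_subtractf)
    then have "?h ** Z = (\<Sum>k<s. \<Sum>l<s. lift (u k) ** (h ** M k l) ** dagger (lift (u l)))"
      by (simp add: matrix_sum_right matrix_mul_assoc tensor_mat_1_lift)
    then have "(norm (?h ** Z))\<^sup>2 = (\<Sum>k<s. \<Sum>l<s. (norm (h ** M k l))\<^sup>2)" by (simp only: norm_sum_lift[OF u])
    moreover have "h ** M k l = (real m / real s) *\<^sub>R slice (u k) (u l) (?h ** \<rho>')
        - (if k = l then (1 / real s) *\<^sub>R (\<Sum>i<m. slice (b i) (b i) (?h ** \<rho>')) else 0)" for k l
      by (simp add: M_def sl R_def matrix_diff_ldistrib matrix_scaleR_right matrix_sum_right)
    ultimately show ?thesis by simp
  qed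
  have "Re (trace GG) \<le> Re (trace R) + t"
  proof -
    have "Re (trace Q) + Re (trace Q2) \<le> c * real s + 1 / c * (norm (?h ** \<rho>'))\<^sup>2 + Re (trace W)"
      using obj unfolding trQ trQ2 hZ u_def[symmetric] by simp
    also have "\<dots> \<le> c * real s + 1 / c * \<kappa> + Re (trace W)"
      using hn c by (intro add_mono mult_left_mono) auto
    also have "c * real s = sqrt (real s * \<kappa>)"
    proof -
      have "c * real s = sqrt (\<kappa> / real s) * sqrt ((real s)\<^sup>2)" by (simp add: c_def)
      also have "\<dots> = sqrt (real s * \<kappa>)" using s by (simp only: real_sqrt_mult[symmetric]) (simp add: power2_eq_square mult_ac)
      finally show ?thesis .
    qed
    also have "1 / c * \<kappa> = sqrt (real s * \<kappa>)"
    proof -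
      have "c * sqrt (real s * \<kappa>) = \<kappa>"
        unfolding c_def using s \<kappa> by (simp only: real_sqrt_mult[symmetric]) (simp add: power2_eq_square[symmetric])
      then show ?thesis using c by (simp add: field_simps)
    qed
    finally show ?thesis by (simp add: GG_def trace_add tr\<tau> t(1))
  qed
  moreover have "(\<Sum>k<s. (norm (dagger (lift (u k)) ** \<Psi>))\<^sup>2) = real s / real m"
  proof -
    have "(norm (dagger (lift (u k)) ** \<Psi>))\<^sup>2 = 1 / real m" if "k < s" for k
      using orthonormalD[OF w that that] s by (intro codeword_block_norm[OF rel' Ne]) auto
    then show ?thesis by simp
  qed
  ultimately have GR: "Re (trace GG) \<le> Re (trace R) + t"
    and tr: "(\<Sum>k<s. (norm (dagger (lift (u k)) ** \<Psi>))\<^sup>2) = real s / real m" by blast+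
  have m: "1 \<le> m" using s by simp
  obtain V :: "'e + 'b \<Rightarrow> complex^'b^'a" where "kraus_complete V"
    "(1 - 2 * t)\<^sup>2 \<le> (\<Sum>p\<in>UNIV. (cmod (trace (V (fst p) ** Ne (snd p) ** onb_projector s w)))\<^sup>2) / (real s)\<^sup>2"
    by (rule code_decoder[OF u w s(1) m rel' R R1 G1 G2[unfolded \<tau>_def] G3 tr GR t(2)]) (rule that)
  with w show ?thesis by (rule that)
qed

subsection \<open>The achievability bound\<close>

text \<open>With purifications \<open>Y = X + D\<close>, Young's inequality for operators gives
  \<open>Y ** dagger Y\<close> below \<open>(1 + \<delta>) *\<^sub>R (X ** dagger X) + (1 + 1 /
  \<delta>) *\<^sub>R (D ** dagger D)\<close>. The squared norm of \<open>D\<close> is at most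
  \<open>2 * \<delta>\<^sup>2\<close>, so weighting with \<delta> itself keeps the error linear:
  \<open>\<delta> + 2 * \<delta> + 2 * \<delta>\<^sup>2\<close>, at most
  \<open>5 * \<delta>\<close>.\<close>

lemma fidelity_perturbation:
  fixes \<rho> \<rho>' :: "complex^'x^'x"
  assumes \<rho>: "psd \<rho>" "Re (trace \<rho>) = 1" and \<rho>': "\<rho>' \<in> smoothing_ball \<delta> \<rho>" and \<delta>: "0 < \<delta>" "\<delta> \<le> 1"
  obtains W where "psd W" "Re (trace W) \<le> 5 * \<delta>" "op_le \<rho> (\<rho>' + W)"
proof -
  have sub: "psd \<rho>'" "Re (trace \<rho>') \<le> 1" and fid: "1 - \<delta>\<^sup>2 \<le> (fidelity \<rho>' \<rho>)\<^sup>2"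
    using \<rho>' by (auto simp: smoothing_ball_def substate_def)
  obtain X Y :: "complex^'x^'x" where X: "op_le (X ** dagger X) \<rho>'" and Y: "Y ** dagger Y = \<rho>"
    and XY: "inner X Y = fidelity \<rho>' \<rho>"
    by (rule fidelity_attained[OF sub(1) \<rho>(1)]) (rule that)
  \<comment> \<open>The ball bounds the squared fidelity, whereas the overlap is the fidelity
    itself; the square is the smaller of the two when the fidelity is at most 1, and otherwise the
    bound is trivial.\<close>
  have F: "1 - \<delta>\<^sup>2 \<le> fidelity \<rho>' \<rho>"
  proof (cases "fidelity \<rho>' \<rho> \<le> 1")
    case True
    then have "(fidelity \<rho>' \<rho>)\<^sup>2 \<le> fidelity \<rho>' \<rho>"
      using fidelity_nonneg[of \<rho>' \<rho>] by (simp add: power2_eq_square mult_left_le_one_le)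
    then show ?thesis using fid by linarith
  next
    case False
    moreover have "0 \<le> \<delta>\<^sup>2" by simp
    ultimately show ?thesis by linarith
  qed
  define D where "D = Y - X"
  have normX: "(norm X)\<^sup>2 \<le> 1"
    using op_le_trace[OF X] sub(2) by (simp add: trace_self_dagger del: of_real_power)
  have normY: "(norm Y)\<^sup>2 = 1"
    using trace_self_dagger[of Y] \<rho>(2) by (simp add: Y del: of_real_power)
  have "(norm D)\<^sup>2 = (norm Y)\<^sup>2 + (norm X)\<^sup>2 - 2 * inner X Y"
    by (simp add: D_def power2_norm_eq_inner inner_diff_left inner_diff_right inner_commute)
  then have D: "(norm D)\<^sup>2 \<le> 2 * \<delta>\<^sup>2" using normX normY XY F by linarith
  define W where "W = \<delta> *\<^sub>R \<rho>' + (1 + 1 / \<delta>) *\<^sub>R (D ** dagger D)"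
  have "psd W" unfolding W_def using \<delta> by (intro psd_add psd_scaleR sub psd_self_dagger) auto
  moreover have "Re (trace W) \<le> 5 * \<delta>"
  proof -
    have "Re (trace W) = \<delta> * Re (trace \<rho>') + (1 + 1 / \<delta>) * (norm D)\<^sup>2"
      by (simp add: W_def trace_add trace_scaleR trace_self_dagger del: of_real_power)
    also have "\<dots> \<le> \<delta> * 1 + (1 + 1 / \<delta>) * (2 * \<delta>\<^sup>2)"
      using sub(2) D \<delta> by (intro add_mono mult_left_mono) auto
    also have "\<dots> = 3 * \<delta> + 2 * (\<delta> * \<delta>)" using \<delta> by (simp add: field_simps power2_eq_square)
    also have "\<dots> \<le> 5 * \<delta>" using mult_left_mono[OF \<delta>(2), of \<delta>] \<delta>(1) by argo
    finally show ?thesis .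
  qed
  moreover have "op_le \<rho> (\<rho>' + W)"
  proof -
    \<comment> \<open>The positive operator \<open>A ** dagger A\<close> is exactly the slack in
      Young's inequality.\<close>
    define A where "A = sqrt \<delta> *\<^sub>R X - (1 / sqrt \<delta>) *\<^sub>R D"
    have "A ** dagger A = \<delta> *\<^sub>R (X ** dagger X) + (1 / \<delta>) *\<^sub>R (D ** dagger D) - X ** dagger D - D ** dagger X"
      using \<delta> by (simp add: A_def dagger_diff dagger_scaleR matrix_diff_ldistrib matrix_diff_rdistrib
          matrix_scaleR_left matrix_scaleR_right scaleR_diff_right)
    moreover have "Y = X + D" by (simp add: D_def)
    ultimately have "((1 + \<delta>) *\<^sub>R (X ** dagger X) + (1 + 1 / \<delta>) *\<^sub>R (D ** dagger D)) - \<rho> = A ** dagger A"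
      unfolding Y[symmetric] by (simp add: dagger_add matrix_add_ldistrib matrix_mult_add_rdistrib scaleR_add_left)
    then have "op_le \<rho> ((1 + \<delta>) *\<^sub>R (X ** dagger X) + (1 + 1 / \<delta>) *\<^sub>R (D ** dagger D))"
      unfolding op_le_def by (simp add: psd_self_dagger)
    also have "op_le \<dots> ((1 + \<delta>) *\<^sub>R \<rho>' + (1 + 1 / \<delta>) *\<^sub>R (D ** dagger D))"
      using \<delta> by (intro op_le_add op_le_scaleR X op_le_refl) simp
    finally (op_le_trans) show ?thesis by (simp add: W_def scaleR_add_left add.assoc)
  qed
  ultimately show ?thesis by (rule that)
qed

text \<open>Intermediate values on the interval up to 1/16, where
  \<open>4 * \<delta> \<le> sqrt \<delta>\<close>. There the inner root is at least
  \<open>10 * \<delta>\<close>, whence \<open>11 * \<delta> \<le> \<delta>'\<close>, and at the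
  right end the formula already exceeds 1. Squaring
  \<open>2 * sqrt (5 * \<delta>') \<le> \<epsilon>\<close> yields the remaining two bounds.\<close>

lemma smoothing_parameter_exists:
  fixes \<epsilon> :: real
  assumes "0 < \<epsilon>" "\<epsilon> \<le> 1"
  obtains \<delta> \<delta>' where "0 < \<delta>" "\<delta> \<le> 1" "\<delta>' = \<delta> + sqrt (4 * sqrt \<delta> - 4 * \<delta>)"
    "\<epsilon> = 2 * sqrt (5 * \<delta>') + 2 * sqrt \<delta>" "11 * \<delta> \<le> \<delta>'" "\<delta>' \<le> 1 / 20" "20 * \<delta>' \<le> \<epsilon>\<^sup>2"
proof -
  define d' where "d' \<delta> = \<delta> + sqrt (4 * sqrt \<delta> - 4 * \<delta>)" for \<delta> :: real
  define f where "f \<delta> = 2 * sqrt (5 * d' \<delta>) + 2 * sqrt \<delta>" for \<delta>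
  have root: "4 * \<delta> \<le> sqrt \<delta>" if "0 \<le> \<delta>" "\<delta> \<le> 1 / 16" for \<delta> :: real
  proof -
    have "sqrt \<delta> \<le> sqrt (1 / 16)" using that by simp
    also have "sqrt (1 / 16 :: real) = 1 / 4" by (rule real_sqrt_unique) (simp_all add: power2_eq_square)
    finally have "sqrt \<delta> * sqrt \<delta> \<le> sqrt \<delta> * (1 / 4)" using that by (intro mult_left_mono) auto
    then show ?thesis using that by simp
  qed
  have ge: "11 * \<delta> \<le> d' \<delta>" if \<delta>: "0 \<le> \<delta>" "\<delta> \<le> 1 / 16" for \<delta>
  proof -
    have "(10 * \<delta>)\<^sup>2 = \<delta> * (100 * \<delta>)" by (simp add: power2_eq_square)
    also have "\<dots> \<le> \<delta> * 12" using \<delta> by (intro mult_left_mono) auto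
    also have "\<dots> \<le> 4 * sqrt \<delta> - 4 * \<delta>" using root[OF \<delta>] by simp
    finally have "10 * \<delta> \<le> sqrt (4 * sqrt \<delta> - 4 * \<delta>)" by (rule real_le_rsqrt)
    then show ?thesis by (simp add: d'_def)
  qed
  have cont: "continuous_on {0..1/16} f"
    unfolding f_def d'_def by (intro continuous_intros)
  have "f 0 \<le> \<epsilon>" using assms by (simp add: f_def d'_def)
  moreover have "\<epsilon> \<le> f (1 / 16)"
  proof -
    have "(1 / 2)\<^sup>2 \<le> 5 * d' (1 / 16)" using ge[of "1 / 16"] by (simp add: power2_eq_square)
    then have "1 / 2 \<le> sqrt (5 * d' (1 / 16))" by (rule real_le_rsqrt)
    moreover have "0 \<le> sqrt (1 / 16 :: real)" by simp
    ultimately show ?thesis using assms(2) unfolding f_def by linarith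
  qed
  ultimately obtain \<delta> where \<delta>: "0 \<le> \<delta>" "\<delta> \<le> 1 / 16" "f \<delta> = \<epsilon>"
    using IVT'[of f 0 \<epsilon> "1 / 16"] cont by auto
  have "\<delta> \<noteq> 0" using \<delta>(3) assms(1) by (auto simp: f_def d'_def)
  then have pos: "0 < \<delta>" using \<delta>(1) by simp
  have d': "11 * \<delta> \<le> d' \<delta>" using ge[OF \<delta>(1,2)] .
  have "2 * sqrt (5 * d' \<delta>) \<le> \<epsilon>" using \<delta> by (auto simp: f_def)
  then have "(2 * sqrt (5 * d' \<delta>))\<^sup>2 \<le> \<epsilon>\<^sup>2" using d' pos by (intro power_mono) auto
  then have sq: "20 * d' \<delta> \<le> \<epsilon>\<^sup>2" using d' pos by (simp add: power_mult_distrib)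
  moreover have "\<epsilon>\<^sup>2 \<le> 1" using assms by (simp add: power_le_one)
  ultimately have "d' \<delta> \<le> 1 / 20" by simp
  then show ?thesis using that[of \<delta> "d' \<delta>"] pos \<delta> d' sq by (simp add: f_def d'_def)
qed

section \<open>From explicit codes to the capacity\<close>

lemma vec_dim_le_card: "vec.dim M \<le> CARD('n)" for M :: "(complex^'n) set"
  using vec.dim_subset[OF subset_UNIV[of M]] by (metis vec.dim_UNIV vec_dim_card)

lemma stinespring_kraus_normalized:
  assumes "stinespring_isometry U N"
  shows "(\<Sum>e\<in>UNIV. dagger (stinespring_kraus U e) ** stinespring_kraus U e) = mat 1"
proof -
  have "(dagger U ** U) $ i $ j = (\<Sum>e\<in>UNIV. dagger (stinespring_kraus U e) ** stinespring_kraus U e) $ i $ j" for i j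
    by (simp add: matrix_matrix_mult_def dagger_def stinespring_kraus_def sum_UNIV_prod) (rule sum.swap)
  then show ?thesis using assms by (simp add: stinespring_isometry_def vec_eq_iff)
qed

text \<open>The Kraus index type \<open>'f\<close> is arbitrary because the constructed decoder is
  indexed by \<open>'e + 'b\<close>, while the optimum was found over
  \<open>'b \<times> 'a\<close>.\<close>

lemma ent_fidelity_ge:
  fixes N :: "complex^'a^'a \<Rightarrow> complex^'b^'b" and U :: "complex^'a^('b::finite \<times> 'e::finite)"
    and \<Phi> :: "(complex^'a) set \<Rightarrow> complex^('a::finite \<times> 'a)" and V :: "'f::finite \<Rightarrow> complex^'b^'a"
  assumes U: "stinespring_isometry U N"
    and \<Phi>: "\<And>M. vec.subspace M \<Longrightarrow> M \<noteq> {0} \<Longrightarrow> max_entangled M (\<Phi> M)"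
    and w: "orthonormal s w" and s: "1 \<le> s" and V: "kraus_complete V"
  shows "(\<Sum>p\<in>UNIV. (cmod (trace (V (fst p) ** stinespring_kraus U (snd p) ** onb_projector s w)))\<^sup>2) / (real s)\<^sup>2
    \<le> ent_fidelity \<Phi> N s"
proof -
  let ?M = "vec.span (w ` {..<s})"
  note M = orthonormal_span[OF w]
  have s': "s \<le> CARD('a)" using vec_dim_le_card[of ?M] unfolding M(1) .
  have sub: "vec.subspace ?M" by simp
  have ne: "?M \<noteq> {0}"
  proof
    assume eq: "?M = {0}"
    have "s = 0" using M(1) unfolding eq by simp
    then show False using s by simp
  qed
  have le: "entanglement_fidelity (\<Phi> ?M) (kraus_map V \<circ> N) \<le> ent_fidelity \<Phi> N s"
  proof (rule optimal_decoder[OF U \<Phi> s s'])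
    fix S and V' :: "'b \<times> 'a \<Rightarrow> complex^'b^'a"
    assume max: "\<And>M D. vec.subspace M \<Longrightarrow> vec.dim M = s \<Longrightarrow> quantum_channel D \<Longrightarrow>
      entanglement_fidelity (\<Phi> M) (D \<circ> N) \<le> ent_fidelity \<Phi> N s"
    show "entanglement_fidelity (\<Phi> ?M) (kraus_map V \<circ> N) \<le> ent_fidelity \<Phi> N s"
      by (rule max[OF sub M(1) quantum_channel_kraus_map[OF V]])
  qed
  have "entanglement_fidelity (\<Phi> ?M) (kraus_map V \<circ> N)
    = (\<Sum>p\<in>UNIV. (cmod (trace (V (fst p) ** stinespring_kraus U (snd p) ** onb_projector s w)))\<^sup>2) / (real s)\<^sup>2"
    unfolding stinespring_kraus_map[OF U] kraus_map_compose
    using entanglement_fidelity_kraus_map[OF \<Phi>[OF sub ne] M(2)] unfolding M(1) .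
  with le show ?thesis by simp
qed

text \<open>A one-dimensional code is decoded perfectly by preparing its only state.\<close>

lemma ent_fidelity_1:
  fixes N :: "complex^'a^'a \<Rightarrow> complex^'b^'b" and U :: "complex^'a^('b::finite \<times> 'e::finite)"
    and \<Phi> :: "(complex^'a) set \<Rightarrow> complex^('a::finite \<times> 'a)"
  assumes U: "stinespring_isometry U N"
    and \<Phi>: "\<And>M. vec.subspace M \<Longrightarrow> M \<noteq> {0} \<Longrightarrow> max_entangled M (\<Phi> M)"
  shows "1 \<le> ent_fidelity \<Phi> N 1"
proof -
  fix a0 :: 'a
  define w where "w = (\<lambda>_ :: nat. axis a0 1 :: complex^'a)"
  define V where "V = (\<lambda>j :: 'b. matrix_unit a0 j :: complex^'b^'a)"
  have w: "orthonormal 1 w" by (simp add: orthonormal_def w_def cinner_axis)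
  have V: "kraus_complete V"
  proof -
    have "(dagger (V j) ** V j) $ p $ q = (if j = p then (if p = q then 1 else 0) else 0)" for j p q
    proof -
      have "(dagger (V j) ** V j) $ p $ q = (\<Sum>k\<in>UNIV. if k = a0 then (if j = p then (if p = q then 1 else 0) else 0) else 0)"
        unfolding V_def matrix_matrix_mult_def dagger_def matrix_unit_def vec_lambda_beta by (intro sum.cong refl) auto
      then show ?thesis by simp
    qed
    then show ?thesis by (simp add: vec_eq_iff mat_def)
  qed
  have "trace (V j ** A ** onb_projector 1 w) = (A *v axis a0 1) $ j" for j and A :: "complex^'a^'b"
  proof -
    have "trace (V j ** A ** onb_projector 1 w) = ((V j ** A) *v axis a0 1) $ a0"
      by (simp add: onb_projector_def trace_mult_proj w_def cinner_axis)
    also have "\<dots> = (\<Sum>k\<in>UNIV. V j $ a0 $ k * (A *v axis a0 1) $ k)"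
      by (simp add: matrix_vector_mul_assoc[symmetric]) (simp add: matrix_vector_mult_def)
    also have "\<dots> = (\<Sum>k\<in>UNIV. if k = j then (A *v axis a0 1) $ j else 0)"
      by (intro sum.cong refl) (auto simp: V_def matrix_unit_def)
    finally show ?thesis by simp
  qed
  then have "(\<Sum>p\<in>UNIV. (cmod (trace (V (fst p) ** stinespring_kraus U (snd p) ** onb_projector 1 w)))\<^sup>2) / (real 1)\<^sup>2
    = (\<Sum>j\<in>UNIV. \<Sum>e\<in>UNIV. (cmod ((stinespring_kraus U e *v axis a0 1) $ j))\<^sup>2)"
    by (simp add: sum_UNIV_prod)
  also have "\<dots> = (\<Sum>e\<in>UNIV. \<Sum>j\<in>UNIV. (cmod ((stinespring_kraus U e *v axis a0 1) $ j))\<^sup>2)" by (rule sum.swap)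
  also have "\<dots> = (\<Sum>e\<in>UNIV. (norm (stinespring_kraus U e *v axis a0 1))\<^sup>2)"
    by (simp add: norm_vec_def L2_set_def sum_nonneg)
  also have "\<dots> = (norm (axis a0 1 :: complex^'a))\<^sup>2" by (rule kraus_norm_sum[OF stinespring_kraus_normalized[OF U]])
  also have "\<dots> = 1" by simp
  finally show ?thesis using ent_fidelity_ge[OF U \<Phi> w order_refl V] by simp
qed

lemma capacity_ge:
  fixes \<Phi> :: "(complex^'a) set \<Rightarrow> complex^('a::finite \<times> 'a)"
  assumes "1 \<le> m" "m \<le> CARD('a)" "1 - \<epsilon>\<^sup>2 \<le> ent_fidelity \<Phi> N m"
  shows "log 2 (real m) \<le> one_shot_capacity \<Phi> N \<epsilon>"
  unfolding one_shot_capacity_def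
proof (rule Max_ge)
  show "finite {log 2 (real m) |m. 1 \<le> m \<and> m \<le> CARD('a) \<and> 1 - \<epsilon>\<^sup>2 \<le> ent_fidelity \<Phi> N m}"
    by (rule finite_subset[of _ "(\<lambda>m. log 2 (real m)) ` {..CARD('a)}"]) auto
qed (use assms in auto)

lemma slice_mono: "op_le A B \<Longrightarrow> Re (trace (slice u u A)) \<le> Re (trace (slice u u B))"
  unfolding slice_def using op_le_trace[OF op_le_conj[of A B "dagger (lift u)"]] by simp

text \<open>A small feasible \<kappa> would allow a large code: rank \<open>s\<close> at least
  \<open>\<delta>'\<^sup>2 / \<kappa>\<close> reaches the required fidelity, so it is at most
  \<open>2 powr\<close> the capacity. The claim is this inequality solved for \<kappa>.\<close>

lemma min_entropy_bound:
  fixes N :: "complex^'a^'a \<Rightarrow> complex^'b^'b" and U :: "complex^'a^('b::finite \<times> 'e::finite)"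
    and \<Phi> :: "(complex^'a) set \<Rightarrow> complex^('a::finite \<times> 'a)"
  assumes U: "stinespring_isometry U N"
    and \<Phi>: "\<And>M. vec.subspace M \<Longrightarrow> M \<noteq> {0} \<Longrightarrow> max_entangled M (\<Phi> M)"
    and M: "vec.subspace M" "M \<noteq> {0}"
    and \<delta>: "0 < \<delta>" "11 * \<delta> \<le> \<delta>'" "\<delta>' \<le> 1 / 20" "20 * \<delta>' \<le> \<epsilon>\<^sup>2"
    and \<rho>': "\<rho>' \<in> smoothing_ball \<delta> (ptrace_mid (proj (channel_vec U (\<Phi> M))))"
    and \<sigma>: "state \<sigma>" and le: "0 \<le> \<kappa>" "op_le \<rho>' (\<kappa> *\<^sub>R tensor_mat (mat 1 :: complex^'a^'a) \<sigma>)"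
  shows "\<delta>'\<^sup>2 * 2 powr (- one_shot_capacity \<Phi> N \<epsilon>) \<le> \<kappa>"
proof -
  define m where "m = vec.dim M"
  define Q where "Q = one_shot_capacity \<Phi> N \<epsilon>"
  obtain b b' where b: "orthonormal_basis_of M b" and b': "orthonormal_basis_of M b'"
    and \<phi>: "\<Phi> M = (1 / sqrt (real m)) *\<^sub>R (\<Sum>i<m. tensor_vec (b i) (b' i))"
    using \<Phi>[OF M] unfolding max_entangled_def m_def by blast
  have on: "orthonormal m b" "orthonormal m b'"
    using b b' by (simp_all add: orthonormal_def orthonormal_basis_of_def m_def)
  have m: "1 \<le> m"
  proof (rule ccontr)
    assume "\<not> 1 \<le> m"
    then have dim0: "vec.dim M = 0" unfolding m_def by linarith
    have "vec.span (b ` {..<vec.dim M}) = M" using b by (simp add: orthonormal_basis_of_def)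
    then have "{0} = M" unfolding dim0 by (simp only: lessThan_0 image_empty vec.span_empty)
    with M(2) show False by blast
  qed
  have mA: "m \<le> CARD('a)" unfolding m_def by (rule vec_dim_le_card)
  let ?N = "stinespring_kraus U"
  note Ne = stinespring_kraus_normalized[OF U]
  let ?\<Psi> = "ref_env_mat (channel_vec U (\<Phi> M))"
  let ?\<rho> = "?\<Psi> ** dagger ?\<Psi>"
  have rel: "(dagger (lift (b i)) ** ?\<Psi>) $ e $ \<beta> = complex_of_real (1 / sqrt (real m)) * (?N e *v b' i) $ \<beta>"
    if "i < m" for i e \<beta>
  proof -
    have "\<Phi> M $ (a, k) = complex_of_real (1 / sqrt (real m)) * (\<Sum>j<m. b j $ a * b' j $ k)" for a k
      unfolding \<phi> scaleR_eq_scale vector_smult_component by (simp add: tensor_vec_def)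
    then have "(\<Sum>a\<in>UNIV. cnj (b i $ a) * \<Phi> M $ (a, k)) = complex_of_real (1 / sqrt (real m)) * b' i $ k" for k
    proof -
      assume *: "\<And>a k. \<Phi> M $ (a, k) = complex_of_real (1 / sqrt (real m)) * (\<Sum>j<m. b j $ a * b' j $ k)"
      have "(\<Sum>a\<in>UNIV. cnj (b i $ a) * \<Phi> M $ (a, k))
        = complex_of_real (1 / sqrt (real m)) * (\<Sum>a\<in>UNIV. \<Sum>j<m. cnj (b i $ a) * b j $ a * b' j $ k)"
        unfolding * by (simp add: sum_distrib_left mult_ac)
      also have "(\<Sum>a\<in>UNIV. \<Sum>j<m. cnj (b i $ a) * b j $ a * b' j $ k) = (\<Sum>j<m. cinner (b i) (b j) * b' j $ k)"
        by (subst sum.swap) (simp add: cinner_def sum_distrib_right)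
      also have "\<dots> = (\<Sum>j<m. if j = i then b' i $ k else 0)"
        using orthonormalD[OF on(1)] that by (intro sum.cong) auto
      finally show ?thesis using that by simp
    qed
    moreover have "(dagger (lift (b i)) ** ?\<Psi>) $ e $ \<beta> = (\<Sum>k\<in>UNIV. ?N e $ \<beta> $ k * (\<Sum>a\<in>UNIV. cnj (b i $ a) * \<Phi> M $ (a, k)))"
    proof -
      have "(dagger (lift (b i)) ** ?\<Psi>) $ e $ \<beta> = (\<Sum>a\<in>UNIV. \<Sum>k\<in>UNIV. ?N e $ \<beta> $ k * (cnj (b i $ a) * \<Phi> M $ (a, k)))"
        by (simp add: dagger_lift_mult ref_env_mat_channel_vec sum_distrib_left mult_ac)
      then show ?thesis by (subst (asm) sum.swap) (simp add: sum_distrib_left)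
    qed
    ultimately show ?thesis by (simp add: matrix_vector_mult_def sum_distrib_left mult_ac)
  qed
  have block: "(norm (dagger (lift (b i)) ** ?\<Psi>))\<^sup>2 = 1 / real m" if "i < m" for i
    using codeword_block_norm[OF rel[OF that] Ne _ m] orthonormalD[OF on(2) that that] by simp
  have trace1: "Re (trace ?\<rho>) = 1"
  proof -
    have "Re (trace ?\<rho>) = (\<Sum>p\<in>UNIV. \<Sum>\<beta>\<in>UNIV. (cmod (?\<Psi> $ p $ \<beta>))\<^sup>2)"
      by (simp add: trace_self_dagger norm_matrix_components del: of_real_power of_real_sum)
    also have "\<dots> = (\<Sum>a\<in>UNIV. \<Sum>e\<in>UNIV. (norm (?N e *v (\<chi> k. \<Phi> M $ (a, k))))\<^sup>2)"
      by (simp add: sum_UNIV_prod ref_env_mat_channel_vec norm_vec_def L2_set_def sum_nonneg matrix_vector_mult_def)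
    also have "\<dots> = (\<Sum>a\<in>UNIV. (norm (\<chi> k. \<Phi> M $ (a, k)))\<^sup>2)" by (simp add: kraus_norm_sum[OF Ne])
    also have "\<dots> = (norm (\<Phi> M))\<^sup>2" by (simp add: norm_vec_def L2_set_def sum_nonneg sum_UNIV_prod)
    also have "\<dots> = 1"
    proof -
      have "cinner (\<Sum>i<m. tensor_vec (b i) (b' i)) (\<Sum>i<m. tensor_vec (b i) (b' i))
        = (\<Sum>i<m. \<Sum>j<m. if j = i then 1 else 0)"
        unfolding cinner_sum_sum cinner_tensor_vec
        using orthonormalD[OF on(1)] orthonormalD[OF on(2)] by (intro sum.cong refl) auto
      also have "\<dots> = complex_of_real (real m)" by simp
      finally have "(norm (\<Sum>i<m. tensor_vec (b i) (b' i)))\<^sup>2 = real m"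
        unfolding cinner_self of_real_eq_iff .
      then show ?thesis using m by (simp add: \<phi> power_mult_distrib power_divide)
    qed
    finally show ?thesis .
  qed
  have ball: "\<rho>' \<in> smoothing_ball \<delta> ?\<rho>" using \<rho>' by (simp add: ptrace_mid_proj)
  have \<delta>1: "\<delta> \<le> 1" using \<delta> by simp
  obtain W where W: "psd W" "Re (trace W) \<le> 5 * \<delta>" "op_le ?\<rho> (\<rho>' + W)"
    by (rule fidelity_perturbation[OF psd_self_dagger trace1 ball \<delta>(1) \<delta>1]) (rule that)
  have \<rho>'1: "psd \<rho>'" "Re (trace \<rho>') \<le> 1" using \<rho>' by (auto simp: smoothing_ball_def substate_def)
  \<comment> \<open>The frame \<open>b\<close> carries the whole trace of the true state. Of it
    \<open>W\<close> accounts for at most \<open>5 * \<delta>\<close>, and each of the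
    \<open>m\<close> slices of \<open>\<rho>'\<close> for at most \<kappa>. This makes \<kappa>
    positive and later ensures that the code fits into the subspace.\<close>
  have half: "1 / 2 \<le> \<kappa> * real m"
  proof -
    have "1 = (\<Sum>i<m. (norm (dagger (lift (b i)) ** ?\<Psi>))\<^sup>2)" using m by (simp add: block)
    also have "\<dots> = (\<Sum>i<m. Re (trace (slice (b i) (b i) ?\<rho>)))"
    proof (intro sum.cong refl)
      fix i
      have "slice (b i) (b i) ?\<rho> = (dagger (lift (b i)) ** ?\<Psi>) ** dagger (dagger (lift (b i)) ** ?\<Psi>)"
        by (simp add: slice_def dagger_mult matrix_mul_assoc)
      then show "(norm (dagger (lift (b i)) ** ?\<Psi>))\<^sup>2 = Re (trace (slice (b i) (b i) ?\<rho>))"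
        by (simp add: trace_self_dagger)
    qed
    also have "\<dots> \<le> (\<Sum>i<m. Re (trace (slice (b i) (b i) \<rho>')) + Re (trace (slice (b i) (b i) W)))"
      using slice_mono[OF W(3)] by (intro sum_mono) (simp add: slice_add trace_add)
    also have "\<dots> = (\<Sum>i<m. Re (trace (slice (b i) (b i) \<rho>'))) + (\<Sum>i<m. Re (trace (slice (b i) (b i) W)))"
      by (rule sum.distrib)
    also have "\<dots> \<le> (\<Sum>i<m. \<kappa>) + Re (trace W)"
    proof (intro add_mono sum_mono bessel_trace_slice(1)[OF on(1) W(1)])
      fix i assume "i \<in> {..<m}"
      then have "dagger (lift (b i)) ** lift (b i) = (mat 1 :: complex^'e^'e)"
        using orthonormalD[OF on(1), of i i] by (intro dagger_lift_lift_orthonormal(1)) simp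
      then have "slice (b i) (b i) (\<kappa> *\<^sub>R tensor_mat (mat 1) \<sigma>) = \<kappa> *\<^sub>R \<sigma>"
        by (simp add: slice_def matrix_scaleR_left matrix_scaleR_right dagger_lift_tensor_mat_1 matrix_mul_assoc[symmetric])
      then show "Re (trace (slice (b i) (b i) \<rho>')) \<le> \<kappa>"
        using slice_mono[OF le(2), of "b i"] \<sigma> by (simp add: trace_scaleR state_def)
    qed
    finally show ?thesis using W(2) \<delta> by (simp add: mult.commute)
  qed
  have \<kappa>: "0 < \<kappa>"
  proof (rule ccontr)
    assume "\<not> 0 < \<kappa>"
    then have "\<kappa> = 0" using le(1) by simp
    then show False using half by simp
  qed
  have \<delta>': "0 < \<delta>'" using \<delta> by simp
  define x where "x = \<delta>'\<^sup>2 / \<kappa>"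
  have "x \<le> 2 powr Q"
  \<comment> \<open>Here a one-dimensional code suffices; it has fidelity 1, so the capacity is
    nonnegative.\<close>
  proof (cases "x \<le> 1")
    case True
    have "1 - \<epsilon>\<^sup>2 \<le> ent_fidelity \<Phi> N 1" by (rule order_trans[OF _ ent_fidelity_1[OF U \<Phi>]]) simp
    then have "0 \<le> Q" using capacity_ge[of 1 \<epsilon> \<Phi> N] by (simp add: Q_def Suc_le_eq)
    then have "2 powr 0 \<le> 2 powr Q" by (intro powr_mono) auto
    then show ?thesis using True by simp
  next
    case False
    \<comment> \<open>Rounding up avoids any loss in the final bound; since \<open>x > 1\<close> it
      at most doubles the rank.\<close>
    define s where "s = nat \<lceil>x\<rceil>"
    have s: "x \<le> real s" "real s \<le> 2 * x" "1 \<le> s" using False unfolding s_def by linarith+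
    have x\<kappa>: "x * \<kappa> = \<delta>'\<^sup>2" using \<kappa> by (simp add: x_def)
    have "2 * x \<le> real m"
    proof -
      have "2 * x * \<kappa> \<le> 1 / 2"
      proof -
        have "\<delta>'\<^sup>2 \<le> (1 / 20)\<^sup>2" using \<delta>' \<delta>(3) by (intro power_mono) auto
        then show ?thesis using x\<kappa> by (simp add: power2_eq_square)
      qed
      also have "\<dots> \<le> real m * \<kappa>" using half by (simp add: mult.commute)
      finally show ?thesis using \<kappa> by simp
    qed
    then have sm: "s \<le> m" using s(2) by linarith
    define t where "t = 2 * sqrt (real s * \<kappa>) + Re (trace W)"
    \<comment> \<open>The doubling from rounding contributes the root of 2, bounded by 3/2.\<close>
    have "sqrt (real s * \<kappa>) \<le> 3 / 2 * \<delta>'"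
    proof (rule real_le_lsqrt)
      have "real s * \<kappa> \<le> 2 * x * \<kappa>" using s(2) \<kappa> by (intro mult_right_mono) auto
      also have "\<dots> = 2 * \<delta>'\<^sup>2" using x\<kappa> by simp
      also have "\<dots> \<le> (3 / 2 * \<delta>')\<^sup>2" by (simp add: power_mult_distrib power2_eq_square)
      finally show "real s * \<kappa> \<le> (3 / 2 * \<delta>')\<^sup>2" .
    qed (use \<delta>' in simp)
    \<comment> \<open>The two square roots give \<open>3 * \<delta>'\<close>, and \<open>W\<close>
      adds at most \<open>5 * \<delta>\<close>, which is below \<open>\<delta>'\<close> because
      \<open>11 * \<delta> \<le> \<delta>'\<close>.\<close>
    then have t4: "t \<le> 4 * \<delta>'" using W(2) \<delta>(2) \<delta>' unfolding t_def by linarith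
    then have t: "2 * t \<le> 1" using \<delta>(3) by linarith
    obtain w :: "nat \<Rightarrow> complex^'a" and V :: "'e + 'b \<Rightarrow> complex^'b^'a" where w: "orthonormal s w"
      and V: "kraus_complete V"
      and val: "(1 - 2 * t)\<^sup>2 \<le> (\<Sum>p\<in>UNIV. (cmod (trace (V (fst p) ** ?N (snd p) ** onb_projector s w)))\<^sup>2) / (real s)\<^sup>2"
      by (rule decoupling_code[OF on s(3) sm rel Ne \<rho>'1 W(1,3) \<sigma> le(2) \<kappa> t_def t]) (assumption | rule that)+
    have "1 - \<epsilon>\<^sup>2 \<le> (1 - 2 * t)\<^sup>2"
    proof -
      have "(1 - 2 * t)\<^sup>2 = 1 - 4 * t + 4 * t\<^sup>2" by (simp add: power2_eq_square algebra_simps)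
      moreover have "0 \<le> t\<^sup>2" by simp
      ultimately show ?thesis using t4 \<delta>(4) \<delta>' by linarith
    qed
    also note val
    also note ent_fidelity_ge[OF U \<Phi> w s(3) V]
    finally have "log 2 (real s) \<le> Q"
      unfolding Q_def using s(3) sm mA by (intro capacity_ge) auto
    then have "real s \<le> 2 powr Q" using s(3) by (simp add: log_le_iff)
    then show ?thesis using s(1) by simp
  qed
  then have "\<delta>'\<^sup>2 \<le> 2 powr Q * \<kappa>" using \<kappa> by (simp add: x_def pos_divide_le_eq)
  then have "\<delta>'\<^sup>2 * 2 powr (- Q) \<le> 2 powr Q * \<kappa> * 2 powr (- Q)" by (intro mult_right_mono) auto
  also have "\<dots> = \<kappa> * (2 powr Q * 2 powr (- Q))" by (simp only: mult_ac)
  also have "2 powr Q * 2 powr (- Q) = 1" by (simp add: powr_add[symmetric])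
  finally show ?thesis by (simp add: Q_def)
qed

lemma capacity_direct:
  fixes N :: "complex^'a^'a \<Rightarrow> complex^'b^'b" and U :: "complex^'a^('b::finite \<times> 'e::finite)"
    and \<Phi> :: "(complex^'a) set \<Rightarrow> complex^('a::finite \<times> 'a)"
  assumes U: "stinespring_isometry U N"
    and \<Phi>: "\<And>M. vec.subspace M \<Longrightarrow> M \<noteq> {0} \<Longrightarrow> max_entangled M (\<Phi> M)"
    and M: "vec.subspace M" "M \<noteq> {0}"
    and \<delta>: "0 < \<delta>" "11 * \<delta> \<le> \<delta>'" "\<delta>' \<le> 1 / 20" "20 * \<delta>' \<le> \<epsilon>\<^sup>2"
  shows "- smooth_Hmax \<delta> (channel_vec U (\<Phi> M)) \<le> ereal (one_shot_capacity \<Phi> N \<epsilon> - 2 * log 2 \<delta>')"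
proof -
  let ?\<rho> = "ptrace_mid (proj (channel_vec U (\<Phi> M)))" and ?Q = "one_shot_capacity \<Phi> N \<epsilon>"
  have \<delta>': "0 < \<delta>'" using \<delta> by simp
  define c where "c = \<delta>'\<^sup>2 * 2 powr (- ?Q)"
  have c: "0 < c" "log 2 c = 2 * log 2 \<delta>' - ?Q"
    using \<delta>' by (simp_all add: c_def log_mult log_nat_power log_powr)
  have "- Dmax \<rho>' (tensor_mat (mat 1 :: complex^'a^'a) \<sigma>) \<le> ereal (?Q - 2 * log 2 \<delta>')"
    if \<rho>': "\<rho>' \<in> smoothing_ball \<delta> ?\<rho>" and \<sigma>: "state \<sigma>" for \<rho>' \<sigma>
  proof (cases "\<exists>l\<ge>0. op_le \<rho>' (l *\<^sub>R tensor_mat (mat 1 :: complex^'a^'a) \<sigma>)")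
    case True
    let ?L = "{l. 0 \<le> l \<and> op_le \<rho>' (l *\<^sub>R tensor_mat (mat 1 :: complex^'a^'a) \<sigma>)}"
    have "c \<le> Inf ?L"
    proof (rule cInf_greatest)
      show "?L \<noteq> {}" using True by blast
      show "c \<le> l" if "l \<in> ?L" for l
        using min_entropy_bound[OF U \<Phi> M \<delta> \<rho>' \<sigma>, of l] that by (simp add: c_def)
    qed
    then have "elog2 c \<le> elog2 (Inf ?L)" by (rule elog2_mono)
    moreover have "elog2 c = - ereal (?Q - 2 * log 2 \<delta>')" using c by (simp add: elog2_def)
    ultimately have "- ereal (?Q - 2 * log 2 \<delta>') \<le> Dmax \<rho>' (tensor_mat (mat 1 :: complex^'a^'a) \<sigma>)"
      unfolding Dmax_def if_P[OF True] by simp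
    then show ?thesis by (metis ereal_minus_le_minus ereal_uminus_uminus)
  next
    \<comment> \<open>No feasible multiplier means that \<open>Dmax\<close> is infinite, so this
      pair contributes minus infinity to the supremum.\<close>
    case False
    then show ?thesis unfolding Dmax_def if_not_P[OF False] by simp
  qed
  then show ?thesis
    unfolding smooth_Hmax_def smooth_Hmin_def Hmin_def ereal_uminus_uminus by (auto intro!: SUP_least)
qed

theorem theorem12:
  fixes N :: "complex^'a^'a \<Rightarrow> complex^'b^'b"
    and U :: "complex^'a^('b::finite \<times> 'e::finite)"
    and \<Phi> :: "(complex^'a) set \<Rightarrow> complex^('a::finite \<times> 'a)"
    and \<epsilon> :: real
  assumes "quantum_channel N"
    and "stinespring_isometry U N"
    and "\<And>M. vec.subspace M \<Longrightarrow> M \<noteq> {0} \<Longrightarrow> max_entangled M (\<Phi> M)"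
    and "0 < \<epsilon>" and "\<epsilon> \<le> 1"
  shows "\<exists>\<delta> \<delta>'. 0 < \<delta> \<and> \<delta> \<le> 1 \<and>
    \<delta>' = \<delta> + sqrt (4 * sqrt \<delta> - 4 * \<delta>) \<and>
    \<epsilon> = 2 * sqrt (5 * \<delta>') + 2 * sqrt \<delta> \<and>
    (SUP M\<in>{M. vec.subspace M \<and> M \<noteq> {0}}. - smooth_Hmax \<delta> (channel_vec U (\<Phi> M)))
        + ereal (2 * log 2 \<delta>')
      \<le> ereal (one_shot_capacity \<Phi> N \<epsilon>) \<and>
    ereal (one_shot_capacity \<Phi> N \<epsilon>)
      \<le> (SUP M\<in>{M. vec.subspace M \<and> M \<noteq> {0}}. - smooth_Hmax \<epsilon> (channel_vec U (\<Phi> M)))"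
proof -
  obtain \<delta> \<delta>' where \<delta>: "0 < \<delta>" "\<delta> \<le> 1" "\<delta>' = \<delta> + sqrt (4 * sqrt \<delta> - 4 * \<delta>)"
    "\<epsilon> = 2 * sqrt (5 * \<delta>') + 2 * sqrt \<delta>" and bounds: "11 * \<delta> \<le> \<delta>'" "\<delta>' \<le> 1 / 20" "20 * \<delta>' \<le> \<epsilon>\<^sup>2"
    by (rule smoothing_parameter_exists[OF assms(4,5)]) (rule that)
  let ?Q = "one_shot_capacity \<Phi> N \<epsilon>"
  \<comment> \<open>Bounding the supremum by a real number first makes adding the logarithm an
    ordinary cancellation, even if the supremum is minus infinity.\<close>
  have "(SUP M\<in>{M. vec.subspace M \<and> M \<noteq> {0}}. - smooth_Hmax \<delta> (channel_vec U (\<Phi> M))) \<le> ereal (?Q - 2 * log 2 \<delta>')"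
    by (rule SUP_least) (use capacity_direct[OF assms(2,3) _ _ \<delta>(1) bounds] in auto)
  then have "(SUP M\<in>{M. vec.subspace M \<and> M \<noteq> {0}}. - smooth_Hmax \<delta> (channel_vec U (\<Phi> M))) + ereal (2 * log 2 \<delta>')
      \<le> ereal (?Q - 2 * log 2 \<delta>') + ereal (2 * log 2 \<delta>')"
    by (rule add_right_mono)
  then have lower: "(SUP M\<in>{M. vec.subspace M \<and> M \<noteq> {0}}. - smooth_Hmax \<delta> (channel_vec U (\<Phi> M))) + ereal (2 * log 2 \<delta>') \<le> ereal ?Q"
    by simp
  \<comment> \<open>One-dimensional codes make the set nonempty, so the maximum is attained by some
    \<open>m\<close> to which the converse applies.\<close>
  have "?Q \<in> {log 2 (real m) |m. 1 \<le> m \<and> m \<le> CARD('a) \<and> 1 - \<epsilon>\<^sup>2 \<le> ent_fidelity \<Phi> N m}"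
    unfolding one_shot_capacity_def
  proof (rule Max_in)
    show "finite {log 2 (real m) |m. 1 \<le> m \<and> m \<le> CARD('a) \<and> 1 - \<epsilon>\<^sup>2 \<le> ent_fidelity \<Phi> N m}"
      by (rule finite_subset[of _ "(\<lambda>m. log 2 (real m)) ` {..CARD('a)}"]) auto
    have "1 - \<epsilon>\<^sup>2 \<le> ent_fidelity \<Phi> N 1"
      by (rule order_trans[OF _ ent_fidelity_1[OF assms(2,3)]]) simp
    then have "log 2 (real 1) \<in> {log 2 (real m) |m. 1 \<le> m \<and> m \<le> CARD('a) \<and> 1 - \<epsilon>\<^sup>2 \<le> ent_fidelity \<Phi> N m}"
      unfolding mem_Collect_eq by (intro exI[of _ 1]) (simp add: Suc_le_eq)
    then show "{log 2 (real m) |m. 1 \<le> m \<and> m \<le> CARD('a) \<and> 1 - \<epsilon>\<^sup>2 \<le> ent_fidelity \<Phi> N m} \<noteq> {}"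
      by blast
  qed
  then obtain m where m: "?Q = log 2 (real m)" "1 \<le> m" "m \<le> CARD('a)" "1 - \<epsilon>\<^sup>2 \<le> ent_fidelity \<Phi> N m"
    by blast
  have "ereal ?Q \<le> (SUP M\<in>{M. vec.subspace M \<and> M \<noteq> {0}}. - smooth_Hmax \<epsilon> (channel_vec U (\<Phi> M)))"
    unfolding m(1) by (rule capacity_converse[OF assms(2,3) m(2,3,4)])
  with \<delta> lower show ?thesis by blast
qed

end
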